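(* Let $\mathscr{U}$ be a countably incomplete ultrafilter on a set $I$. Let $X$ and $Y$ be quasi-Banach spaces, with $Y$ an ultrasummand. Suppose that either $X$ has the BAP, or $X$ is a $\mathcal{K}$-space and $Y$ has the BAP. Then the following statements are equivalent: (1) Every accessible operator from $X_{\mathscr{U}}$ to $Y_{\mathscr{U}}$ is an ultraproduct of operators. (2) $K[X,Y]$ is finite. (3) $K_0[X,Y]$ is finite. (4) Every quasilinear map from $X$ to $Y$ is trivial. (5) Every exact sequence of quasi-Banach spaces (and bounded linear operators) $0\to Y\to Z\to X\to 0$ splits.
   Context: The ground field is $\mathbb{R}$. A quasinorm on a linear space $X$ is a function $\|\cdot\|:X\to[0,\infty)$, vanishing only at $0$, with $\|tx\|=|t|\|x\|$ and $\|x+y\|\le\Delta(\|x\|+\|y\|)$ for some constant $\Delta$; a complete quasinormed space is a quasi-Banach space. A $p$-norm ($0<p\le 1$) is a quasinorm with $\|x+y\|^p\le\|x\|^p+\|y\|^p$; every quasinorm is equivalent to a $p$-norm for some $p$. Convention: in ultrapowers, $X$ and $Y$ are equipped with $p$-norms for some common $0<p\le1$. The ultrapower $X_{\mathscr{U}}$ is the space of bounded families $(x_i)_{i\in I}$ in $X$ modulo those with $\lim_{\mathscr{U}(i)}\|x_i\|=0$, with quasinorm $\|(x_i)_{\mathscr{U}}\|=\lim_{\mathscr{U}(i)}\|x_i\|$, where $(x_i)_{\mathscr{U}}$ is the class of $(x_i)$. A mapping $f:X_{\mathscr{U}}\to Y_{\mathscr{U}}$ is accessible if there are mappings $f_i:X\to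 Y$ ($i\in I$) with $f((x_i)_{\mathscr{U}})=(f_i(x_i))_{\mathscr{U}}$ for every bounded family $(x_i)$; we write $f=(f_i)_{\mathscr{U}}$. An accessible operator is an accessible map that is a bounded linear operator. It is an ultraproduct of operators if it equals $(u_i)_{\mathscr{U}}$ for some uniformly bounded family of bounded linear operators $u_i:X\to Y$. A map $f:X\to Y$ is homogeneous if $f(tx)=tf(x)$ for all $t\in\mathbb{R}$; for homogeneous $f$, $\|f\|=\sup_{\|x\|=1}\|f(x)\|\in[0,\infty]$, and $f$ is bounded if $\|f\|<\infty$. $f$ is quasilinear if it is homogeneous and there is a constant $Q$ with $\|f(x+y)-f(x)-f(y)\|\le Q(\|x\|+\|y\|)$ for all $x,y$; the least such $Q$ is $Q[f]$. A quasilinear $f$ is trivial if there is a linear (not necessarily bounded) map $\ell:X\to Y$ with $\|f-\ell\|<\infty$. $K_0[X,Y]$ is the infimum of the constants $C$ such that for every bounded quasilinear map $f:X\to Y$ there is a linear map $\ell:X\to Y$ with $\|f-\ell\|\le CQ[f]$ ($=\infty$ if there is no such $C$). $K[X,Y]$ is defined in the same way with the word "bounded" omitted. $X$ is a $\mathcal{K}$-space if $K[X,\mathbb{R}]<\infty$. A quasi-Banach space $Y$ is an ultrasummand if, for every ultrapower of $Y$ (over every index set and ultrafilter), the image of $Y$ under the diagonal embedding is the range of a bounded linear projection on the ultrapower. $X$ has the bounded approximation property (BAP) if there is $\lambda\ge1$ such that for every finite-dimensional subspace $E\subset X$ and every $\varepsilon>0$ there is a finite-rank operator $t\in L(X)$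 with $\|t\|\le\lambda$ and $\|t(x)-x\|\le\varepsilon\|x\|$ for all $x\in E$. An exact sequence $0\to Y\xrightarrow{\jmath}Z\xrightarrow{\varpi}X\to0$ (bounded linear maps, kernel of each arrow equal to the image of the preceding one) splits if there is a bounded linear operator $u:Z\to Y$ with $u\circ\jmath=\mathbf{1}_Y$, equivalently a bounded linear operator $v:X\to Z$ with $\varpi\circ v=\mathbf{1}_X$. *)

theory Defs
  imports "HOL-Analysis.Analysis"
begin

section \<open>Quasinormed spaces\<close>

text \<open>A quasinormed space is a type of class \<open>real_vector\<close> together with an explicit quasinorm;
  an instance of \<open>real_normed_vector\<close> would force the triangle inequality.\<close>

definition quasinorm :: "('a::real_vector \<Rightarrow> real) \<Rightarrow> bool" where
  "quasinorm N \<longleftrightarrow>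
     (\<forall>x. 0 \<le> N x) \<and> (\<forall>x. N x = 0 \<longrightarrow> x = 0) \<and>
     (\<forall>t x. N (t *\<^sub>R x) = \<bar>t\<bar> * N x) \<and>
     (\<exists>\<Delta>. \<forall>x y. N (x + y) \<le> \<Delta> * (N x + N y))"

definition quasi_complete :: "('a::real_vector \<Rightarrow> real) \<Rightarrow> bool" where
  "quasi_complete N \<longleftrightarrow>
     (\<forall>s :: nat \<Rightarrow> 'a. (\<forall>e>0. \<exists>n0. \<forall>m\<ge>n0. \<forall>n\<ge>n0. N (s m - s n) < e) \<longrightarrow>
        (\<exists>x. (\<lambda>n. N (s n - x)) \<longlonglongrightarrow> 0))"

definition quasi_banach :: "('a::real_vector \<Rightarrow> real) \<Rightarrow> bool" where
  "quasi_banach N \<longleftrightarrow> quasinorm N \<and> quasi_complete N"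

definition p_norm :: "real \<Rightarrow> ('a::real_vector \<Rightarrow> real) \<Rightarrow> bool" where
  "p_norm p N \<longleftrightarrow> 0 < p \<and> p \<le> 1 \<and> quasinorm N \<and>
     (\<forall>x y. N (x + y) powr p \<le> N x powr p + N y powr p)"

definition equivalent_quasinorms :: "('a \<Rightarrow> real) \<Rightarrow> ('a \<Rightarrow> real) \<Rightarrow> bool" where
  "equivalent_quasinorms N M \<longleftrightarrow>
     (\<exists>c>0. \<exists>C>0. \<forall>x. c * N x \<le> M x \<and> M x \<le> C * N x)"

definition bounded_operator ::
  "('a::real_vector \<Rightarrow> real) \<Rightarrow> ('b::real_vector \<Rightarrow> real) \<Rightarrow> ('a \<Rightarrow> 'b) \<Rightarrow> bool" where
  "bounded_operator NA NB u \<longleftrightarrow> linear u \<and> (\<exists>C. \<forall>x. NB (u x) \<le> C * NA x)"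

section \<open>Homogeneous and quasilinear maps\<close>

definition homogeneous :: "('a::real_vector \<Rightarrow> 'b::real_vector) \<Rightarrow> bool" where
  "homogeneous f \<longleftrightarrow> (\<forall>t x. f (t *\<^sub>R x) = t *\<^sub>R f x)"

text \<open>Meaningful for homogeneous maps; it is the operator norm for linear ones.\<close>

definition hom_norm ::
  "('a \<Rightarrow> real) \<Rightarrow> ('b \<Rightarrow> real) \<Rightarrow> ('a \<Rightarrow> 'b) \<Rightarrow> ennreal" where
  "hom_norm NX NY f = (SUP x\<in>{x. NX x = 1}. ennreal (NY (f x)))"

definition quasilinear_bound ::
  "('a::real_vector \<Rightarrow> real) \<Rightarrow> ('b::real_vector \<Rightarrow> real) \<Rightarrow> ('a \<Rightarrow> 'b) \<Rightarrow> real \<Rightarrow> bool" where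
  "quasilinear_bound NX NY f Q \<longleftrightarrow> (\<forall>x y. NY (f (x + y) - f x - f y) \<le> Q * (NX x + NX y))"

definition quasilinear ::
  "('a::real_vector \<Rightarrow> real) \<Rightarrow> ('b::real_vector \<Rightarrow> real) \<Rightarrow> ('a \<Rightarrow> 'b) \<Rightarrow> bool" where
  "quasilinear NX NY f \<longleftrightarrow> homogeneous f \<and> (\<exists>Q. quasilinear_bound NX NY f Q)"

text \<open>The restriction to \<open>Q \<ge> 0\<close> only matters for the zero space, where every real number is
  a bound.\<close>

definition quasilinear_const ::
  "('a::real_vector \<Rightarrow> real) \<Rightarrow> ('b::real_vector \<Rightarrow> real) \<Rightarrow> ('a \<Rightarrow> 'b) \<Rightarrow> real" where
  "quasilinear_const NX NY f = Inf {Q. 0 \<le> Q \<and> quasilinear_bound NX NY f Q}"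

definition trivial_quasilinear ::
  "('a::real_vector \<Rightarrow> real) \<Rightarrow> ('b::real_vector \<Rightarrow> real) \<Rightarrow> ('a \<Rightarrow> 'b) \<Rightarrow> bool" where
  "trivial_quasilinear NX NY f \<longleftrightarrow>
     (\<exists>l. linear l \<and> hom_norm NX NY (\<lambda>x. f x - l x) < \<infinity>)"

definition K0_const ::
  "('a::real_vector \<Rightarrow> real) \<Rightarrow> ('b::real_vector \<Rightarrow> real) \<Rightarrow> ennreal" where
  "K0_const NX NY = Inf {ennreal C | C. 0 \<le> C \<and>
     (\<forall>f. quasilinear NX NY f \<and> hom_norm NX NY f < \<infinity> \<longrightarrow>
        (\<exists>l. linear l \<and>
           hom_norm NX NY (\<lambda>x. f x - l x) \<le> ennreal (C * quasilinear_const NX NY f)))}"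

definition K_const ::
  "('a::real_vector \<Rightarrow> real) \<Rightarrow> ('b::real_vector \<Rightarrow> real) \<Rightarrow> ennreal" where
  "K_const NX NY = Inf {ennreal C | C. 0 \<le> C \<and>
     (\<forall>f. quasilinear NX NY f \<longrightarrow>
        (\<exists>l. linear l \<and>
           hom_norm NX NY (\<lambda>x. f x - l x) \<le> ennreal (C * quasilinear_const NX NY f)))}"

definition K_space :: "('a::real_vector \<Rightarrow> real) \<Rightarrow> bool" where
  "K_space NX \<longleftrightarrow> K_const NX (abs :: real \<Rightarrow> real) < \<infinity>"

section \<open>The bounded approximation property\<close>

definition finite_dim_subspace :: "'a::real_vector set \<Rightarrow> bool" where
  "finite_dim_subspace E \<longleftrightarrow> (\<exists>B. finite B \<and> E = span B)"

definition BAP :: "('a::real_vector \<Rightarrow> real) \<Rightarrow> bool" where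
  "BAP N \<longleftrightarrow> (\<exists>K\<ge>1. \<forall>E. finite_dim_subspace E \<longrightarrow> (\<forall>\<epsilon>>0.
     \<exists>t. bounded_operator N N t \<and> finite_dim_subspace (range t) \<and>
         hom_norm N N t \<le> ennreal K \<and> (\<forall>x\<in>E. N (t x - x) \<le> \<epsilon> * N x)))"

section \<open>Exact sequences\<close>

definition short_exact ::
  "('y::real_vector \<Rightarrow> real) \<Rightarrow> ('z::real_vector \<Rightarrow> real) \<Rightarrow> ('x::real_vector \<Rightarrow> real) \<Rightarrow>
   ('y \<Rightarrow> 'z) \<Rightarrow> ('z \<Rightarrow> 'x) \<Rightarrow> bool" where
  "short_exact NY NZ NX j q \<longleftrightarrow>
     bounded_operator NY NZ j \<and> bounded_operator NZ NX q \<and>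
     {y. j y = 0} = {0} \<and> {z. q z = 0} = range j \<and> range q = UNIV"

definition sequence_splits ::
  "('y::real_vector \<Rightarrow> real) \<Rightarrow> ('z::real_vector \<Rightarrow> real) \<Rightarrow> ('y \<Rightarrow> 'z) \<Rightarrow> bool" where
  "sequence_splits NY NZ j \<longleftrightarrow> (\<exists>u. bounded_operator NZ NY u \<and> u \<circ> j = id)"

text \<open>All exact sequences whose middle space has underlying vector space \<open>'z\<close>.\<close>

definition exact_sequences_split ::
  "'z::real_vector itself \<Rightarrow> ('y::real_vector \<Rightarrow> real) \<Rightarrow> ('x::real_vector \<Rightarrow> real) \<Rightarrow> bool" where
  "exact_sequences_split _ NY NX \<longleftrightarrow>
     (\<forall>(NZ :: 'z \<Rightarrow> real) j q. quasi_banach NZ \<and> short_exact NY NZ NX j q \<longrightarrow>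
        sequence_splits NY NZ j)"

section \<open>Ultrapowers\<close>

definition ultrafilter :: "'i filter \<Rightarrow> bool" where
  "ultrafilter U \<longleftrightarrow> U \<noteq> bot \<and> (\<forall>P. eventually P U \<or> eventually (\<lambda>i. \<not> P i) U)"

definition countably_incomplete :: "'i filter \<Rightarrow> bool" where
  "countably_incomplete U \<longleftrightarrow>
     (\<exists>A :: nat \<Rightarrow> 'i set. (\<forall>n. eventually (\<lambda>i. i \<in> A n) U) \<and>
        \<not> eventually (\<lambda>i. i \<in> (\<Inter>n. A n)) U)"

definition bounded_families :: "('a \<Rightarrow> real) \<Rightarrow> ('i \<Rightarrow> 'a) set" where
  "bounded_families N = {x. \<exists>C. \<forall>i. N (x i) \<le> C}"

definition ultra_rel ::
  "'i filter \<Rightarrow> ('a::real_vector \<Rightarrow> real) \<Rightarrow> (('i \<Rightarrow> 'a) \<times> ('i \<Rightarrow> 'a)) set" where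
  "ultra_rel U N = {(x, y). x \<in> bounded_families N \<and> y \<in> bounded_families N \<and>
     ((\<lambda>i. N (x i - y i)) \<longlongrightarrow> 0) U}"

definition ultrapower ::
  "'i filter \<Rightarrow> ('a::real_vector \<Rightarrow> real) \<Rightarrow> ('i \<Rightarrow> 'a) set set" where
  "ultrapower U N = bounded_families N // ultra_rel U N"

definition ultra_class ::
  "'i filter \<Rightarrow> ('a::real_vector \<Rightarrow> real) \<Rightarrow> ('i \<Rightarrow> 'a) \<Rightarrow> ('i \<Rightarrow> 'a) set" where
  "ultra_class U N x = ultra_rel U N `` {x}"

text \<open>The operations and the quasinorm of the ultrapower, computed on representatives. They are
  independent of the representatives when \<open>N\<close> is a \<open>p\<close>-norm; for a general quasinorm this
  fails for \<open>ultra_norm\<close>.\<close>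

definition ultra_add ::
  "'i filter \<Rightarrow> ('a::real_vector \<Rightarrow> real) \<Rightarrow> ('i \<Rightarrow> 'a) set \<Rightarrow> ('i \<Rightarrow> 'a) set \<Rightarrow> ('i \<Rightarrow> 'a) set" where
  "ultra_add U N \<xi> \<eta> = (\<Union>x\<in>\<xi>. \<Union>y\<in>\<eta>. ultra_class U N (\<lambda>i. x i + y i))"

definition ultra_scale ::
  "'i filter \<Rightarrow> ('a::real_vector \<Rightarrow> real) \<Rightarrow> real \<Rightarrow> ('i \<Rightarrow> 'a) set \<Rightarrow> ('i \<Rightarrow> 'a) set" where
  "ultra_scale U N t \<xi> = (\<Union>x\<in>\<xi>. ultra_class U N (\<lambda>i. t *\<^sub>R x i))"

definition ultra_norm ::
  "'i filter \<Rightarrow> ('a::real_vector \<Rightarrow> real) \<Rightarrow> ('i \<Rightarrow> 'a) set \<Rightarrow> real" where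
  "ultra_norm U N \<xi> = the_elem ((\<lambda>x. Lim U (\<lambda>i. N (x i))) ` \<xi>)"

definition ultra_bounded_operator ::
  "'i filter \<Rightarrow> ('a::real_vector \<Rightarrow> real) \<Rightarrow> ('b::real_vector \<Rightarrow> real) \<Rightarrow>
   (('i \<Rightarrow> 'a) set \<Rightarrow> ('i \<Rightarrow> 'b) set) \<Rightarrow> bool" where
  "ultra_bounded_operator U NX NY f \<longleftrightarrow>
     (\<forall>\<xi>\<in>ultrapower U NX. f \<xi> \<in> ultrapower U NY) \<and>
     (\<forall>\<xi>\<in>ultrapower U NX. \<forall>\<eta>\<in>ultrapower U NX.
        f (ultra_add U NX \<xi> \<eta>) = ultra_add U NY (f \<xi>) (f \<eta>)) \<and>
     (\<forall>t. \<forall>\<xi>\<in>ultrapower U NX. f (ultra_scale U NX t \<xi>) = ultra_scale U NY t (f \<xi>)) \<and>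
     (\<exists>C. \<forall>\<xi>\<in>ultrapower U NX. ultra_norm U NY (f \<xi>) \<le> C * ultra_norm U NX \<xi>)"

definition is_ultraproduct_map ::
  "'i filter \<Rightarrow> ('a::real_vector \<Rightarrow> real) \<Rightarrow> ('b::real_vector \<Rightarrow> real) \<Rightarrow>
   (('i \<Rightarrow> 'a) set \<Rightarrow> ('i \<Rightarrow> 'b) set) \<Rightarrow> ('i \<Rightarrow> 'a \<Rightarrow> 'b) \<Rightarrow> bool" where
  "is_ultraproduct_map U NX NY f g \<longleftrightarrow>
     (\<forall>x\<in>bounded_families NX.
        (\<lambda>i. g i (x i)) \<in> bounded_families NY \<and>
        f (ultra_class U NX x) = ultra_class U NY (\<lambda>i. g i (x i)))"

definition accessible ::
  "'i filter \<Rightarrow> ('a::real_vector \<Rightarrow> real) \<Rightarrow> ('b::real_vector \<Rightarrow> real) \<Rightarrow>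
   (('i \<Rightarrow> 'a) set \<Rightarrow> ('i \<Rightarrow> 'b) set) \<Rightarrow> bool" where
  "accessible U NX NY f \<longleftrightarrow> (\<exists>g. is_ultraproduct_map U NX NY f g)"

definition accessible_operator ::
  "'i filter \<Rightarrow> ('a::real_vector \<Rightarrow> real) \<Rightarrow> ('b::real_vector \<Rightarrow> real) \<Rightarrow>
   (('i \<Rightarrow> 'a) set \<Rightarrow> ('i \<Rightarrow> 'b) set) \<Rightarrow> bool" where
  "accessible_operator U NX NY f \<longleftrightarrow>
     accessible U NX NY f \<and> ultra_bounded_operator U NX NY f"

definition ultraproduct_of_operators ::
  "'i filter \<Rightarrow> ('a::real_vector \<Rightarrow> real) \<Rightarrow> ('b::real_vector \<Rightarrow> real) \<Rightarrow>
   (('i \<Rightarrow> 'a) set \<Rightarrow> ('i \<Rightarrow> 'b) set) \<Rightarrow> bool" where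
  "ultraproduct_of_operators U NX NY f \<longleftrightarrow>
     (\<exists>u. (\<forall>i. linear (u i)) \<and> (\<exists>C. \<forall>i x. NY (u i x) \<le> C * NX x) \<and>
        is_ultraproduct_map U NX NY f u)"

text \<open>Ultrapowers over all ultrafilters on the type \<open>'j\<close>. Since an ultrafilter on a set \<open>J\<close>
  generates an ultrafilter on any larger set, with the same ultrapowers, this covers every index
  set that embeds in \<open>'j\<close>. HOL cannot quantify over \<open>'j\<close> inside the definition; for any fixed
  \<open>'j\<close> the property is implied by the one for all index sets.\<close>

definition ultrasummand :: "'j itself \<Rightarrow> ('a::real_vector \<Rightarrow> real) \<Rightarrow> bool" where
  "ultrasummand _ N \<longleftrightarrow>
     (\<forall>V :: 'j filter. ultrafilter V \<longrightarrow>
        (\<exists>P. ultra_bounded_operator V N N P \<and>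
             (\<forall>\<xi>\<in>ultrapower V N. P (P \<xi>) = P \<xi>) \<and>
             P ` ultrapower V N = range (\<lambda>y. ultra_class V N (\<lambda>_. y))))"

end

theory Submission
  imports Defs "HOL-Library.Function_Algebras"
begin

text \<open>
  (1) \<open>\<Leftrightarrow>\<close> (3): the components of an accessible operator may be taken homogeneous; choosing almost
  extremal points in each component shows that they are uniformly bounded along the ultrafilter and
  that their quasilinearity constants tend to \<open>0\<close>. A finite \<open>K\<^sub>0\<close> then replaces them by operators.
  Conversely, if \<open>K\<^sub>0\<close> is infinite, there are bounded maps \<open>g\<^sub>n\<close> with \<open>\<parallel>g\<^sub>n\<parallel> \<le> 1\<close> and
  \<open>Q[g\<^sub>n] \<le> 1/n\<close> at distance at least \<open>1/2\<close> from all linear maps; along a map \<open>i \<mapsto> n(i)\<close> tending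
  to infinity, which exists by countable incompleteness, they form an accessible operator that is
  not an ultraproduct of operators.

  (3) \<open>\<Rightarrow>\<close> (2): the approximation property improves to finite-rank operators that are the identity
  on a given finite-dimensional subspace. Composing a quasilinear map with them, on the right or on
  the left, gives linear maps close to it on any given finite set, with a uniform constant. The
  ultraproduct of these linear maps, followed by the projection onto \<open>Y\<close>, is close everywhere.

  (4) \<open>\<Rightarrow>\<close> (2): an open mapping argument in the space of quasilinear maps that vanish on a Hamel
  basis, which is complete for the quasinorm \<open>Q[\<cdot>]\<close>.

  (4) \<open>\<Leftrightarrow>\<close> (5): a quasilinear map \<open>f\<close> gives the twisted sum with quasinorm
  \<open>\<parallel>y - f x\<parallel> + \<parallel>x\<parallel>\<close>; an exact sequence gives the difference of a bounded homogeneous and a linear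
  section of the quotient map.
\<close>

section \<open>Complete quasinorms and the open mapping theorem\<close>

text \<open>Two obstacles shape the proof. First, a quasilinear map is in general unbounded, so
  finiteness of \<open>K0_const\<close> says nothing about it directly. It is, however, bounded on
  every finite-dimensional subspace, and this brings its compositions with finite-rank operators
  within reach; the constants depend on the norms of the operators, not on their rank. The operators
  must fix the given points exactly, since closeness of \<open>t x\<close> to \<open>x\<close> gives
  no uniform control of \<open>f (t x) - f x\<close>.

  Second, a quasinorm need not be continuous. Limits therefore cost factors of the triangle constant
  \<open>D\<close>, series are taken with ratio \<open>1 / (2 * D)\<close>, and p-norms enter where
  the quasinorm of an ultrapower has to be well defined. As the constants refer to the original
  quasinorms, the bridge to the ultrapowers is \<open>K0_fin\<close>, which is invariant under
  equivalence.

  Completeness is formulated on a carrier set because it is used for the range of an embedding, for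
  finite-dimensional subspaces and for a set of quasilinear maps.\<close>

locale quasi_space =
  fixes S :: "'a::real_vector set" and N :: "'a \<Rightarrow> real" and D :: real
  assumes subspace: "subspace S" and D_ge_1: "1 \<le> D"
    and nonneg: "x \<in> S \<Longrightarrow> 0 \<le> N x"
    and definite: "x \<in> S \<Longrightarrow> N x = 0 \<Longrightarrow> x = 0"
    and scale: "x \<in> S \<Longrightarrow> N (t *\<^sub>R x) = \<bar>t\<bar> * N x"
    and triangle: "x \<in> S \<Longrightarrow> y \<in> S \<Longrightarrow> N (x + y) \<le> D * (N x + N y)"
begin

lemma D_pos: "0 < D"
  using D_ge_1 by simp

lemma mem_diff: "x \<in> S \<Longrightarrow> y \<in> S \<Longrightarrow> x - y \<in> S"
  and mem_add: "x \<in> S \<Longrightarrow> y \<in> S \<Longrightarrow> x + y \<in> S"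
  and mem_scale: "x \<in> S \<Longrightarrow> t *\<^sub>R x \<in> S"
  and mem_zero: "0 \<in> S"
  and mem_sum: "(\<And>i. i \<in> I \<Longrightarrow> f i \<in> S) \<Longrightarrow> sum f I \<in> S"
  using subspace by (auto intro: subspace_diff subspace_add subspace_scale subspace_0 subspace_sum)

lemma zero [simp]: "N 0 = 0"
  using scale[OF mem_zero, of 0] by simp

lemma minus: "x \<in> S \<Longrightarrow> N (- x) = N x"
  using scale[of x "-1"] by simp

lemma diff_commute: "x \<in> S \<Longrightarrow> y \<in> S \<Longrightarrow> N (x - y) = N (y - x)"
  using minus[OF mem_diff, of x y] by simp

lemma triangle_diff: "x \<in> S \<Longrightarrow> y \<in> S \<Longrightarrow> N (x - y) \<le> D * (N x + N y)"
  using triangle[of x "- y"] minus[of y] mem_scale[of y "-1"] by simp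

lemma triangle_via: "x \<in> S \<Longrightarrow> y \<in> S \<Longrightarrow> z \<in> S \<Longrightarrow> N (x - z) \<le> D * (N (x - y) + N (y - z))"
  using triangle[of "x - y" "y - z"] by (simp add: mem_diff)

lemma triangle_from: "x \<in> S \<Longrightarrow> y \<in> S \<Longrightarrow> N x \<le> D * (N (x - y) + N y)"
  using triangle[of "x - y" y] by (simp add: mem_diff)

text \<open>Splitting off a term costs a factor \<open>D\<close>, and the ratio
  \<open>1 / (2 * D)\<close> pays for it: by induction the tail, which has
  \<open>c / (2 * D)\<close> in place of \<open>c\<close>, sums to at most \<open>c\<close>, so the
  whole is at most \<open>D * (c + c)\<close>, whatever \<open>n\<close>.\<close>

lemma geometric_sum_le:
  assumes "\<And>k. x k \<in> S" and "\<And>k. N (x k) \<le> c * (1 / (2 * D)) ^ k"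
  shows "N (\<Sum>k<n. x k) \<le> 2 * D * c"
  using assms
proof (induction n arbitrary: x c)
  case 0
  have "0 \<le> c" using 0(2)[of 0] nonneg[OF 0(1), of 0] by simp
  then show ?case using D_ge_1 by simp
next
  case (Suc n)
  have "N (\<Sum>k<n. x (Suc k)) \<le> 2 * D * (c / (2 * D))"
  proof (rule Suc.IH)
    show "N (x (Suc k)) \<le> c / (2 * D) * (1 / (2 * D)) ^ k" for k
      using Suc.prems(2)[of "Suc k"] by simp
  qed (rule Suc.prems(1))
  then have *: "N (\<Sum>k<n. x (Suc k)) \<le> c" using D_pos by simp
  have "N (\<Sum>k<Suc n. x k) = N (x 0 + (\<Sum>k<n. x (Suc k)))"
    by (simp only: sum.lessThan_Suc_shift)
  also have "\<dots> \<le> D * (N (x 0) + N (\<Sum>k<n. x (Suc k)))"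
    by (intro triangle mem_sum Suc.prems(1))
  also have "\<dots> \<le> D * (c + c)"
    using * Suc.prems(2)[of 0] D_pos by (intro mult_left_mono add_mono) auto
  finally show ?case by simp
qed

lemma geometric_tail_le:
  assumes "\<And>k. x k \<in> S" and "\<And>k. N (x k) \<le> c * (1 / (2 * D)) ^ k"
  shows "N ((\<Sum>k<m + n. x k) - (\<Sum>k<m. x k)) \<le> 2 * D * (c * (1 / (2 * D)) ^ m)"
proof -
  have "(\<Sum>k<m + n. x k) = (\<Sum>k<m. x k) + (\<Sum>k<n. x (m + k))"
    by (induction n) (simp_all add: algebra_simps)
  moreover have "N (\<Sum>k<n. x (m + k)) \<le> 2 * D * (c * (1 / (2 * D)) ^ m)"
  proof (rule geometric_sum_le)
    show "N (x (m + k)) \<le> c * (1 / (2 * D)) ^ m * (1 / (2 * D)) ^ k" for k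
      using assms(2)[of "m + k"] by (simp add: power_add mult.assoc)
  qed (rule assms(1))
  ultimately show ?thesis by simp
qed

text \<open>As \<open>N\<close> may be discontinuous, a bound along the sequence reaches the limit
  only through the triangle inequality via \<open>s n\<close>, at the price of one factor
  \<open>D\<close>.\<close>

lemma lim_bound:
  assumes "\<And>n. s n \<in> S" and "x \<in> S" and "y \<in> S" and "(\<lambda>n. N (s n - x)) \<longlonglongrightarrow> 0"
    and "\<forall>\<^sub>F n in sequentially. N (s n - y) \<le> B"
  shows "N (x - y) \<le> D * B"
proof -
  have "(\<lambda>n. D * (N (s n - x) + B)) \<longlonglongrightarrow> D * (0 + B)"
    by (intro tendsto_intros assms)
  moreover have "\<forall>\<^sub>F n in sequentially. N (x - y) \<le> D * (N (s n - x) + B)"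
    using assms(5)
  proof eventually_elim
    case (elim n)
    have "N (x - y) \<le> D * (N (s n - x) + N (s n - y))"
      using triangle_via[OF assms(2,1,3), of n] diff_commute[OF assms(2,1), of n] by simp
    also have "\<dots> \<le> D * (N (s n - x) + B)"
      using elim D_pos by simp
    finally show ?case .
  qed
  ultimately show ?thesis
    using tendsto_lowerbound[of "\<lambda>n. D * (N (s n - x) + B)" "D * (0 + B)" sequentially]
    by simp
qed

lemma lim_unique:
  assumes "\<And>n. s n \<in> S" and "x \<in> S" and "y \<in> S"
    and "(\<lambda>n. N (s n - x)) \<longlonglongrightarrow> 0" and "(\<lambda>n. N (s n - y)) \<longlonglongrightarrow> 0"
  shows "x = y"
proof -
  have "N (x - y) \<le> 0 + e" if "e > 0" for e
  proof -
    have "\<forall>\<^sub>F n in sequentially. N (s n - y) < e / D"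
      using order_tendstoD(2)[OF assms(5)] that D_pos by simp
    then have "\<forall>\<^sub>F n in sequentially. N (s n - y) \<le> e / D"
      by eventually_elim simp
    from lim_bound[OF assms(1-4) this] show ?thesis using D_pos by simp
  qed
  then have "N (x - y) \<le> 0" by (rule field_le_epsilon)
  then show ?thesis
    using nonneg[OF mem_diff[OF assms(2,3)]] definite[OF mem_diff[OF assms(2,3)]] by simp
qed

lemma tendsto_sandwich_norm:
  assumes "\<And>n. s n \<in> S" and "\<And>n. N (s n) \<le> b n" and "b \<longlonglongrightarrow> 0"
  shows "(\<lambda>n. N (s n)) \<longlonglongrightarrow> 0"
  by (rule tendsto_sandwich[OF _ _ tendsto_const assms(3)]) (auto simp: nonneg assms)

lemma lim_add:
  assumes "\<And>n. s n \<in> S" and "\<And>n. t n \<in> S" and "x \<in> S" and "y \<in> S"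
    and "(\<lambda>n. N (s n - x)) \<longlonglongrightarrow> 0" and "(\<lambda>n. N (t n - y)) \<longlonglongrightarrow> 0"
  shows "(\<lambda>n. N (s n + t n - (x + y))) \<longlonglongrightarrow> 0"
proof (rule tendsto_sandwich_norm)
  show "s n + t n - (x + y) \<in> S" for n
    by (intro mem_diff mem_add assms)
  show "N (s n + t n - (x + y)) \<le> D * (N (s n - x) + N (t n - y))" for n
    using triangle[of "s n - x" "t n - y"] by (simp add: mem_diff assms algebra_simps)
  show "(\<lambda>n. D * (N (s n - x) + N (t n - y))) \<longlonglongrightarrow> 0"
    using tendsto_mult_left[OF tendsto_add[OF assms(5,6)], of D] by simp
qed

lemma lim_scale:
  assumes "\<And>n. s n \<in> S" and "x \<in> S" and "(\<lambda>n. N (s n - x)) \<longlonglongrightarrow> 0"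
  shows "(\<lambda>n. N (r *\<^sub>R s n - r *\<^sub>R x)) \<longlonglongrightarrow> 0"
proof -
  have "N (r *\<^sub>R s n - r *\<^sub>R x) = \<bar>r\<bar> * N (s n - x)" for n
    using scale[of "s n - x" r] by (simp add: mem_diff assms scaleR_diff_right)
  then show ?thesis using tendsto_mult_left[OF assms(3), of "\<bar>r\<bar>"] by simp
qed

end

locale complete_quasi_space = quasi_space +
  assumes complete: "(\<And>n. s n \<in> S) \<Longrightarrow> (\<And>e. e > 0 \<Longrightarrow> \<exists>n0. \<forall>m\<ge>n0. \<forall>n\<ge>n0. N (s m - s n) < e) \<Longrightarrow>
    \<exists>x\<in>S. (\<lambda>n. N (s n - x)) \<longlonglongrightarrow> 0"
begin

lemma ratio_power_tendsto: "(\<lambda>n. c * (1 / (2 * D)) ^ n) \<longlonglongrightarrow> 0"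
  using D_ge_1 tendsto_mult_left[OF LIMSEQ_power_zero[of "1 / (2 * D)"], of c] by simp

lemma geometric_series_converges:
  assumes "\<And>k. x k \<in> S" and "\<And>k. N (x k) \<le> c * (1 / (2 * D)) ^ k"
  obtains y where "y \<in> S" and "(\<lambda>n. N ((\<Sum>k<n. x k) - y)) \<longlonglongrightarrow> 0"
    and "N y \<le> 2 * D\<^sup>2 * c"
proof -
  have S: "(\<Sum>k<n. x k) \<in> S" for n by (intro mem_sum assms)
  have "\<exists>y\<in>S. (\<lambda>n. N ((\<Sum>k<n. x k) - y)) \<longlonglongrightarrow> 0"
  proof (rule complete[OF S])
    fix e :: real assume "e > 0"
    then obtain n0 where n0: "\<And>n. n \<ge> n0 \<Longrightarrow> 2 * D * c * (1 / (2 * D)) ^ n < e"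
      using order_tendstoD(2)[OF ratio_power_tendsto[of "2 * D * c"]]
      by (auto simp: eventually_sequentially)
    have *: "N ((\<Sum>k<n. x k) - (\<Sum>k<m. x k)) < e" if "n0 \<le> m" "m \<le> n" for m n
      using geometric_tail_le[OF assms, of m "n - m"] n0[OF that(1)] that(2)
      by (simp add: mult.assoc)
    show "\<exists>n0. \<forall>m\<ge>n0. \<forall>n\<ge>n0. N ((\<Sum>k<m. x k) - (\<Sum>k<n. x k)) < e"
    proof (intro exI allI impI)
      fix m n assume "n0 \<le> m" "n0 \<le> n"
      then show "N ((\<Sum>k<m. x k) - (\<Sum>k<n. x k)) < e"
        using *[of m n] *[of n m] diff_commute[OF S S, of m n] by (cases "m \<le> n") auto
    qed
  qed
  then obtain y where y: "y \<in> S" "(\<lambda>n. N ((\<Sum>k<n. x k) - y)) \<longlonglongrightarrow> 0" by blast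
  \<comment> \<open>\<open>2 * D * c\<close> bounds the partial sums; the passage to the limit adds
    the second \<open>D\<close>.\<close>
  have "N (y - 0) \<le> D * (2 * D * c)"
    by (rule lim_bound[OF S y(1) mem_zero y(2)]) (simp add: geometric_sum_le[OF assms])
  then show ?thesis using that[OF y] by (simp add: power2_eq_square mult_ac)
qed

text \<open>Baire's argument with nested quasi-balls. Balls of a quasinorm need not be open and the
  quasinorm need not be continuous, so the radii absorb the constant \<open>D\<close>.\<close>

lemma baire:
  fixes A :: "nat \<Rightarrow> 'a set"
  assumes cover: "\<And>x. x \<in> S \<Longrightarrow> \<exists>n. x \<in> A n"
  obtains n x0 \<rho> where "x0 \<in> S" and "\<rho> > 0"
    and "\<And>x \<epsilon>. x \<in> S \<Longrightarrow> N (x - x0) < \<rho> \<Longrightarrow> \<epsilon> > 0 \<Longrightarrow> \<exists>a\<in>A n \<inter> S. N (x - a) < \<epsilon>"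
proof (rule ccontr)
  note pos = D_pos
  note result = that
  assume not: "\<not> thesis"
  have baire_fail: "\<not> (\<forall>x \<epsilon>. x \<in> S \<longrightarrow> N (x - x0) < \<rho> \<longrightarrow> \<epsilon> > 0 \<longrightarrow> (\<exists>a\<in>A n \<inter> S. N (x - a) < \<epsilon>))"
    if "x0 \<in> S" "\<rho> > 0" for x0 \<rho> n
    using not that result[of x0 \<rho> n] by blast
  define P where "P n x0 \<rho> x \<epsilon> \<longleftrightarrow>
    x \<in> S \<and> N (x - x0) < \<rho> \<and> \<epsilon> > 0 \<and> (\<forall>a\<in>A n \<inter> S. \<epsilon> \<le> N (x - a))" for n x0 \<rho> x \<epsilon>
  have "\<forall>n x0 \<rho>. \<exists>x \<epsilon>. x0 \<in> S \<and> \<rho> > 0 \<longrightarrow> P n x0 \<rho> x \<epsilon>"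
  proof (intro allI)
    fix n x0 \<rho>
    show "\<exists>x \<epsilon>. x0 \<in> S \<and> \<rho> > 0 \<longrightarrow> P n x0 \<rho> x \<epsilon>"
      using baire_fail[of x0 \<rho> n] unfolding P_def by (meson not_le_imp_less)
  qed
  then obtain g h where "\<And>n x0 \<rho>. x0 \<in> S \<Longrightarrow> \<rho> > 0 \<Longrightarrow> P n x0 \<rho> (g n x0 \<rho>) (h n x0 \<rho>)"
    unfolding choice_iff by blast
  then have gh: "x0 \<in> S \<Longrightarrow> \<rho> > 0 \<Longrightarrow> g n x0 \<rho> \<in> S \<and>
      N (g n x0 \<rho> - x0) < \<rho> \<and> h n x0 \<rho> > 0 \<and> (\<forall>a\<in>A n \<inter> S. h n x0 \<rho> \<le> N (g n x0 \<rho> - a))"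
    for n x0 \<rho>
    unfolding P_def by blast
  \<comment> \<open>Division by \<open>2 * D\<close> makes the steps a geometric series of the ratio
    handled above. The other term keeps the limit off \<open>A n\<close>: the limit is within
    \<open>2 * D\<^sup>2 * \<rho> (Suc n)\<close>, at most half of the value of \<open>h\<close>,
    from the next centre, and that centre is at least the value of \<open>h\<close> away from
    \<open>A n\<close>.\<close>
  define st where "st = rec_nat (0::'a, 1::real)
    (\<lambda>n (x, \<rho>). (g n x \<rho>, min (\<rho> / (2 * D)) (h n x \<rho> / (4 * D\<^sup>2))))"
  define x where "x n = fst (st n)" for n
  define \<rho> where "\<rho> n = snd (st n)" for n
  have x0: "x 0 = 0" "\<rho> 0 = 1" by (simp_all add: x_def \<rho>_def st_def)
  have xS: "x (Suc n) = g n (x n) (\<rho> n)"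
    "\<rho> (Suc n) = min (\<rho> n / (2 * D)) (h n (x n) (\<rho> n) / (4 * D\<^sup>2))" for n
    by (simp_all add: x_def \<rho>_def st_def split: prod.split)
  have inv: "x n \<in> S \<and> \<rho> n > 0" for n
  proof (induction n)
    case (Suc n)
    then show ?case using gh[of "x n" "\<rho> n" n] pos by (simp add: xS)
  qed (simp add: x0 mem_zero)
  have step: "N (x (Suc n) - x n) < \<rho> n" for n
    using gh[of "x n" "\<rho> n" n] inv[of n] by (simp add: xS)
  have far: "h n (x n) (\<rho> n) \<le> N (x (Suc n) - a)" if "a \<in> A n" "a \<in> S" for a n
    using gh[of "x n" "\<rho> n" n] inv[of n] that by (simp add: xS)
  have hpos: "h n (x n) (\<rho> n) > 0" for n
    using gh[of "x n" "\<rho> n" n] inv[of n] by simp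
  have \<rho>: "\<rho> (m + k) \<le> \<rho> m * (1 / (2 * D)) ^ k" for m k
  proof (induction k)
    case (Suc k)
    have "\<rho> (m + Suc k) \<le> \<rho> (m + k) / (2 * D)" by (simp add: xS)
    also have "\<dots> \<le> \<rho> m * (1 / (2 * D)) ^ k / (2 * D)"
      using Suc pos by (intro divide_right_mono) auto
    finally show ?case by simp
  qed simp
  have dS: "x (Suc (m + k)) - x (m + k) \<in> S" for m k using inv by (simp add: mem_diff)
  have dN: "N (x (Suc (m + k)) - x (m + k)) \<le> \<rho> m * (1 / (2 * D)) ^ k" for m k
    using step[of "m + k"] \<rho>[of m k] by simp
  have tel: "(\<Sum>k<n. x (Suc (m + k)) - x (m + k)) = x (m + n) - x m" for m n
    by (induction n) auto
  obtain y where y: "y \<in> S"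
    "(\<lambda>n. N ((\<Sum>k<n. x (Suc (0 + k)) - x (0 + k)) - y)) \<longlonglongrightarrow> 0"
    by (rule geometric_series_converges[where x="\<lambda>k. x (Suc (0 + k)) - x (0 + k)" and c="\<rho> 0"])
      (use dS[of 0] dN[of 0] in auto)
  then have lim: "(\<lambda>n. N (x n - y)) \<longlonglongrightarrow> 0"
    unfolding tel by (simp add: x0)
  have near: "N (y - x m) \<le> 2 * D\<^sup>2 * \<rho> m" for m
  proof -
    have "\<forall>\<^sub>F n in sequentially. N (x n - x m) \<le> 2 * D * \<rho> m"
    proof (rule eventually_sequentiallyI[of m])
      fix n assume "m \<le> n"
      then show "N (x n - x m) \<le> 2 * D * \<rho> m"
        using geometric_sum_le[OF dS dN, of m "n - m"] unfolding tel by simp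
    qed
    from lim_bound[OF _ y(1) _ lim this] inv show ?thesis
      by (simp add: power2_eq_square mult_ac)
  qed
  obtain n where n: "y \<in> A n" using cover y(1) by blast
  have "N (x (Suc n) - y) \<le> 2 * D\<^sup>2 * \<rho> (Suc n)"
    using near[of "Suc n"] diff_commute[of y "x (Suc n)"] y(1) inv by simp
  also have "\<dots> \<le> 2 * D\<^sup>2 * (h n (x n) (\<rho> n) / (4 * D\<^sup>2))"
    using pos by (intro mult_left_mono) (auto simp: xS)
  also have "\<dots> < h n (x n) (\<rho> n)" using hpos[of n] pos by (simp add: field_simps)
  finally show False using far[OF n y(1)] by simp
qed

text \<open>An open mapping theorem in the style of Zabreiko's lemma. \<open>A c\<close> plays the role of the image
  of the ball of radius \<open>c\<close>.\<close>

lemma open_mapping_sets: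
  fixes A :: "real \<Rightarrow> 'a set"
  assumes mono: "\<And>c d. c \<le> d \<Longrightarrow> A c \<subseteq> A d"
    and scaleA: "\<And>c t x. x \<in> A c \<Longrightarrow> t *\<^sub>R x \<in> A (\<bar>t\<bar> * c)"
    and diffA: "\<And>c x y. x \<in> A c \<Longrightarrow> y \<in> A c \<Longrightarrow> x - y \<in> A (E * c)"
    and cover: "\<And>x. x \<in> S \<Longrightarrow> \<exists>c. x \<in> A c"
    and r: "0 < r" "r < 1"
    and series: "\<And>c s x. \<lbrakk>\<And>k. s k \<in> A (c * r ^ k); \<And>k. s k \<in> S; x \<in> S;
      (\<lambda>n. N ((\<Sum>k<n. s k) - x)) \<longlonglongrightarrow> 0\<rbrakk> \<Longrightarrow> x \<in> A (M * c)"
  obtains C where "0 \<le> C" and "\<And>x. x \<in> S \<Longrightarrow> x \<in> A (C * N x)"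
proof -
  note pos = D_pos
  obtain n x0 \<rho> where x0: "x0 \<in> S" and \<rho>: "\<rho> > 0"
    and near: "\<And>x \<epsilon>. x \<in> S \<Longrightarrow> N (x - x0) < \<rho> \<Longrightarrow> \<epsilon> > 0 \<Longrightarrow> \<exists>a\<in>A (real n) \<inter> S. N (x - a) < \<epsilon>"
  proof (rule baire[of "\<lambda>n. A (real n)"])
    fix x assume "x \<in> S"
    then obtain c where "x \<in> A c" using cover by blast
    then show "\<exists>n. x \<in> A (real n)" using mono real_arch_simple[of c] by blast
  qed blast
  \<comment> \<open>Below, \<open>x\<close> is scaled by \<open>\<rho> / (2 * N x)\<close> and
    approximated by a difference of two points of \<open>A n\<close>, which lies in
    \<open>A (E * n)\<close>; undoing the scaling multiplies by
    \<open>2 * N x / \<rho>\<close>.\<close>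
  define K where "K = 2 * \<bar>E\<bar> * n / \<rho>"
  have zeroA: "0 \<in> A 0"
  proof -
    obtain c where "0 \<in> A c" using cover mem_zero by blast
    from scaleA[OF this, of 0] show ?thesis by simp
  qed
  have approx: "\<exists>u\<in>S. u \<in> A (K * N x) \<and> N (x - u) \<le> r * N x" if x: "x \<in> S" for x
  proof (cases "x = 0")
    case True
    then show ?thesis using zeroA mem_zero by (intro bexI[of _ 0]) auto
  next
    case False
    then have Nx: "N x > 0" using nonneg[OF x] definite[OF x] by fastforce
    define \<sigma> where "\<sigma> = \<rho> / (2 * N x)"
    \<comment> \<open>Undoing the scaling turns the error
      \<open>D * (\<epsilon> + \<epsilon>)\<close> of the difference into exactly
      \<open>r * N x\<close>.\<close>
    define \<epsilon> where "\<epsilon> = r * \<rho> / (4 * D)"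
    have \<sigma>: "\<sigma> > 0" and \<epsilon>: "\<epsilon> > 0" using \<rho> Nx r pos by (auto simp: \<sigma>_def \<epsilon>_def)
    have sx: "\<sigma> *\<^sub>R x \<in> S" using x by (rule mem_scale)
    have "N (x0 + \<sigma> *\<^sub>R x - x0) < \<rho>"
      using Nx \<rho> scale[OF x, of \<sigma>] \<sigma> by (simp add: \<sigma>_def)
    then obtain a where a: "a \<in> A n" "a \<in> S" "N (x0 + \<sigma> *\<^sub>R x - a) < \<epsilon>"
      using near[of "x0 + \<sigma> *\<^sub>R x" \<epsilon>] \<epsilon> mem_add[OF x0 sx] by blast
    obtain b where b: "b \<in> A n" "b \<in> S" "N (x0 - b) < \<epsilon>"
      using near[of x0 \<epsilon>] \<epsilon> x0 \<rho> by auto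
    \<comment> \<open>Subtracting an approximation of the centre carries the density of
      \<open>A n\<close> from the ball around \<open>x0\<close> over to 0.\<close>
    define u where "u = inverse \<sigma> *\<^sub>R (a - b)"
    have "a - b \<in> A (E * n)" by (rule diffA[OF a(1) b(1)])
    then have "u \<in> A (\<bar>inverse \<sigma>\<bar> * (E * n))" unfolding u_def by (rule scaleA)
    moreover have "\<bar>inverse \<sigma>\<bar> * (E * n) \<le> K * N x"
    proof -
      have "\<bar>inverse \<sigma>\<bar> * (E * n) \<le> \<bar>inverse \<sigma>\<bar> * (\<bar>E\<bar> * n)"
        by (intro mult_left_mono mult_right_mono) auto
      also have "\<dots> = K * N x" using \<rho> Nx by (simp add: K_def \<sigma>_def field_simps)
      finally show ?thesis .
    qed
    ultimately have uA: "u \<in> A (K * N x)" using mono by blast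
    have uS: "u \<in> S" unfolding u_def by (intro mem_scale mem_diff a b)
    have "x - u = inverse \<sigma> *\<^sub>R ((x0 + \<sigma> *\<^sub>R x - a) - (x0 - b))"
      using \<sigma> by (simp add: u_def algebra_simps)
    then have "N (x - u) = inverse \<sigma> * N ((x0 + \<sigma> *\<^sub>R x - a) - (x0 - b))"
      using scale[of "(x0 + \<sigma> *\<^sub>R x - a) - (x0 - b)" "inverse \<sigma>"] \<sigma> mem_diff mem_add a b x0 sx
      by simp
    also have "\<dots> \<le> inverse \<sigma> * (D * (N (x0 + \<sigma> *\<^sub>R x - a) + N (x0 - b)))"
      using \<sigma> by (intro mult_left_mono triangle_diff mem_diff mem_add a b x0 sx) auto
    also have "\<dots> \<le> inverse \<sigma> * (D * (\<epsilon> + \<epsilon>))"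
      using \<sigma> pos a(3) b(3) by (intro mult_left_mono add_mono) auto
    also have "\<dots> = r * N x" using \<rho> Nx pos by (simp add: \<epsilon>_def \<sigma>_def field_simps)
    finally show ?thesis using uA uS by blast
  qed
  then obtain u where u: "\<And>x. x \<in> S \<Longrightarrow> u x \<in> S \<and> u x \<in> A (K * N x) \<and> N (x - u x) \<le> r * N x"
    by metis
  have K: "K \<ge> 0" using \<rho> by (simp add: K_def)
  have main: "x \<in> A (M * (K * N x))" if x: "x \<in> S" for x
  proof -
    \<comment> \<open>Iterated remainders: \<open>u (z k)\<close> corrects \<open>z k\<close> up to
      \<open>z (Suc k)\<close>, so the corrections telescope to \<open>x - z n\<close>, and
      \<open>N (z n)\<close> decays like \<open>r ^ n\<close>.\<close>
    define z where "z k = ((\<lambda>y. y - u y) ^^ k) x" for k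
    have zS: "z k \<in> S" for k
      by (induction k) (use u x in \<open>auto simp: z_def mem_diff\<close>)
    have zN: "N (z k) \<le> N x * r ^ k" for k
    proof (induction k)
      case (Suc k)
      have "N (z (Suc k)) \<le> r * N (z k)" using u[OF zS[of k]] by (simp add: z_def)
      also have "\<dots> \<le> r * (N x * r ^ k)" using Suc r by (intro mult_left_mono) auto
      finally show ?case by (simp add: mult_ac)
    qed (simp add: z_def)
    have sum: "(\<Sum>k<n. u (z k)) = x - z n" for n
      by (induction n) (auto simp: z_def)
    show ?thesis
    proof (rule series[of "\<lambda>k. u (z k)"])
      show "u (z k) \<in> A (K * N x * r ^ k)" for k
        using u[OF zS[of k]] mono[of "K * N (z k)" "K * N x * r ^ k"] zN[of k] K
        by (auto simp: mult.assoc intro: mult_left_mono)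
      show "u (z k) \<in> S" for k using u[OF zS] by blast
      show "(\<lambda>n. N ((\<Sum>k<n. u (z k)) - x)) \<longlonglongrightarrow> 0"
        unfolding sum
      proof (rule tendsto_sandwich_norm)
        show "x - z n - x \<in> S" for n by (intro mem_diff x zS)
        show "N (x - z n - x) \<le> N x * r ^ n" for n using zN[of n] minus[OF zS[of n]] by simp
        show "(\<lambda>n. N x * r ^ n) \<longlonglongrightarrow> 0"
          using tendsto_mult_left[OF LIMSEQ_power_zero[of r], of "N x"] r by simp
      qed
    qed (rule x)
  qed
  show ?thesis
  proof (rule that[of "\<bar>M\<bar> * K"])
    show "x \<in> A (\<bar>M\<bar> * K * N x)" if "x \<in> S" for x
    proof -
      have "M * (K * N x) \<le> \<bar>M\<bar> * (K * N x)"
        using K nonneg[OF that] by (intro mult_right_mono) auto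
      then show ?thesis using main[OF that] mono by (force simp: mult.assoc)
    qed
  qed (use K in simp)
qed

end

section \<open>Quasi-Banach spaces as instances of the locales, and the open mapping theorem for
  operators\<close>

lemma quasinorm_quasi_space: "quasinorm N \<longleftrightarrow> (\<exists>D. quasi_space UNIV N D)"
proof
  assume q: "quasinorm N"
  then obtain D where D: "\<And>x y. N (x + y) \<le> D * (N x + N y)" unfolding quasinorm_def by blast
  have nn: "0 \<le> N x" for x using q unfolding quasinorm_def by blast
  \<comment> \<open>On the zero space any real number serves as the constant in
    \<open>quasinorm\<close>; the locale asks for one that is at least 1.\<close>
  have "N (x + y) \<le> max D 1 * (N x + N y)" for x y
    using D[of x y] mult_right_mono[of D "max D 1" "N x + N y"] nn[of x] nn[of y] by linarith
  then have "quasi_space UNIV N (max D 1)"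
    using q by unfold_locales (auto simp: quasinorm_def)
  then show "\<exists>D. quasi_space UNIV N D" ..
next
  assume "\<exists>D. quasi_space UNIV N D"
  then obtain D where "quasi_space UNIV N D" ..
  then interpret quasi_space UNIV N D .
  show "quasinorm N"
    unfolding quasinorm_def using nonneg definite scale triangle by auto
qed

lemma quasi_banach_complete_quasi_space:
  "quasi_banach N \<longleftrightarrow> (\<exists>D. complete_quasi_space UNIV N D)"
proof
  assume q: "quasi_banach N"
  then obtain D where D: "quasi_space UNIV N D"
    using quasinorm_quasi_space unfolding quasi_banach_def by blast
  then interpret quasi_space UNIV N D .
  have "complete_quasi_space UNIV N D"
    using q by unfold_locales (auto simp: quasi_banach_def quasi_complete_def)
  then show "\<exists>D. complete_quasi_space UNIV N D" ..
next
  assume "\<exists>D. complete_quasi_space UNIV N D"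
  then obtain D where "complete_quasi_space UNIV N D" ..
  then interpret complete_quasi_space UNIV N D .
  have "quasinorm N" using quasi_space_axioms quasinorm_quasi_space by blast
  then show "quasi_banach N"
    unfolding quasi_banach_def quasi_complete_def using complete by auto
qed

text \<open>With a carrier \<open>S\<close> for the target, this applies to a quotient map as well
  as to an embedding onto its range. \<open>R c\<close> is the image of the ball of radius
  \<open>c\<close>. A series with geometrically shrinking preimages can be summed in the complete
  domain, and boundedness of \<open>T\<close> identifies the two limits.\<close>

lemma open_mapping:
  assumes "complete_quasi_space UNIV NA DA" and "complete_quasi_space S NB DB"
    and bT: "bounded_operator NA NB T" and range: "range T = S"
  obtains C where "0 \<le> C" and "\<And>b. b \<in> S \<Longrightarrow> \<exists>a. T a = b \<and> NA a \<le> C * NB b"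
proof -
  interpret A: complete_quasi_space UNIV NA DA by fact
  interpret B: complete_quasi_space S NB DB by fact
  obtain K where linT: "linear T" and K: "\<And>x. NB (T x) \<le> K * NA x"
    using bT unfolding bounded_operator_def by blast
  interpret T: linear T by fact
  define R where "R c = {T a | a. NA a \<le> c}" for c
  have r: "0 < 1 / (2 * DA)" "1 / (2 * DA) < 1" using A.D_ge_1 by (auto simp: field_simps)
  obtain C where "0 \<le> C" and C: "\<And>x. x \<in> S \<Longrightarrow> x \<in> R (C * NB x)"
  proof (rule B.open_mapping_sets[where A=R and E="2 * DA" and r="1 / (2 * DA)" and M="2 * DA\<^sup>2"])
    show "c \<le> d \<Longrightarrow> R c \<subseteq> R d" for c d by (fastforce simp: R_def)
    show "t *\<^sub>R x \<in> R (\<bar>t\<bar> * c)" if x: "x \<in> R c" for c t x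
    proof -
      obtain a where "x = T a" "NA a \<le> c" using x by (auto simp: R_def)
      then show ?thesis
        unfolding R_def using A.scale[of a t]
        by (auto intro!: exI[of _ "t *\<^sub>R a"] mult_left_mono simp: T.scaleR)
    qed
    show "x - y \<in> R (2 * DA * c)" if x: "x \<in> R c" and y: "y \<in> R c" for c x y
    proof -
      obtain a b where ab: "x = T a" "NA a \<le> c" "y = T b" "NA b \<le> c"
        using x y by (auto simp: R_def)
      have "NA (a - b) \<le> DA * (NA a + NA b)" by (rule A.triangle_diff) auto
      also have "\<dots> \<le> DA * (c + c)" using ab A.D_pos by (intro mult_left_mono add_mono) auto
      finally have "T (a - b) \<in> R (2 * DA * c)" unfolding R_def by (auto simp: algebra_simps)
      then show ?thesis by (simp add: ab T.diff)
    qed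
    show "\<exists>c. x \<in> R c" if "x \<in> S" for x using that range unfolding R_def by auto
    show "x \<in> R (2 * DA\<^sup>2 * c)"
      if s: "\<And>k. s k \<in> R (c * (1 / (2 * DA)) ^ k)" and sS: "\<And>k. s k \<in> S" and x: "x \<in> S"
        and lim: "(\<lambda>n. NB ((\<Sum>k<n. s k) - x)) \<longlonglongrightarrow> 0" for c s x
    proof -
      obtain a where a: "\<And>k. s k = T (a k)" "\<And>k. NA (a k) \<le> c * (1 / (2 * DA)) ^ k"
        using s unfolding R_def by simp metis
      obtain y where y: "(\<lambda>n. NA ((\<Sum>k<n. a k) - y)) \<longlonglongrightarrow> 0" "NA y \<le> 2 * DA\<^sup>2 * c"
        using A.geometric_series_converges[of a c] a(2) by auto
      have "(\<lambda>n. NB ((\<Sum>k<n. s k) - T y)) \<longlonglongrightarrow> 0"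
      proof (rule B.tendsto_sandwich_norm)
        show "(\<Sum>k<n. s k) - T y \<in> S" for n
          using range by (intro B.mem_diff B.mem_sum sS) auto
        show "NB ((\<Sum>k<n. s k) - T y) \<le> K * NA ((\<Sum>k<n. a k) - y)" for n
          using K[of "(\<Sum>k<n. a k) - y"] by (simp add: a(1) T.diff T.sum)
        show "(\<lambda>n. K * NA ((\<Sum>k<n. a k) - y)) \<longlonglongrightarrow> 0"
          using tendsto_mult_left[OF y(1), of K] by simp
      qed
      then have "x = T y"
        by (intro B.lim_unique[OF _ x _ lim] B.mem_sum sS) (use range in auto)
      then show ?thesis using y(2) by (auto simp: R_def)
    qed
  qed (use r in auto)
  show ?thesis
  proof (rule that[OF \<open>0 \<le> C\<close>])
    show "\<exists>a. T a = b \<and> NA a \<le> C * NB b" if "b \<in> S" for b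
      using C[OF that] unfolding R_def by auto
  qed
qed

section \<open>Quasilinear maps\<close>

definition lin_approx ::
  "('a::real_vector \<Rightarrow> real) \<Rightarrow> ('b::real_vector \<Rightarrow> real) \<Rightarrow> ('a \<Rightarrow> 'b) \<Rightarrow> real \<Rightarrow> bool" where
  "lin_approx NX NY f c \<longleftrightarrow> (\<exists>l. linear l \<and> (\<forall>x. NY (f x - l x) \<le> c * NX x))"

text \<open>Finiteness of the constants \<open>K\<close> and \<open>K\<^sub>0\<close> without infima: \<open>Q\<close> is any
  quasilinearity bound, not the optimal one.\<close>

definition K_fin :: "('a::real_vector \<Rightarrow> real) \<Rightarrow> ('b::real_vector \<Rightarrow> real) \<Rightarrow> bool" where
  "K_fin NX NY \<longleftrightarrow> (\<exists>C\<ge>0. \<forall>f Q. homogeneous f \<and> 0 \<le> Q \<and> quasilinear_bound NX NY f Q \<longrightarrow>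
     lin_approx NX NY f (C * Q))"

definition K0_fin :: "('a::real_vector \<Rightarrow> real) \<Rightarrow> ('b::real_vector \<Rightarrow> real) \<Rightarrow> bool" where
  "K0_fin NX NY \<longleftrightarrow> (\<exists>C\<ge>0. \<forall>f Q. homogeneous f \<and> 0 \<le> Q \<and> quasilinear_bound NX NY f Q \<and>
     (\<exists>b. \<forall>x. NY (f x) \<le> b * NX x) \<longrightarrow> lin_approx NX NY f (C * Q))"

lemma homogeneous_zero: "homogeneous f \<Longrightarrow> f 0 = 0"
  unfolding homogeneous_def by (metis scaleR_zero_left)

lemma homogeneous_linear: "linear l \<Longrightarrow> homogeneous l"
  by (simp add: homogeneous_def linear_cmul)

lemma homogeneous_diff: "homogeneous f \<Longrightarrow> homogeneous g \<Longrightarrow> homogeneous (\<lambda>x. f x - g x)"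
  by (simp add: homogeneous_def scaleR_diff_right)

lemma homogeneous_add: "homogeneous f \<Longrightarrow> homogeneous g \<Longrightarrow> homogeneous (\<lambda>x. f x + g x)"
  by (simp add: homogeneous_def scaleR_add_right)

lemma homogeneous_scale: "homogeneous f \<Longrightarrow> homogeneous (\<lambda>x. t *\<^sub>R f x)"
  by (simp add: homogeneous_def)

lemma quasilinear_bound_diff_linear:
  assumes "linear l"
  shows "quasilinear_bound NX NY (\<lambda>x. f x - l x) Q \<longleftrightarrow> quasilinear_bound NX NY f Q"
proof -
  have "(f (x + y) - l (x + y)) - (f x - l x) - (f y - l y) = f (x + y) - f x - f y" for x y
    using linear_add[OF assms] by (simp add: algebra_simps)
  then show ?thesis by (simp only: quasilinear_bound_def)
qed

locale quasi_pair = X: quasi_space "UNIV :: 'a::real_vector set" NX DX +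
  Y: quasi_space "UNIV :: 'b::real_vector set" NY DY
  for NX :: "'a::real_vector \<Rightarrow> real" and DX and NY :: "'b::real_vector \<Rightarrow> real" and DY
begin

lemma hom_norm_le_iff:
  assumes f: "homogeneous f" and c: "0 \<le> c"
  shows "hom_norm NX NY f \<le> ennreal c \<longleftrightarrow> (\<forall>x. NY (f x) \<le> c * NX x)"
proof
  assume *: "hom_norm NX NY f \<le> ennreal c"
  show "\<forall>x. NY (f x) \<le> c * NX x"
  proof
    fix x
    show "NY (f x) \<le> c * NX x"
    proof (cases "x = 0")
      case True
      then show ?thesis using homogeneous_zero[OF f] by simp
    next
      case False
      then have Nx: "NX x > 0" using X.nonneg[of x] X.definite[of x] by fastforce
      define e where "e = inverse (NX x) *\<^sub>R x"
      have "NX e = 1" using Nx X.scale[of x "inverse (NX x)"] by (simp add: e_def)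
      then have "ennreal (NY (f e)) \<le> hom_norm NX NY f"
        unfolding hom_norm_def by (intro SUP_upper) simp
      then have "NY (f e) \<le> c" using * c order_trans ennreal_le_iff by blast
      moreover have "f x = NX x *\<^sub>R f e"
        using f Nx unfolding homogeneous_def e_def by simp
      ultimately show ?thesis using Nx Y.scale[of "f e" "NX x"] by (simp add: mult.commute)
    qed
  qed
next
  assume "\<forall>x. NY (f x) \<le> c * NX x"
  then show "hom_norm NX NY f \<le> ennreal c"
    unfolding hom_norm_def by (intro SUP_least ennreal_leI) (metis mem_Collect_eq mult.right_neutral)
qed

lemma hom_norm_finite_iff:
  assumes f: "homogeneous f"
  shows "hom_norm NX NY f < \<infinity> \<longleftrightarrow> (\<exists>c. \<forall>x. NY (f x) \<le> c * NX x)"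
proof
  assume "hom_norm NX NY f < \<infinity>"
  then obtain c where "0 \<le> c" "hom_norm NX NY f = ennreal c"
    using ennreal_cases[of "hom_norm NX NY f"] by auto
  then show "\<exists>c. \<forall>x. NY (f x) \<le> c * NX x" using hom_norm_le_iff[OF f, of c] by auto
next
  assume "\<exists>c. \<forall>x. NY (f x) \<le> c * NX x"
  then obtain c where c: "\<And>x. NY (f x) \<le> c * NX x" by blast
  have "NY (f x) \<le> \<bar>c\<bar> * NX x" for x
    using order_trans[OF c mult_right_mono[OF abs_ge_self X.nonneg]] by simp
  then have "hom_norm NX NY f \<le> ennreal \<bar>c\<bar>" using hom_norm_le_iff[OF f, of "\<bar>c\<bar>"] by simp
  then show "hom_norm NX NY f < \<infinity>" using le_less_trans[OF _ ennreal_less_top] by simp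
qed

lemma quasilinear_bound_mono:
  "quasilinear_bound NX NY f Q \<Longrightarrow> Q \<le> Q' \<Longrightarrow> quasilinear_bound NX NY f Q'"
  unfolding quasilinear_bound_def
  by (meson X.nonneg UNIV_I add_nonneg_nonneg mult_right_mono order_trans)

lemma quasilinear_obtain:
  assumes "quasilinear NX NY f"
  obtains Q where "0 \<le> Q" "quasilinear_bound NX NY f Q"
proof -
  obtain Q where "quasilinear_bound NX NY f Q" using assms unfolding quasilinear_def by blast
  then have "quasilinear_bound NX NY f \<bar>Q\<bar>" by (rule quasilinear_bound_mono) simp
  then show ?thesis using that[of "\<bar>Q\<bar>"] by simp
qed

lemma quasilinear_const_le: "0 \<le> Q \<Longrightarrow> quasilinear_bound NX NY f Q \<Longrightarrow> quasilinear_const NX NY f \<le> Q"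
  unfolding quasilinear_const_def by (intro cInf_lower bdd_belowI[of _ 0]) auto

text \<open>The infimum is attained because each pair \<open>x\<close>, \<open>y\<close> bounds all
  admissible constants from below by the quotient \<open>?d / ?s\<close>. If \<open>?s\<close> is 0,
  any single bound already gives the claim.\<close>

lemma quasilinear_const_bound:
  assumes "quasilinear NX NY f"
  shows "0 \<le> quasilinear_const NX NY f" "quasilinear_bound NX NY f (quasilinear_const NX NY f)"
proof -
  let ?A = "{Q. 0 \<le> Q \<and> quasilinear_bound NX NY f Q}"
  have ne: "?A \<noteq> {}" using quasilinear_obtain[OF assms] by blast
  then show "0 \<le> quasilinear_const NX NY f"
    unfolding quasilinear_const_def by (intro cInf_greatest) auto
  show "quasilinear_bound NX NY f (quasilinear_const NX NY f)"
    unfolding quasilinear_bound_def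
  proof (intro allI)
    fix x y
    let ?d = "NY (f (x + y) - f x - f y)" and ?s = "NX x + NX y"
    show "?d \<le> quasilinear_const NX NY f * ?s"
    proof (cases "?s > 0")
      case True
      have "?d / ?s \<le> quasilinear_const NX NY f"
        unfolding quasilinear_const_def using True
        by (intro cInf_greatest ne) (auto simp: quasilinear_bound_def field_simps)
      then show ?thesis using True by (simp add: field_simps)
    next
      case False
      then have "?s = 0" using X.nonneg[of x] X.nonneg[of y] by simp
      moreover obtain Q where "quasilinear_bound NX NY f Q" using ne by auto
      ultimately show ?thesis unfolding quasilinear_bound_def by (metis mult_zero_right)
    qed
  qed
qed

lemma trivial_quasilinear_iff:
  assumes "homogeneous f"
  shows "trivial_quasilinear NX NY f \<longleftrightarrow> (\<exists>c. lin_approx NX NY f c)"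
proof -
  have "hom_norm NX NY (\<lambda>x. f x - l x) < \<infinity> \<longleftrightarrow> (\<exists>c. \<forall>x. NY (f x - l x) \<le> c * NX x)" if "linear l" for l
    by (rule hom_norm_finite_iff[OF homogeneous_diff[OF assms homogeneous_linear[OF that]]])
  then show ?thesis unfolding trivial_quasilinear_def lin_approx_def by blast
qed

lemma lin_approx_hom_norm:
  assumes "homogeneous f" "0 \<le> c"
  shows "lin_approx NX NY f c \<longleftrightarrow> (\<exists>l. linear l \<and> hom_norm NX NY (\<lambda>x. f x - l x) \<le> ennreal c)"
proof -
  have "hom_norm NX NY (\<lambda>x. f x - l x) \<le> ennreal c \<longleftrightarrow> (\<forall>x. NY (f x - l x) \<le> c * NX x)" if "linear l" for l
    by (rule hom_norm_le_iff[OF homogeneous_diff[OF assms(1) homogeneous_linear[OF that]] assms(2)])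
  then show ?thesis unfolding lin_approx_def by blast
qed

lemma lin_approx_mono: "lin_approx NX NY f c \<Longrightarrow> c \<le> d \<Longrightarrow> lin_approx NX NY f d"
  unfolding lin_approx_def by (meson X.nonneg UNIV_I mult_right_mono order_trans)

text \<open>\<open>P\<close> is \<open>True\<close> for \<open>K_const\<close> and finiteness of the
  norm for \<open>K0_const\<close>. For fixed \<open>C\<close> it makes no difference whether the
  estimate is required with the optimal constant or with every bound \<open>Q \<ge> 0\<close>: the
  optimal constant is itself a bound and lies below the others.\<close>

lemma Inf_const_finite_iff:
  "Inf {ennreal C | C. 0 \<le> C \<and> (\<forall>f. quasilinear NX NY f \<and> P f \<longrightarrow>
       (\<exists>l. linear l \<and> hom_norm NX NY (\<lambda>x. f x - l x) \<le> ennreal (C * quasilinear_const NX NY f)))} < \<infinity>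
   \<longleftrightarrow> (\<exists>C\<ge>0. \<forall>f Q. homogeneous f \<and> 0 \<le> Q \<and> quasilinear_bound NX NY f Q \<and> P f \<longrightarrow>
     lin_approx NX NY f (C * Q))" (is "Inf {ennreal C | C. 0 \<le> C \<and> ?R C} < \<infinity> \<longleftrightarrow> (\<exists>C\<ge>0. ?L C)")
proof -
  have "?R C \<longleftrightarrow> ?L C" if C: "0 \<le> C" for C
  proof
    assume R: "?R C"
    show "?L C"
    proof (intro allI impI, elim conjE)
      fix f Q
      assume f: "homogeneous f" "0 \<le> Q" "quasilinear_bound NX NY f Q" "P f"
      then have q: "quasilinear NX NY f" unfolding quasilinear_def by blast
      then have "lin_approx NX NY f (C * quasilinear_const NX NY f)"
        using R f C quasilinear_const_bound(1)[OF q] by (subst lin_approx_hom_norm) auto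
      then show "lin_approx NX NY f (C * Q)"
        by (rule lin_approx_mono) (intro mult_left_mono quasilinear_const_le f C)
    qed
  next
    assume L: "?L C"
    show "?R C"
    proof (intro allI impI, elim conjE)
      fix f
      assume q: "quasilinear NX NY f" and P: "P f"
      have "lin_approx NX NY f (C * quasilinear_const NX NY f)"
        using L quasilinear_const_bound[OF q] q P unfolding quasilinear_def by blast
      then show "\<exists>l. linear l \<and>
          hom_norm NX NY (\<lambda>x. f x - l x) \<le> ennreal (C * quasilinear_const NX NY f)"
        using lin_approx_hom_norm[of f "C * quasilinear_const NX NY f"] q C
          quasilinear_const_bound(1)[OF q] unfolding quasilinear_def by auto
    qed
  qed
  then have "(\<exists>C\<ge>0. ?L C) \<longleftrightarrow> (\<exists>C. 0 \<le> C \<and> ?R C)" by auto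
  also have "\<dots> \<longleftrightarrow> Inf {ennreal C | C. 0 \<le> C \<and> ?R C} < \<infinity>"
    unfolding Inf_less_iff by auto
  finally show ?thesis by simp
qed

lemma K_const_finite_iff: "K_const NX NY < \<infinity> \<longleftrightarrow> K_fin NX NY"
  using Inf_const_finite_iff[of "\<lambda>f. True"] by (simp add: K_const_def K_fin_def)

lemma K0_const_finite_iff: "K0_const NX NY < \<infinity> \<longleftrightarrow> K0_fin NX NY"
proof -
  have "(\<exists>b. \<forall>x. NY (f x) \<le> b * NX x) \<longleftrightarrow> hom_norm NX NY f < \<infinity>" if "homogeneous f" for f
    using hom_norm_finite_iff[OF that] by simp
  then have "K0_fin NX NY \<longleftrightarrow>
    (\<exists>C\<ge>0. \<forall>f Q. homogeneous f \<and> 0 \<le> Q \<and> quasilinear_bound NX NY f Q \<and> hom_norm NX NY f < \<infinity>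
      \<longrightarrow> lin_approx NX NY f (C * Q))"
    unfolding K0_fin_def by (metis (no_types, lifting))
  then show ?thesis
    using Inf_const_finite_iff[of "\<lambda>f. hom_norm NX NY f < \<infinity>"] by (simp only: K0_const_def)
qed

lemma K_fin_imp_trivial:
  assumes "K_fin NX NY" "quasilinear NX NY f"
  shows "trivial_quasilinear NX NY f"
proof -
  obtain Q where "0 \<le> Q" "quasilinear_bound NX NY f Q" using quasilinear_obtain[OF assms(2)] .
  then show ?thesis
    using assms trivial_quasilinear_iff unfolding K_fin_def quasilinear_def by blast
qed

end

lemma K_fin_imp_K0_fin: "K_fin NX NY \<Longrightarrow> K0_fin NX NY"
  unfolding K_fin_def K0_fin_def by blast

section \<open>Passage to equivalent quasinorms\<close>

lemma equivalent_quasinorms_sym: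
  assumes "equivalent_quasinorms N M"
  shows "equivalent_quasinorms M N"
proof -
  obtain c C where "c > 0" "C > 0" "\<And>x. c * N x \<le> M x \<and> M x \<le> C * N x"
    using assms unfolding equivalent_quasinorms_def by blast
  then have "1 / C * M x \<le> N x \<and> N x \<le> 1 / c * M x" for x
    by (simp add: field_simps)
  then show ?thesis
    unfolding equivalent_quasinorms_def using \<open>c > 0\<close> \<open>C > 0\<close>
    by (meson zero_less_divide_1_iff)
qed

lemma quasilinear_equivalent:
  assumes "quasi_space UNIV NX DX" "quasi_space UNIV NY DY"
    and "quasi_space UNIV PX FX" "quasi_space UNIV PY FY"
    and "equivalent_quasinorms NX PX" "equivalent_quasinorms NY PY"
  obtains a where "a > 0"
    and "\<And>f Q. 0 \<le> Q \<Longrightarrow> quasilinear_bound PX PY f Q \<Longrightarrow> quasilinear_bound NX NY f (a * Q)"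
    and "\<And>c x y. 0 \<le> c \<Longrightarrow> NY y \<le> c * NX x \<Longrightarrow> PY y \<le> a * c * PX x"
    and "\<And>c x y. 0 \<le> c \<Longrightarrow> PY y \<le> c * PX x \<Longrightarrow> NY y \<le> a * c * NX x"
proof -
  interpret NX: quasi_space UNIV NX DX by fact
  interpret NY: quasi_space UNIV NY DY by fact
  interpret PX: quasi_space UNIV PX FX by fact
  interpret PY: quasi_space UNIV PY FY by fact
  obtain c C where c: "c > 0" "C > 0" "\<And>x. c * NX x \<le> PX x" "\<And>x. PX x \<le> C * NX x"
    using assms(5) unfolding equivalent_quasinorms_def by blast
  obtain d D where d: "d > 0" "D > 0" "\<And>x. d * NY x \<le> PY x" "\<And>x. PY x \<le> D * NY x"
    using assms(6) unfolding equivalent_quasinorms_def by blast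
  \<comment> \<open>Each transfer compares a value in \<open>Y\<close> with values in
    \<open>X\<close>, so it costs the upper constant of one equivalence over the lower constant of
    the other; the maximum serves both directions.\<close>
  define a where "a = max (C / d) (D / c)"
  have a: "C / d \<le> a" "D / c \<le> a" "a > 0"
    using c(1,2) d(1,2) by (auto simp: a_def less_max_iff_disj)
  have NY: "NY y \<le> PY y / d" for y using d(3)[of y] d(1) by (simp add: field_simps)
  have NX: "NX y \<le> PX y / c" for y using c(3)[of y] c(1) by (simp add: field_simps)
  show ?thesis
  proof (rule that[OF a(3)])
    show "NY y \<le> a * e * NX x" if e: "0 \<le> e" "PY y \<le> e * PX x" for e x y
    proof -
      have "NY y \<le> e * PX x / d" using NY[of y] e(2) d(1) by (meson divide_right_mono less_imp_le order_trans)
      also have "\<dots> \<le> e * (C * NX x) / d"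
        using c(4)[of x] e(1) d(1) by (intro divide_right_mono mult_left_mono) auto
      also have "\<dots> = C / d * (e * NX x)" by simp
      also have "\<dots> \<le> a * (e * NX x)"
        using e(1) NX.nonneg[of x] by (intro mult_right_mono a) auto
      finally show ?thesis by (simp add: mult.assoc)
    qed
    show "PY y \<le> a * e * PX x" if e: "0 \<le> e" "NY y \<le> e * NX x" for e x y
    proof -
      have "PY y \<le> D * (e * NX x)" using d(4)[of y] e(2) d(2) by (meson less_imp_le mult_left_mono order_trans)
      also have "\<dots> \<le> D * (e * (PX x / c))"
        using NX[of x] e(1) d(2) by (intro mult_left_mono) auto
      also have "\<dots> = D / c * (e * PX x)" by simp
      also have "\<dots> \<le> a * (e * PX x)"
        using e(1) PX.nonneg[of x] by (intro mult_right_mono a) auto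
      finally show ?thesis by (simp add: mult.assoc)
    qed
    show "quasilinear_bound NX NY f (a * Q)" if Q: "0 \<le> Q" "quasilinear_bound PX PY f Q" for f Q
      unfolding quasilinear_bound_def
    proof (intro allI)
      fix x y
      have "NY (f (x + y) - f x - f y) \<le> Q * (PX x + PX y) / d"
        using NY[of "f (x + y) - f x - f y"] Q(2) d(1) unfolding quasilinear_bound_def
        by (meson divide_right_mono less_imp_le order_trans)
      also have "\<dots> \<le> Q * (C * NX x + C * NX y) / d"
        using c(4) Q(1) d(1) by (intro divide_right_mono mult_left_mono add_mono) auto
      also have "\<dots> = C / d * (Q * (NX x + NX y))" by (simp add: field_simps)
      also have "\<dots> \<le> a * (Q * (NX x + NX y))"
        using Q(1) NX.nonneg[of x] NX.nonneg[of y] by (intro mult_right_mono a) auto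
      finally show "NY (f (x + y) - f x - f y) \<le> a * Q * (NX x + NX y)" by (simp add: mult.assoc)
    qed
  qed
qed

text \<open>This links the accessible operators, which live on ultrapowers of p-norms, with the
  constants of the original quasinorms. One factor \<open>a\<close> comes from the quasilinearity
  bound, the other from the approximation.\<close>

lemma K0_fin_equivalent:
  assumes spaces: "quasi_space UNIV NX DX" "quasi_space UNIV NY DY"
    "quasi_space UNIV PX FX" "quasi_space UNIV PY FY"
    and "equivalent_quasinorms NX PX" "equivalent_quasinorms NY PY" and K: "K0_fin NX NY"
  shows "K0_fin PX PY"
proof -
  obtain a where a: "a > 0"
    "\<And>f Q. 0 \<le> Q \<Longrightarrow> quasilinear_bound PX PY f Q \<Longrightarrow> quasilinear_bound NX NY f (a * Q)"
    "\<And>c x y. 0 \<le> c \<Longrightarrow> NY y \<le> c * NX x \<Longrightarrow> PY y \<le> a * c * PX x"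
    "\<And>c x y. 0 \<le> c \<Longrightarrow> PY y \<le> c * PX x \<Longrightarrow> NY y \<le> a * c * NX x"
    by (rule quasilinear_equivalent[OF assms(1-6)]) blast
  interpret PX: quasi_space UNIV PX FX by fact
  obtain C where C: "C \<ge> 0" "\<And>f Q. homogeneous f \<Longrightarrow> 0 \<le> Q \<Longrightarrow> quasilinear_bound NX NY f Q \<Longrightarrow>
      (\<exists>b. \<forall>x. NY (f x) \<le> b * NX x) \<Longrightarrow> lin_approx NX NY f (C * Q)"
    using K unfolding K0_fin_def by blast
  have "lin_approx PX PY f (a * C * a * Q)"
    if f: "homogeneous f" "0 \<le> Q" "quasilinear_bound PX PY f Q" and b: "\<And>x. PY (f x) \<le> b * PX x"
    for f Q b
  proof -
    have "PY (f x) \<le> \<bar>b\<bar> * PX x" for x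
      using order_trans[OF b mult_right_mono[OF abs_ge_self PX.nonneg]] by simp
    then have "NY (f x) \<le> a * \<bar>b\<bar> * NX x" for x using a(4)[of "\<bar>b\<bar>"] by simp
    then have "lin_approx NX NY f (C * (a * Q))"
      using f a by (intro C(2)) auto
    then obtain l where l: "linear l" "\<And>x. NY (f x - l x) \<le> C * (a * Q) * NX x"
      unfolding lin_approx_def by blast
    have "PY (f x - l x) \<le> a * (C * (a * Q)) * PX x" for x
      using a(3)[OF _ l(2)[of x]] C(1) a(1) f(2) by simp
    then show ?thesis unfolding lin_approx_def using l(1) by (auto simp: mult_ac)
  qed
  then show ?thesis
    unfolding K0_fin_def using C(1) a(1) by (intro exI[of _ "a * C * a"]) auto
qed

section \<open>Triviality of all quasilinear maps implies a uniform estimate\<close>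

text \<open>Maps from \<open>X\<close> to \<open>Y\<close> become vectors, so that the locales above
  can be interpreted for a set of quasilinear maps.\<close>

instantiation "fun" :: (type, real_vector) real_vector
begin

definition "r *\<^sub>R f = (\<lambda>x. r *\<^sub>R f x)"

instance
  by standard (auto simp: scaleR_fun_def fun_eq_iff scaleR_add_right scaleR_add_left)

end

lemma scaleR_fun_apply [simp]: "(r *\<^sub>R f) x = r *\<^sub>R f x"
  for f :: "'a \<Rightarrow> 'b::real_vector"
  by (simp add: scaleR_fun_def)

lemma sum_fun_apply: "(\<Sum>k<n. s k) x = (\<Sum>k<n. s k x)"
  for s :: "nat \<Rightarrow> 'a \<Rightarrow> 'b::real_vector"
  by (induction n) auto

text \<open>Linear maps have constant 0; vanishing on a Hamel basis excludes the nonzero ones and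
  makes \<open>quasilinear_const\<close> definite. By hypothesis the sets \<open>A c\<close> of maps
  within \<open>c\<close> of a linear map cover \<open>S\<close>, and
  \<open>open_mapping_sets\<close> makes this cover uniform in the constant.\<close>

lemma trivial_imp_K_fin:
  fixes NX :: "'a::real_vector \<Rightarrow> real" and NY :: "'b::real_vector \<Rightarrow> real"
  assumes spX: "quasi_space UNIV NX DX" and spY: "complete_quasi_space UNIV NY DY"
    and triv: "\<And>f. quasilinear NX NY f \<Longrightarrow> trivial_quasilinear NX NY f"
  shows "K_fin NX NY"
proof -
  interpret X: quasi_space UNIV NX DX by fact
  interpret Y: complete_quasi_space UNIV NY DY by fact
  interpret quasi_pair NX DX NY DY ..
  note DY = Y.D_pos
  let ?Q = "quasilinear_const NX NY"
  let ?d = "\<lambda>f x y. f (x + y) - f x - f y"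
  obtain H :: "'a set" where H: "independent H" "span H = UNIV"
    using maximal_independent_subset[of UNIV] by (metis top.extremum_uniqueI)
  define S where "S = {f. quasilinear NX NY f \<and> (\<forall>h\<in>H. f h = 0)}"
  have Sq: "quasilinear NX NY f" and Sh: "homogeneous f" if "f \<in> S" for f
    using that unfolding S_def quasilinear_def by auto
  have Qb: "0 \<le> ?Q f" "quasilinear_bound NX NY f (?Q f)" if "f \<in> S" for f
    using quasilinear_const_bound[OF Sq[OF that]] by auto
  have SI: "f \<in> S" if "homogeneous f" "quasilinear_bound NX NY f Q" "\<And>h. h \<in> H \<Longrightarrow> f h = 0" for f Q
    using that unfolding S_def quasilinear_def by blast
  have add: "quasilinear_bound NX NY (f + g) (DY * (?Q f + ?Q g))" if "f \<in> S" "g \<in> S" for f g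
    unfolding quasilinear_bound_def
  proof (intro allI)
    fix x y
    have "NY (?d (f + g) x y) = NY (?d f x y + ?d g x y)" by (simp add: algebra_simps)
    also have "\<dots> \<le> DY * (NY (?d f x y) + NY (?d g x y))" by (rule Y.triangle) auto
    also have "\<dots> \<le> DY * (?Q f * (NX x + NX y) + ?Q g * (NX x + NX y))"
      using Qb[OF that(1)] Qb[OF that(2)] DY unfolding quasilinear_bound_def
      by (intro mult_left_mono add_mono) auto
    finally show "NY (?d (f + g) x y) \<le> DY * (?Q f + ?Q g) * (NX x + NX y)"
      by (simp add: algebra_simps)
  qed
  have scale: "quasilinear_bound NX NY (t *\<^sub>R f) (\<bar>t\<bar> * ?Q f)" if "f \<in> S" for f t
    unfolding quasilinear_bound_def
  proof (intro allI)
    fix x y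
    have "NY (?d (t *\<^sub>R f) x y) = \<bar>t\<bar> * NY (?d f x y)"
      using Y.scale[of "?d f x y" t] by (simp add: scaleR_diff_right)
    also have "\<dots> \<le> \<bar>t\<bar> * (?Q f * (NX x + NX y))"
      using Qb[OF that] unfolding quasilinear_bound_def by (intro mult_left_mono) auto
    finally show "NY (?d (t *\<^sub>R f) x y) \<le> \<bar>t\<bar> * ?Q f * (NX x + NX y)" by (simp add: mult.assoc)
  qed
  have Sadd: "f + g \<in> S" if "f \<in> S" "g \<in> S" for f g
    by (rule SI[OF _ add]) (use that homogeneous_add[OF Sh Sh] in \<open>auto simp: plus_fun_def S_def\<close>)
  have Sscale: "t *\<^sub>R f \<in> S" if "f \<in> S" for f t
    by (rule SI[OF _ scale]) (use that homogeneous_scale[OF Sh] in \<open>auto simp: scaleR_fun_def S_def\<close>)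
  have S0: "0 \<in> S"
    by (rule SI[of _ 0]) (auto simp: homogeneous_def quasilinear_bound_def)
  have "subspace S" using Sadd Sscale S0 by (simp add: subspace_def)
  have scale_le: "?Q (t *\<^sub>R f) \<le> \<bar>t\<bar> * ?Q f" if "f \<in> S" for t f
    by (intro quasilinear_const_le scale that) (simp add: Qb[OF that])
  interpret S: quasi_space S ?Q DY
  proof
    show "?Q (t *\<^sub>R f) = \<bar>t\<bar> * ?Q f" if f: "f \<in> S" for f t
    proof (cases "t = 0")
      case True
      then show ?thesis using scale_le[OF f, of 0] Qb(1)[OF S0] by simp
    next
      case False
      have "\<bar>t\<bar> * ?Q f \<le> \<bar>t\<bar> * (\<bar>inverse t\<bar> * ?Q (t *\<^sub>R f))"
        using scale_le[OF Sscale[OF f, of t], of "inverse t"] False by (intro mult_left_mono) auto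
      also have "\<dots> = ?Q (t *\<^sub>R f)" using False by (simp add: field_simps)
      finally show ?thesis using scale_le[OF f, of t] by simp
    qed
    show "f = 0" if f: "f \<in> S" and Q: "?Q f = 0" for f
    proof -
      have "?d f x y = 0" for x y
        using Qb(2)[OF f] Q Y.nonneg[of "?d f x y"] unfolding quasilinear_bound_def
        by (intro Y.definite) (auto intro: antisym)
      then have "linear f" using Sh[OF f]
        by (intro linearI) (auto simp: homogeneous_def algebra_simps)
      then have "f x = 0" for x
        by (rule linear_eq_0_on_span[of f H]) (use f H(2) in \<open>auto simp: S_def\<close>)
      then show ?thesis by (simp add: fun_eq_iff)
    qed
    show "?Q (f + g) \<le> DY * (?Q f + ?Q g)" if "f \<in> S" "g \<in> S" for f g
      using Qb(1)[OF that(1)] Qb(1)[OF that(2)] DY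
      by (intro quasilinear_const_le add that) auto
  qed (use \<open>subspace S\<close> Y.D_ge_1 Qb(1) in auto)
  \<comment> \<open>The points at which evaluation is bounded by \<open>?Q\<close>: a subspace
    containing \<open>H\<close>, hence everything. So convergence for \<open>?Q\<close> implies
    pointwise convergence.\<close>
  have "subspace {x. \<exists>M. \<forall>f\<in>S. NY (f x) \<le> M * ?Q f}" (is "subspace ?T")
    unfolding subspace_def
  proof (intro conjI ballI allI)
    have "NY (f 0) \<le> 0 * ?Q f" if "f \<in> S" for f
      using homogeneous_zero[OF Sh[OF that]] by simp
    then show "0 \<in> ?T" by blast
    show "x + y \<in> ?T" if x: "x \<in> ?T" and y: "y \<in> ?T" for x y
    proof -
      obtain M L where M: "\<And>f. f \<in> S \<Longrightarrow> NY (f x) \<le> M * ?Q f"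
        and L: "\<And>f. f \<in> S \<Longrightarrow> NY (f y) \<le> L * ?Q f"
        using x y by blast
      have "NY (f (x + y)) \<le> DY * ((NX x + NX y) + DY * (M + L)) * ?Q f" if f: "f \<in> S" for f
      proof -
        have "NY (f (x + y)) = NY (?d f x y + (f x + f y))" by simp
        also have "\<dots> \<le> DY * (NY (?d f x y) + DY * (NY (f x) + NY (f y)))"
          using Y.triangle[of "?d f x y" "f x + f y"] Y.triangle[of "f x" "f y"] DY
          by (smt (verit) UNIV_I mult_left_mono)
        also have "\<dots> \<le> DY * (?Q f * (NX x + NX y) + DY * (M * ?Q f + L * ?Q f))"
          using DY M[OF f] L[OF f] Qb(2)[OF f] unfolding quasilinear_bound_def
          by (intro mult_left_mono add_mono) auto
        finally show ?thesis by (simp add: algebra_simps)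
      qed
      then show ?thesis by blast
    qed
    show "t *\<^sub>R x \<in> ?T" if x: "x \<in> ?T" for t x
    proof -
      obtain M where M: "\<And>f. f \<in> S \<Longrightarrow> NY (f x) \<le> M * ?Q f" using x by blast
      have "NY (f (t *\<^sub>R x)) \<le> \<bar>t\<bar> * M * ?Q f" if f: "f \<in> S" for f
        using Sh[OF f] Y.scale[of "f x" t] mult_left_mono[OF M[OF f], of "\<bar>t\<bar>"]
        by (simp add: homogeneous_def mult.assoc)
      then show ?thesis by blast
    qed
  qed
  moreover have "H \<subseteq> ?T" by (auto simp: S_def intro!: exI[of _ 0])
  ultimately have "span H \<subseteq> ?T" by (simp add: span_minimal)
  then obtain M where M: "\<And>x f. f \<in> S \<Longrightarrow> NY (f x) \<le> M x * ?Q f"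
    using H(2) by (simp add: subset_iff) metis
  interpret S: complete_quasi_space S ?Q DY
  proof
    fix s :: "nat \<Rightarrow> 'a \<Rightarrow> 'b"
    assume s: "\<And>n. s n \<in> S"
      and Cauchy: "\<And>e. e > 0 \<Longrightarrow> \<exists>n0. \<forall>m\<ge>n0. \<forall>n\<ge>n0. ?Q (s m - s n) < e"
    have Ms: "NY (s m x - s n x) \<le> \<bar>M x\<bar> * ?Q (s m - s n)" for m n x
    proof -
      have "NY (s m x - s n x) \<le> M x * ?Q (s m - s n)"
        using M[OF S.mem_diff[OF s s], of m n x] by simp
      also have "\<dots> \<le> \<bar>M x\<bar> * ?Q (s m - s n)"
        using Qb(1)[OF S.mem_diff[OF s s], of m n] by (intro mult_right_mono) auto
      finally show ?thesis .
    qed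
    have "\<exists>y\<in>UNIV. (\<lambda>n. NY (s n x - y)) \<longlonglongrightarrow> 0" for x
    proof (rule Y.complete)
      fix e :: real assume "e > 0"
      then obtain n0 where n0: "\<And>m n. m \<ge> n0 \<Longrightarrow> n \<ge> n0 \<Longrightarrow> ?Q (s m - s n) < e / (\<bar>M x\<bar> + 1)"
        using Cauchy[of "e / (\<bar>M x\<bar> + 1)"] by auto
      have "NY (s m x - s n x) < e" if "m \<ge> n0" "n \<ge> n0" for m n
      proof -
        have "NY (s m x - s n x) \<le> (\<bar>M x\<bar> + 1) * ?Q (s m - s n)"
          using Ms[of m x n] Qb(1)[OF S.mem_diff[OF s s], of m n] by (simp add: algebra_simps)
        also have "\<dots> < (\<bar>M x\<bar> + 1) * (e / (\<bar>M x\<bar> + 1))"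
          using n0[OF that] by (intro mult_strict_left_mono) auto
        finally show ?thesis by simp
      qed
      then show "\<exists>n0. \<forall>m\<ge>n0. \<forall>n\<ge>n0. NY (s m x - s n x) < e" by blast
    qed auto
    then obtain F where F: "\<And>x. (\<lambda>n. NY (s n x - F x)) \<longlonglongrightarrow> 0" by (metis UNIV_I)
    have homF: "homogeneous F"
      unfolding homogeneous_def
    proof (intro allI)
      fix t x
      have "(\<lambda>n. NY (s n (t *\<^sub>R x) - t *\<^sub>R F x)) \<longlonglongrightarrow> 0"
        using Y.lim_scale[OF _ _ F[of x], of t] Sh[OF s] by (simp add: homogeneous_def)
      then show "F (t *\<^sub>R x) = t *\<^sub>R F x"
        using Y.lim_unique[OF _ _ _ F[of "t *\<^sub>R x"]] by simp
    qed
    have HF: "F h = 0" if "h \<in> H" for h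
    proof -
      have "(\<lambda>n. NY (s n h - 0)) \<longlonglongrightarrow> 0" using s that by (simp add: S_def)
      then show ?thesis using Y.lim_unique[OF _ _ _ F[of h]] by simp
    qed
    \<comment> \<open>Letting \<open>m\<close> tend to infinity costs the factor \<open>DY\<close>,
      which the tolerance \<open>e / (2 * DY)\<close> chosen later absorbs.\<close>
    have dF: "quasilinear_bound NX NY (F - s n) (DY * e)"
      if e: "\<forall>m\<ge>n. ?Q (s m - s n) \<le> e" for n e
      unfolding quasilinear_bound_def
    proof (intro allI)
      fix x y
      have lim: "(\<lambda>m. NY (?d (s m) x y - ?d F x y)) \<longlonglongrightarrow> 0"
      proof -
        have 1: "(\<lambda>m. NY (- s m z - - F z)) \<longlonglongrightarrow> 0" for z
          using Y.lim_scale[OF _ _ F[of z], of "-1"] by simp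
        have 2: "(\<lambda>m. NY (- s m x + - s m y - (- F x + - F y))) \<longlonglongrightarrow> 0"
          by (rule Y.lim_add[OF _ _ _ _ 1 1]) auto
        have "(\<lambda>m. NY (s m (x + y) + (- s m x + - s m y) - (F (x + y) + (- F x + - F y)))) \<longlonglongrightarrow> 0"
          by (rule Y.lim_add[OF _ _ _ _ F 2]) auto
        then show ?thesis by (simp add: algebra_simps)
      qed
      have "NY (?d F x y - ?d (s n) x y) \<le> DY * (e * (NX x + NX y))"
      proof (rule Y.lim_bound[OF _ _ _ lim])
        show "\<forall>\<^sub>F m in sequentially. NY (?d (s m) x y - ?d (s n) x y) \<le> e * (NX x + NX y)"
        proof (rule eventually_sequentiallyI[of n])
          fix m assume "n \<le> m"
          have "NY (?d (s m) x y - ?d (s n) x y) = NY (?d (s m - s n) x y)"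
            by (simp add: algebra_simps)
          also have "\<dots> \<le> ?Q (s m - s n) * (NX x + NX y)"
            using Qb(2)[OF S.mem_diff[OF s s]] unfolding quasilinear_bound_def by blast
          also have "\<dots> \<le> e * (NX x + NX y)"
            using e \<open>n \<le> m\<close> X.nonneg[of x] X.nonneg[of y] by (intro mult_right_mono) auto
          finally show "NY (?d (s m) x y - ?d (s n) x y) \<le> e * (NX x + NX y)" .
        qed
      qed auto
      moreover have "?d (F - s n) x y = ?d F x y - ?d (s n) x y" by (simp add: algebra_simps)
      ultimately show "NY (?d (F - s n) x y) \<le> DY * e * (NX x + NX y)" by (simp only: mult.assoc)
    qed
    have FsS: "F - s n \<in> S" if "\<forall>m\<ge>n. ?Q (s m - s n) \<le> e" for n e
    proof (rule SI[OF _ dF[OF that]])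
      show "homogeneous (F - s n)"
        using homogeneous_diff[OF homF Sh[OF s]] by (simp add: fun_diff_def)
    qed (use HF s in \<open>auto simp: S_def\<close>)
    show "\<exists>F\<in>S. (\<lambda>n. ?Q (s n - F)) \<longlonglongrightarrow> 0"
    proof (rule bexI[of _ F])
      obtain n0 where "\<And>m n. m \<ge> n0 \<Longrightarrow> n \<ge> n0 \<Longrightarrow> ?Q (s m - s n) < 1" using Cauchy[of 1] by auto
      then have "F - s n0 \<in> S" by (intro FsS[of n0 1]) (auto intro: less_imp_le)
      from S.mem_add[OF this s[of n0]] show FS: "F \<in> S" by simp
      show "(\<lambda>n. ?Q (s n - F)) \<longlonglongrightarrow> 0"
      proof (rule LIMSEQ_I)
        fix e :: real assume e: "e > 0"
        then obtain n0 where n0: "\<And>m n. m \<ge> n0 \<Longrightarrow> n \<ge> n0 \<Longrightarrow> ?Q (s m - s n) < e / (2 * DY)"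
          using Cauchy[of "e / (2 * DY)"] DY by auto
        have "norm (?Q (s n - F) - 0) < e" if "n \<ge> n0" for n
        proof -
          have "?Q (F - s n) \<le> DY * (e / (2 * DY))"
            using n0 that DY e by (intro quasilinear_const_le dF) (auto intro: less_imp_le)
          then have "?Q (s n - F) \<le> e / 2" using DY S.diff_commute[OF s FS] by simp
          then show ?thesis using e Qb(1)[OF S.mem_diff[OF s[of n] FS]] by simp
        qed
        then show "\<exists>n0. \<forall>n\<ge>n0. norm (?Q (s n - F) - 0) < e" by blast
      qed
    qed
  qed
  define A where "A c = {f. lin_approx NX NY f c}" for c
  have r: "0 < 1 / (2 * DY)" "1 / (2 * DY) < 1" using Y.D_ge_1 by (auto simp: field_simps)
  obtain C where C: "0 \<le> C" "\<And>f. f \<in> S \<Longrightarrow> f \<in> A (C * ?Q f)"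
  proof (rule S.open_mapping_sets[where A=A and E="2 * DY" and r="1 / (2 * DY)" and M="2 * DY\<^sup>2"])
    show "c \<le> d \<Longrightarrow> A c \<subseteq> A d" for c d using lin_approx_mono by (auto simp: A_def)
    show "t *\<^sub>R f \<in> A (\<bar>t\<bar> * c)" if f: "f \<in> A c" for c t f
    proof -
      obtain l where l: "linear l" "\<And>x. NY (f x - l x) \<le> c * NX x"
        using f unfolding A_def lin_approx_def by blast
      have "NY ((t *\<^sub>R f) x - t *\<^sub>R l x) \<le> \<bar>t\<bar> * c * NX x" for x
        using mult_left_mono[OF l(2)[of x], of "\<bar>t\<bar>"] Y.scale[of "f x - l x" t]
        by (simp add: scaleR_diff_right mult.assoc)
      moreover have "linear (\<lambda>x. t *\<^sub>R l x)" using l(1) by (rule linear_compose_scale_right)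
      ultimately show ?thesis unfolding A_def lin_approx_def by blast
    qed
    show "f - g \<in> A (2 * DY * c)" if f: "f \<in> A c" and g: "g \<in> A c" for c f g
    proof -
      obtain l k where l: "linear l" "\<And>x. NY (f x - l x) \<le> c * NX x"
        and k: "linear k" "\<And>x. NY (g x - k x) \<le> c * NX x"
        using f g unfolding A_def lin_approx_def by blast
      have "NY ((f - g) x - (l x - k x)) \<le> 2 * DY * c * NX x" for x
      proof -
        have "NY ((f - g) x - (l x - k x)) = NY ((f x - l x) - (g x - k x))"
          by (simp add: algebra_simps)
        also have "\<dots> \<le> DY * (NY (f x - l x) + NY (g x - k x))" by (rule Y.triangle_diff) auto
        also have "\<dots> \<le> DY * (c * NX x + c * NX x)"
          using DY l k by (intro mult_left_mono add_mono) auto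
        finally show ?thesis by (simp add: algebra_simps)
      qed
      then show ?thesis unfolding A_def lin_approx_def using linear_compose_sub[OF l(1) k(1)] by blast
    qed
    show "\<exists>c. f \<in> A c" if "f \<in> S" for f
      using triv[OF Sq[OF that]] trivial_quasilinear_iff[OF Sh[OF that]] by (simp add: A_def)
    show "f \<in> A (2 * DY\<^sup>2 * c)"
      if sA: "\<And>k. s k \<in> A (c * (1 / (2 * DY)) ^ k)" and sS: "\<And>k. s k \<in> S" and f: "f \<in> S"
        and lim: "(\<lambda>n. ?Q ((\<Sum>k<n. s k) - f)) \<longlonglongrightarrow> 0" for c s f
    proof -
      have "\<forall>k. \<exists>l. linear l \<and> (\<forall>x. NY (s k x - l x) \<le> c * (1 / (2 * DY)) ^ k * NX x)"
        using sA unfolding A_def lin_approx_def by blast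
      then obtain l where l: "\<And>k. linear (l k)"
        and sl: "\<And>k x. NY (s k x - l k x) \<le> c * (1 / (2 * DY)) ^ k * NX x" by metis
      have "\<exists>b. (\<lambda>n. NY ((\<Sum>k<n. s k x - l k x) - b)) \<longlonglongrightarrow> 0 \<and> NY b \<le> 2 * DY\<^sup>2 * (c * NX x)" for x
        by (rule Y.geometric_series_converges[of "\<lambda>k. s k x - l k x" "c * NX x"])
          (use sl in \<open>auto simp: mult_ac\<close>)
      then obtain b where b: "\<And>x. (\<lambda>n. NY ((\<Sum>k<n. s k x - l k x) - b x)) \<longlonglongrightarrow> 0"
        and bN: "\<And>x. NY (b x) \<le> 2 * DY\<^sup>2 * (c * NX x)" by metis
      have sumS: "(\<Sum>k<n. s k) - f \<in> S" for n
        by (intro S.mem_diff S.mem_sum sS f)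
      have sf: "(\<lambda>n. NY ((\<Sum>k<n. s k x) - f x)) \<longlonglongrightarrow> 0" for x
      proof (rule Y.tendsto_sandwich_norm)
        show "NY ((\<Sum>k<n. s k x) - f x) \<le> M x * ?Q ((\<Sum>k<n. s k) - f)" for n
          using M[of "(\<Sum>k<n. s k) - f" x] sumS by (simp add: sum_fun_apply)
        show "(\<lambda>n. M x * ?Q ((\<Sum>k<n. s k) - f)) \<longlonglongrightarrow> 0"
          using tendsto_mult_left[OF lim, of "M x"] by simp
      qed simp
      \<comment> \<open>Convergence of the sums of \<open>l k\<close> is not known beforehand. It
        follows pointwise from that of the sums of \<open>s k\<close> and of
        \<open>s k - l k\<close>, and the limit \<open>f x - b x\<close> inherits linearity in
        \<open>x\<close>.\<close>
      have L: "(\<lambda>n. NY ((\<Sum>k<n. l k x) - (f x - b x))) \<longlonglongrightarrow> 0" for x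
      proof -
        have 1: "(\<lambda>n. NY (- 1 *\<^sub>R (\<Sum>k<n. s k x - l k x) - - 1 *\<^sub>R b x)) \<longlonglongrightarrow> 0"
          by (rule Y.lim_scale[OF _ _ b]) auto
        have "(\<lambda>n. NY ((\<Sum>k<n. s k x) + - 1 *\<^sub>R (\<Sum>k<n. s k x - l k x) - (f x + - 1 *\<^sub>R b x))) \<longlonglongrightarrow> 0"
          by (rule Y.lim_add[OF _ _ _ _ sf 1]) auto
        then show ?thesis by (simp add: sum_subtractf)
      qed
      have "linear (\<lambda>x. f x - b x)"
      proof (rule linearI)
        fix x y
        have "(\<lambda>n. NY ((\<Sum>k<n. l k x) + (\<Sum>k<n. l k y) - ((f x - b x) + (f y - b y)))) \<longlonglongrightarrow> 0"
          by (rule Y.lim_add[OF _ _ _ _ L L]) auto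
        then have "(\<lambda>n. NY ((\<Sum>k<n. l k (x + y)) - ((f x - b x) + (f y - b y)))) \<longlonglongrightarrow> 0"
          by (simp add: linear_add[OF l] sum.distrib)
        then show "f (x + y) - b (x + y) = f x - b x + (f y - b y)"
          using Y.lim_unique[OF _ _ _ L[of "x + y"]] by simp
      next
        fix t x
        have "(\<lambda>n. NY (t *\<^sub>R (\<Sum>k<n. l k x) - t *\<^sub>R (f x - b x))) \<longlonglongrightarrow> 0"
          by (rule Y.lim_scale[OF _ _ L]) auto
        then have "(\<lambda>n. NY ((\<Sum>k<n. l k (t *\<^sub>R x)) - t *\<^sub>R (f x - b x))) \<longlonglongrightarrow> 0"
          by (simp add: linear_cmul[OF l] scaleR_sum_right)
        then show "f (t *\<^sub>R x) - b (t *\<^sub>R x) = t *\<^sub>R (f x - b x)"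
          using Y.lim_unique[OF _ _ _ L[of "t *\<^sub>R x"]] by simp
      qed
      moreover have "NY (f x - (f x - b x)) \<le> 2 * DY\<^sup>2 * c * NX x" for x
        using bN[of x] by (simp add: mult.assoc)
      ultimately show ?thesis unfolding A_def lin_approx_def by blast
    qed
  qed (use r in auto)
  have "lin_approx NX NY f (C * Q)"
    if f: "homogeneous f" "0 \<le> Q" "quasilinear_bound NX NY f Q" for f Q
  proof -
    \<comment> \<open>Subtracting the linear map that agrees with \<open>f\<close> on
      \<open>H\<close> leaves the defect unchanged and gives a member of \<open>S\<close>.\<close>
    obtain k where k: "linear k" "\<And>h. h \<in> H \<Longrightarrow> k h = f h"
      using linear_independent_extend[OF H(1)] by blast
    define g where "g = (\<lambda>x. f x - k x)"
    have gQ: "quasilinear_bound NX NY g Q"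
      unfolding g_def quasilinear_bound_diff_linear[OF k(1)] by (rule f(3))
    have "homogeneous g"
      unfolding g_def by (rule homogeneous_diff[OF f(1) homogeneous_linear[OF k(1)]])
    then have "g \<in> S"
      by (rule SI[OF _ gQ]) (simp add: g_def k)
    then have "lin_approx NX NY g (C * ?Q g)" using C(2) by (simp add: A_def)
    then have "lin_approx NX NY g (C * Q)"
      by (rule lin_approx_mono) (intro mult_left_mono quasilinear_const_le gQ f C)
    then obtain l where l: "linear l" "\<And>x. NY (g x - l x) \<le> C * Q * NX x"
      unfolding lin_approx_def by blast
    have "NY (f x - (k x + l x)) \<le> C * Q * NX x" for x
      using l(2)[of x] by (simp add: g_def algebra_simps)
    then show ?thesis unfolding lin_approx_def using linear_compose_add[OF k(1) l(1)] by blast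
  qed
  then show ?thesis unfolding K_fin_def using C(1) by blast
qed

section \<open>Exact sequences\<close>

text \<open>\<open>e\<close> chooses a unit vector on every line, from which maps extend homogeneously.\<close>

lemma line_section:
  fixes N :: "'a::real_vector \<Rightarrow> real"
  assumes "quasi_space UNIV N D"
  obtains e :: "'a \<Rightarrow> 'a" and t :: "'a \<Rightarrow> real"
  where "\<And>x. x = t x *\<^sub>R e x" and "\<And>x. \<bar>t x\<bar> = N x" and "\<And>x. N (e x) \<le> 1"
    and "\<And>s x. t (s *\<^sub>R x) = s * t x" and "\<And>s x. s \<noteq> 0 \<Longrightarrow> e (s *\<^sub>R x) = e x"
proof -
  interpret quasi_space UNIV N D by fact
  \<comment> \<open>A unit vector chosen from the whole line, unlike \<open>x\<close> divided by
    \<open>N x\<close>, is the same for \<open>x\<close> and \<open>- x\<close>. The coefficient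
    \<open>t\<close> then carries the sign, as homogeneity for negative scalars requires.\<close>
  define R where "R x = {u. N u = 1 \<and> (\<exists>r. x = r *\<^sub>R u)}" for x
  define e where "e x = (if x = 0 then 0 else SOME u. u \<in> R x)" for x
  have e: "e x \<in> R x" if "x \<noteq> 0" for x
  proof -
    have "N x > 0" using that definite[of x] nonneg[of x] by fastforce
    then have "inverse (N x) *\<^sub>R x \<in> R x"
      unfolding R_def using scale[of x "inverse (N x)"] by (auto intro!: exI[of _ "N x"])
    then show ?thesis using that someI[of "\<lambda>u. u \<in> R x"] by (simp add: e_def)
  qed
  define t where "t x = (if x = 0 then 0 else SOME r. x = r *\<^sub>R e x)" for x
  have t: "x = t x *\<^sub>R e x" for x
  proof (cases "x = 0")
    case False
    then have "\<exists>r. x = r *\<^sub>R e x" using e[of x] by (auto simp: R_def)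
    then have "x = (SOME r. x = r *\<^sub>R e x) *\<^sub>R e x" by (rule someI_ex)
    then show ?thesis using False by (simp add: t_def)
  qed (simp add: t_def)
  have Ne: "x \<noteq> 0 \<Longrightarrow> N (e x) = 1" for x using e[of x] by (simp add: R_def)
  have es: "e (s *\<^sub>R x) = e x" if "s \<noteq> 0" for s x
  proof -
    have "R (s *\<^sub>R x) = R x"
    proof (intro set_eqI iffI)
      fix u assume "u \<in> R (s *\<^sub>R x)"
      then obtain r where u: "N u = 1" "s *\<^sub>R x = r *\<^sub>R u" unfolding R_def by blast
      have "x = inverse s *\<^sub>R (s *\<^sub>R x)" using that by simp
      also have "\<dots> = (inverse s * r) *\<^sub>R u" by (simp add: u)
      finally show "u \<in> R x" unfolding R_def using u by blast
    next
      fix u assume "u \<in> R x"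
      then obtain r where u: "N u = 1" "x = r *\<^sub>R u" unfolding R_def by blast
      then have "s *\<^sub>R x = (s * r) *\<^sub>R u" by simp
      then show "u \<in> R (s *\<^sub>R x)" unfolding R_def using u by blast
    qed
    then show ?thesis using that by (simp add: e_def)
  qed
  show ?thesis
  proof (rule that)
    show "\<bar>t x\<bar> = N x" for x
    proof (cases "x = 0")
      case False
      have "N x = N (t x *\<^sub>R e x)" using t[of x] by simp
      then show ?thesis using scale[of "e x" "t x"] Ne[OF False] by simp
    qed (simp add: t_def)
    show "N (e x) \<le> 1" for x using Ne[of x] by (cases "x = 0") (auto simp: e_def)
    show "t (s *\<^sub>R x) = s * t x" for s x
    proof (cases "s = 0 \<or> x = 0")
      case False
      then have "t (s *\<^sub>R x) *\<^sub>R e x = (s * t x) *\<^sub>R e x"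
        using t[of "s *\<^sub>R x"] t[of x] es[of s x] by (metis scaleR_scaleR)
      moreover have "e x \<noteq> 0" using Ne[of x] False by auto
      ultimately show ?thesis by simp
    qed (auto simp: t_def)
  qed (rule t, rule es)
qed

lemma homogeneous_line_extension:
  assumes "\<And>s x. t (s *\<^sub>R x) = s * t x" and "\<And>s x. s \<noteq> 0 \<Longrightarrow> e (s *\<^sub>R x) = e x"
  shows "homogeneous (\<lambda>x. t x *\<^sub>R g (e x))"
  unfolding homogeneous_def
proof (intro allI)
  fix s x
  show "t (s *\<^sub>R x) *\<^sub>R g (e (s *\<^sub>R x)) = s *\<^sub>R t x *\<^sub>R g (e x)"
    using assms(1)[of s x] assms(2)[of s x] by (cases "s = 0") simp_all
qed

text \<open>The linear section \<open>L\<close> does not contribute to the defect of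
  \<open>B - L\<close>, so boundedness of \<open>B\<close> alone makes \<open>f\<close> quasilinear.
  If \<open>l\<close> is linear and close to \<open>f\<close>, then
  \<open>L x + j (l x) = B x - j (f x - l x)\<close> is linear in the first form and bounded in the
  second, hence a section of \<open>q\<close> that splits the sequence.\<close>

lemma trivial_imp_sequence_splits:
  assumes qbX: "quasi_banach NX" and qbY: "quasi_banach NY" and qbZ: "quasi_banach NZ"
    and exact: "short_exact NY NZ NX j q"
    and triv: "\<And>f. quasilinear NX NY f \<Longrightarrow> trivial_quasilinear NX NY f"
  shows "sequence_splits NY NZ j"
proof -
  obtain DX where X: "complete_quasi_space UNIV NX DX"
    using qbX quasi_banach_complete_quasi_space by blast
  obtain DY where Y: "complete_quasi_space UNIV NY DY"
    using qbY quasi_banach_complete_quasi_space by blast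
  obtain DZ where Z: "complete_quasi_space UNIV NZ DZ"
    using qbZ quasi_banach_complete_quasi_space by blast
  interpret X: complete_quasi_space UNIV NX DX by fact
  interpret Y: complete_quasi_space UNIV NY DY by fact
  interpret Z: complete_quasi_space UNIV NZ DZ by fact
  interpret quasi_pair NX DX NY DY ..
  have bj: "bounded_operator NY NZ j" and bq: "bounded_operator NZ NX q"
    and inj0: "{y. j y = 0} = {0}" and ker: "{z. q z = 0} = range j" and surj: "range q = UNIV"
    using exact unfolding short_exact_def by auto
  obtain Kj where lj: "linear j" and Kj: "\<And>y. NZ (j y) \<le> Kj * NY y"
    using bj unfolding bounded_operator_def by blast
  obtain Kq where lq: "linear q" and Kq: "\<And>z. NX (q z) \<le> Kq * NZ z"
    using bq unfolding bounded_operator_def by blast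
  interpret j: linear j by fact
  interpret q: linear q by fact
  have inj: "inj j" using inj0 linear_injective_0[OF lj] by auto
  have ker': "z \<in> range j \<longleftrightarrow> q z = 0" for z using ker by auto
  \<comment> \<open>\<open>range j\<close> is the kernel of the bounded map \<open>q\<close>, hence
    closed and complete; the open mapping theorem then bounds the inverse of
    \<open>j\<close>.\<close>
  interpret R: complete_quasi_space "range j" NZ DZ
  proof
    show "subspace (range j)" unfolding ker[symmetric] by (rule linear_subspace_kernel[OF lq])
    fix s :: "nat \<Rightarrow> _"
    assume s: "\<And>n. s n \<in> range j"
      and "\<And>e. e > 0 \<Longrightarrow> \<exists>n0. \<forall>m\<ge>n0. \<forall>n\<ge>n0. NZ (s m - s n) < e"
    then obtain z where z: "(\<lambda>n. NZ (s n - z)) \<longlonglongrightarrow> 0" using Z.complete[of s] by auto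
    have "(\<lambda>n. Kq * NZ (s n - z)) \<longlonglongrightarrow> 0" using tendsto_mult_left[OF z, of Kq] by simp
    moreover have "NX (q z) \<le> Kq * NZ (s n - z)" for n
      using Kq[of "s n - z"] s[of n] X.minus[of "q z"] by (simp add: ker' q.diff)
    ultimately have "NX (q z) \<le> 0" by (intro LIMSEQ_le_const) auto
    then have "q z = 0" using X.nonneg[of "q z"] X.definite[of "q z"] by simp
    then show "\<exists>z\<in>range j. (\<lambda>n. NZ (s n - z)) \<longlonglongrightarrow> 0" using z ker' by blast
  qed (use Z.D_ge_1 Z.nonneg Z.definite Z.scale Z.triangle in auto)
  have R: "complete_quasi_space (range j) NZ DZ" ..
  obtain C1 where C1: "0 \<le> C1" "\<And>x. x \<in> UNIV \<Longrightarrow> \<exists>z. q z = x \<and> NZ z \<le> C1 * NX x"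
    using open_mapping[OF Z X bq surj] by blast
  obtain C2 where C2: "0 \<le> C2" "\<And>z. z \<in> range j \<Longrightarrow> \<exists>y. j y = z \<and> NY y \<le> C2 * NZ z"
    using open_mapping[OF Y R bj refl] by blast
  have C2': "NY y \<le> C2 * NZ (j y)" for y
    using C2(2)[of "j y"] inj by (auto dest: injD)
  obtain \<sigma> where \<sigma>: "\<And>x. q (\<sigma> x) = x" "\<And>x. NZ (\<sigma> x) \<le> C1 * NX x"
    using C1(2) by (metis UNIV_I)
  obtain L where L: "linear L" "q \<circ> L = id"
    using linear_surjective_right_inverse[OF lq surj] by blast
  have qL: "q (L x) = x" for x using L(2) by (metis comp_apply id_apply)
  obtain e t where et: "\<And>x. x = t x *\<^sub>R e x" "\<And>x. \<bar>t x\<bar> = NX x" "\<And>x. NX (e x) \<le> 1"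
    "\<And>s x. t (s *\<^sub>R x) = s * t x" "\<And>s x. s \<noteq> 0 \<Longrightarrow> e (s *\<^sub>R x) = e x"
    by (rule line_section[OF X.quasi_space_axioms]) blast
  \<comment> \<open>\<open>\<sigma>\<close> is bounded but need not be homogeneous. It is evaluated
    at one vector \<open>e x\<close> per line and extended along the line, which keeps the constant
    \<open>C1\<close>.\<close>
  define B where "B x = t x *\<^sub>R \<sigma> (e x)" for x
  have homB: "homogeneous B" unfolding B_def by (rule homogeneous_line_extension[OF et(4,5)])
  have qB: "q (B x) = x" for x using et(1)[of x] by (simp add: B_def q.scaleR \<sigma>)
  have NB: "NZ (B x) \<le> C1 * NX x" for x
  proof -
    have "NZ (B x) = NX x * NZ (\<sigma> (e x))" by (simp add: B_def Z.scale et(2))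
    also have "\<dots> \<le> NX x * (C1 * NX (e x))" by (intro mult_left_mono \<sigma> X.nonneg) auto
    also have "\<dots> \<le> NX x * (C1 * 1)" by (intro mult_left_mono et X.nonneg C1) auto
    finally show ?thesis by (simp add: mult.commute)
  qed
  define f where "f x = inv j (B x - L x)" for x
  have jf: "j (f x) = B x - L x" for x
    unfolding f_def by (rule f_inv_into_f) (simp add: ker' q.diff qB qL)
  have jinj: "j y = j y' \<Longrightarrow> y = y'" for y y' using inj by (rule injD)
  have homf: "homogeneous f"
    unfolding homogeneous_def
  proof (intro allI)
    fix s x
    have "B (s *\<^sub>R x) = s *\<^sub>R B x" using homB unfolding homogeneous_def by blast
    then show "f (s *\<^sub>R x) = s *\<^sub>R f x"
      by (intro jinj) (simp add: jf j.scaleR linear_cmul[OF L(1)] scaleR_diff_right)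
  qed
  have "quasilinear_bound NX NY f (C2 * (DZ * (C1 * DX + DZ * C1)))"
    unfolding quasilinear_bound_def
  proof (intro allI)
    fix x y
    let ?s = "NX x + NX y"
    have "j (f (x + y) - f x - f y) = B (x + y) - (B x + B y)"
      by (simp add: j.diff jf linear_add[OF L(1)])
    then have "NY (f (x + y) - f x - f y) \<le> C2 * NZ (B (x + y) - (B x + B y))"
      using C2'[of "f (x + y) - f x - f y"] by simp
    also have "\<dots> \<le> C2 * (DZ * (NZ (B (x + y)) + NZ (B x + B y)))"
      by (intro mult_left_mono Z.triangle_diff C2) auto
    also have "\<dots> \<le> C2 * (DZ * (C1 * NX (x + y) + DZ * (NZ (B x) + NZ (B y))))"
      using Z.D_pos by (intro mult_left_mono add_mono Z.triangle NB C2) auto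
    also have "\<dots> \<le> C2 * (DZ * (C1 * (DX * ?s) + DZ * (C1 * NX x + C1 * NX y)))"
      using Z.D_pos by (intro mult_left_mono add_mono X.triangle NB C2 C1) auto
    also have "\<dots> = C2 * (DZ * (C1 * DX + DZ * C1)) * ?s" by (simp add: algebra_simps)
    finally show "NY (f (x + y) - f x - f y) \<le> \<dots>" .
  qed
  then have "quasilinear NX NY f" using homf unfolding quasilinear_def by blast
  then obtain l c where l: "linear l" and c: "\<And>x. NY (f x - l x) \<le> c * NX x"
    using triv trivial_quasilinear_iff[OF homf] unfolding lin_approx_def by blast
  define v where "v x = L x + j (l x)" for x
  have lv: "linear v" unfolding v_def
    using linear_compose_add[OF L(1) linear_compose[OF l lj]] by (simp add: o_def)
  have Nv: "NZ (v x) \<le> DZ * (C1 + \<bar>Kj\<bar> * \<bar>c\<bar>) * NX x" for x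
  proof -
    have "v x = B x - j (f x - l x)" by (simp add: v_def j.diff jf)
    then have "NZ (v x) \<le> DZ * (NZ (B x) + NZ (j (f x - l x)))" by (simp add: Z.triangle_diff)
    also have "NZ (j (f x - l x)) \<le> \<bar>Kj\<bar> * NY (f x - l x)"
      using order_trans[OF Kj mult_right_mono[OF abs_ge_self Y.nonneg]] by simp
    also have "NY (f x - l x) \<le> \<bar>c\<bar> * NX x"
      using order_trans[OF c mult_right_mono[OF abs_ge_self X.nonneg]] by simp
    finally have "NZ (v x) \<le> DZ * (NZ (B x) + \<bar>Kj\<bar> * (\<bar>c\<bar> * NX x))"
      using Z.D_pos by (simp add: mult_left_mono)
    also have "\<dots> \<le> DZ * (C1 * NX x + \<bar>Kj\<bar> * (\<bar>c\<bar> * NX x))"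
      using Z.D_pos NB by (intro mult_left_mono add_mono) auto
    finally show ?thesis by (simp add: algebra_simps)
  qed
  have qv: "q (v x) = x" for x
    using ker'[of "j (l x)"] by (simp add: v_def q.add qL)
  define u where "u z = inv j (z - v (q z))" for z
  have ju: "j (u z) = z - v (q z)" for z
    unfolding u_def by (rule f_inv_into_f) (simp add: ker' q.diff qv)
  have "linear u"
  proof (rule linearI)
    show "u (y + z) = u y + u z" for y z
      by (rule jinj) (simp add: ju j.add q.add linear_add[OF lv])
    show "u (r *\<^sub>R z) = r *\<^sub>R u z" for r z
      by (rule jinj) (simp add: ju j.scaleR q.scaleR linear_cmul[OF lv] scaleR_diff_right)
  qed
  moreover have "NY (u z) \<le> C2 * (DZ * (1 + \<bar>DZ * (C1 + \<bar>Kj\<bar> * \<bar>c\<bar>) * Kq\<bar>)) * NZ z" for z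
  proof -
    define a where "a = DZ * (C1 + \<bar>Kj\<bar> * \<bar>c\<bar>)"
    have a: "a \<ge> 0" using Z.D_pos C1 by (simp add: a_def)
    have "NY (u z) \<le> C2 * NZ (z - v (q z))" using C2'[of "u z"] by (simp add: ju)
    also have "\<dots> \<le> C2 * (DZ * (NZ z + NZ (v (q z))))"
      by (intro mult_left_mono Z.triangle_diff C2) auto
    also have "\<dots> \<le> C2 * (DZ * (NZ z + a * NX (q z)))"
      using Z.D_pos C2 Nv by (intro mult_left_mono add_mono) (auto simp: a_def)
    also have "\<dots> \<le> C2 * (DZ * (NZ z + a * (Kq * NZ z)))"
      using Z.D_pos C2 Kq a by (intro mult_left_mono add_mono) auto
    also have "\<dots> \<le> C2 * (DZ * (NZ z + \<bar>a * Kq\<bar> * NZ z))"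
      using Z.D_pos C2(1) mult_right_mono[OF abs_ge_self[of "a * Kq"] Z.nonneg[of z]]
      by (intro mult_left_mono add_mono) (auto simp: mult.assoc)
    finally show ?thesis unfolding a_def by (simp only: distrib_right mult.assoc mult_1_left)
  qed
  moreover have "u (j y) = y" for y
    using ker'[of "j y"] linear_0[OF lv] by (intro jinj) (simp add: ju)
  ultimately show ?thesis
    unfolding sequence_splits_def bounded_operator_def by (auto simp: fun_eq_iff)
qed

section \<open>The twisted sum of a quasilinear map\<close>

definition twisted_norm ::
  "('y::real_vector \<Rightarrow> real) \<Rightarrow> ('x::real_vector \<Rightarrow> real) \<Rightarrow> ('x \<Rightarrow> 'y) \<Rightarrow> 'y \<times> 'x \<Rightarrow> real" where
  "twisted_norm NY NX f z = NY (fst z - f (snd z)) + NX (snd z)"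

text \<open>The delicate point is completeness: \<open>f\<close> need not be continuous, so the
  first coordinates of a Cauchy sequence need not converge even if the second ones tend to
  \<open>x0\<close>. Subtracting \<open>(f (x n - x0), x n - x0)\<close>, of twisted norm
  \<open>NX (x n - x0)\<close>, makes the second coordinate constant and leaves a Cauchy sequence in
  \<open>Y\<close>.\<close>

lemma twisted_norm_quasi_banach:
  assumes qbX: "quasi_banach NX" and qbY: "quasi_banach NY" and f: "quasilinear NX NY f"
  shows "quasi_banach (twisted_norm NY NX f)"
proof -
  obtain DX where X: "complete_quasi_space UNIV NX DX"
    using qbX quasi_banach_complete_quasi_space by blast
  obtain DY where Y: "complete_quasi_space UNIV NY DY"
    using qbY quasi_banach_complete_quasi_space by blast
  interpret X: complete_quasi_space UNIV NX DX by fact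
  interpret Y: complete_quasi_space UNIV NY DY by fact
  interpret quasi_pair NX DX NY DY ..
  let ?N = "twisted_norm NY NX f"
  have homf: "homogeneous f" using f unfolding quasilinear_def by blast
  have f0: "f 0 = 0" by (rule homogeneous_zero[OF homf])
  have fs: "f (t *\<^sub>R x) = t *\<^sub>R f x" for t x using homf unfolding homogeneous_def by blast
  obtain Q where Q: "0 \<le> Q" "\<And>x y. NY (f (x + y) - f x - f y) \<le> Q * (NX x + NX y)"
    using quasilinear_obtain[OF f] unfolding quasilinear_bound_def by metis
  \<comment> \<open>\<open>DY * DY\<close> collects the \<open>Y\<close>-terms and
    \<open>DY * Q + DX\<close> the \<open>X\<close>-terms of the triangle estimate.\<close>
  define D where "D = DY * DY + DY * Q + DX"
  have pos: "DY > 0" "DX \<ge> 1" "DX > 0" using Y.D_pos X.D_pos X.D_ge_1 by auto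
  have D: "DX \<le> D" "DY * DY + DY * Q \<le> D" "DY * DY \<le> D" using pos Q(1) by (auto simp: D_def)
  interpret Z: quasi_space UNIV ?N D
  proof
    show "1 \<le> D" using D(1) pos by simp
    show "0 \<le> ?N z" for z by (simp add: twisted_norm_def X.nonneg Y.nonneg)
    show "z = 0" if "?N z = 0" for z
    proof -
      have "NX (snd z) = 0" "NY (fst z - f (snd z)) = 0"
        using that X.nonneg[of "snd z"] Y.nonneg[of "fst z - f (snd z)"]
        by (auto simp: twisted_norm_def)
      then have "snd z = 0" "fst z - f (snd z) = 0" using X.definite[of "snd z"] Y.definite[of "fst z - f (snd z)"] by auto
      then show ?thesis using f0 by (simp add: prod_eq_iff)
    qed
    show "?N (t *\<^sub>R z) = \<bar>t\<bar> * ?N z" for t z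
      using Y.scale[of "fst z - f (snd z)" t] X.scale[of "snd z" t]
      by (simp add: twisted_norm_def fs scaleR_diff_right distrib_left)
    show "?N (z + w) \<le> D * (?N z + ?N w)" for z w
    proof -
      obtain y x y' x' where zw: "z = (y, x)" "w = (y', x')" by fastforce
      let ?a = "NY (y - f x) + NY (y' - f x')" and ?b = "NX x + NX x'"
      have "NY (y + y' - f (x + x')) =
          NY ((y - f x) + (y' - f x') - (f (x + x') - f x - f x'))" by (simp add: algebra_simps)
      also have "\<dots> \<le> DY * (NY ((y - f x) + (y' - f x')) + NY (f (x + x') - f x - f x'))"
        by (rule Y.triangle_diff) auto
      also have "\<dots> \<le> DY * (DY * ?a + Q * ?b)"
        using pos Q by (intro mult_left_mono add_mono Y.triangle) auto
      finally have "?N (z + w) \<le> DY * (DY * ?a + Q * ?b) + DX * ?b"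
        using X.triangle[of x x'] by (simp add: twisted_norm_def zw)
      also have "\<dots> = DY * DY * ?a + (DY * Q + DX) * ?b" by (simp add: algebra_simps)
      also have "\<dots> \<le> D * ?a + D * ?b"
        using pos X.nonneg Y.nonneg Q(1)
        by (intro add_mono mult_right_mono D) (auto simp: D_def add_nonneg_nonneg)
      finally show ?thesis by (simp add: twisted_norm_def zw algebra_simps)
    qed
  qed (simp_all add: subspace_def)
  have "complete_quasi_space UNIV ?N D"
  proof
    fix s :: "nat \<Rightarrow> _"
    assume Cauchy: "\<And>e. e > 0 \<Longrightarrow> \<exists>n0. \<forall>m\<ge>n0. \<forall>n\<ge>n0. ?N (s m - s n) < e"
    define y where "y n = fst (s n)" for n
    define x where "x n = snd (s n)" for n
    have xs: "NX (x m - x n) \<le> ?N (s m - s n)" for m n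
      by (simp add: x_def twisted_norm_def Y.nonneg)
    have "\<exists>x0\<in>UNIV. (\<lambda>n. NX (x n - x0)) \<longlonglongrightarrow> 0"
      by (rule X.complete) (use Cauchy xs in \<open>auto intro: le_less_trans\<close>, meson Cauchy le_less_trans xs)
    then obtain x0 where x0: "(\<lambda>n. NX (x n - x0)) \<longlonglongrightarrow> 0" by blast
    define c where "c n = (f (x n - x0), x n - x0)" for n
    define w where "w n = y n - f x0 - f (x n - x0)" for n
    have Nc: "?N (c n) = NX (x n - x0)" for n by (simp add: c_def twisted_norm_def)
    have Nw: "?N (a, 0) = NY a" for a by (simp add: twisted_norm_def f0)
    have "\<exists>w0\<in>UNIV. (\<lambda>n. NY (w n - w0)) \<longlonglongrightarrow> 0"
    proof (rule Y.complete)
      fix e :: real assume e: "e > 0"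
      define d where "d = e / (D * (1 + 2 * D))"
      have d: "d > 0" using e Z.D_pos by (simp add: d_def)
      obtain n1 where n1: "\<And>m n. m \<ge> n1 \<Longrightarrow> n \<ge> n1 \<Longrightarrow> ?N (s m - s n) < d"
        using Cauchy[OF d] by blast
      obtain n2 where n2: "\<And>n. n \<ge> n2 \<Longrightarrow> NX (x n - x0) < d"
        using order_tendstoD(2)[OF x0 d] by (auto simp: eventually_sequentially)
      have "NY (w m - w n) < e" if "m \<ge> max n1 n2" "n \<ge> max n1 n2" for m n
      proof -
        have "(w m - w n, 0) = (s m - s n) - (c m - c n)"
          by (simp add: prod_eq_iff w_def c_def x_def y_def algebra_simps)
        then have "NY (w m - w n) \<le> D * (?N (s m - s n) + ?N (c m - c n))"
          using Z.triangle_diff[of "s m - s n" "c m - c n"] Nw[of "w m - w n"] by simp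
        also have "\<dots> \<le> D * (?N (s m - s n) + D * (?N (c m) + ?N (c n)))"
          using Z.D_pos by (intro mult_left_mono add_mono Z.triangle_diff) auto
        also have "\<dots> < D * (d + D * (d + d))"
          using Z.D_pos n1[of m n] n2[of m] n2[of n] that unfolding Nc
          by (intro mult_strict_left_mono add_strict_mono) auto
        also have "\<dots> = d * (D * (1 + 2 * D))" by (simp add: algebra_simps)
        also have "\<dots> = e" using Z.D_pos by (simp add: d_def)
        finally show ?thesis .
      qed
      then show "\<exists>n0. \<forall>m\<ge>n0. \<forall>n\<ge>n0. NY (w m - w n) < e" by blast
    qed simp
    then obtain w0 where w0: "(\<lambda>n. NY (w n - w0)) \<longlonglongrightarrow> 0" by blast
    show "\<exists>z\<in>UNIV. (\<lambda>n. ?N (s n - z)) \<longlonglongrightarrow> 0"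
    proof (rule bexI[of _ "(f x0 + w0, x0)"], rule Z.tendsto_sandwich_norm)
      show "?N (s n - (f x0 + w0, x0)) \<le> D * (NY (w n - w0) + NX (x n - x0))" for n
      proof -
        have "s n - (f x0 + w0, x0) = (w n - w0, 0) + c n"
          by (simp add: prod_eq_iff w_def c_def x_def y_def algebra_simps)
        then show ?thesis using Z.triangle[of "(w n - w0, 0)" "c n"] by (simp add: Nw Nc)
      qed
      show "(\<lambda>n. D * (NY (w n - w0) + NX (x n - x0))) \<longlonglongrightarrow> 0"
        using tendsto_mult_left[OF tendsto_add[OF w0 x0], of D] by simp
    qed auto
  qed
  then show ?thesis using quasi_banach_complete_quasi_space by blast
qed

text \<open>The vector \<open>(f x, x)\<close> has twisted norm \<open>NX x\<close>, however large
  \<open>f x\<close> is. A bounded retraction \<open>u\<close> sends it to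
  \<open>f x + u (0, x)\<close>, so the linear map \<open>- u (0, x)\<close> is close to
  \<open>f\<close>.\<close>

lemma sequences_split_imp_trivial:
  fixes NX :: "'x::real_vector \<Rightarrow> real" and NY :: "'y::real_vector \<Rightarrow> real"
  assumes qbX: "quasi_banach NX" and qbY: "quasi_banach NY"
    and split: "exact_sequences_split TYPE('y \<times> 'x) NY NX" and f: "quasilinear NX NY f"
  shows "trivial_quasilinear NX NY f"
proof -
  obtain DX where "quasi_space UNIV NX DX"
    using qbX quasinorm_quasi_space unfolding quasi_banach_def by blast
  then interpret X: quasi_space UNIV NX DX .
  obtain DY where "quasi_space UNIV NY DY"
    using qbY quasinorm_quasi_space unfolding quasi_banach_def by blast
  then interpret Y: quasi_space UNIV NY DY .
  interpret quasi_pair NX DX NY DY ..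
  have homf: "homogeneous f" using f unfolding quasilinear_def by blast
  let ?N = "twisted_norm NY NX f" and ?j = "\<lambda>y::'y. (y, 0::'x)"
  have "bounded_operator NY ?N ?j"
    unfolding bounded_operator_def
    by (auto intro!: linearI exI[of _ 1] simp: twisted_norm_def homogeneous_zero[OF homf])
  moreover have "bounded_operator ?N NX snd"
    unfolding bounded_operator_def
    by (auto intro!: linearI exI[of _ 1] simp: twisted_norm_def Y.nonneg)
  ultimately have "short_exact NY ?N NX ?j snd"
    unfolding short_exact_def by (auto simp: image_iff zero_prod_def)
  then have "sequence_splits NY ?N ?j"
    using split twisted_norm_quasi_banach[OF qbX qbY f] unfolding exact_sequences_split_def by blast
  then obtain u C where u: "linear u" "\<And>y. u (y, 0) = y" and C: "\<And>z. NY (u z) \<le> C * ?N z"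
    unfolding sequence_splits_def bounded_operator_def by (metis comp_apply id_apply)
  define l where "l x = - u (0, x)" for x
  have "linear l"
  proof (rule linearI)
    show "l (x + y) = l x + l y" for x y
      using linear_add[OF u(1), of "(0, x)" "(0, y)"] by (simp add: l_def)
    show "l (r *\<^sub>R x) = r *\<^sub>R l x" for r x
      using linear_cmul[OF u(1), of r "(0, x)"] by (simp add: l_def)
  qed
  moreover have "NY (f x - l x) \<le> C * NX x" for x
  proof -
    have "u (f x, x) = f x - l x"
      using linear_add[OF u(1), of "(f x, 0)" "(0, x)"] u(2) by (simp add: l_def)
    then show ?thesis using C[of "(f x, x)"] by (simp add: twisted_norm_def)
  qed
  ultimately show ?thesis
    using trivial_quasilinear_iff[OF homf] unfolding lin_approx_def by blast
qed

section \<open>Finite-dimensional subspaces and the bounded approximation property\<close>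

text \<open>Points of \<open>V\<close> with distances to \<open>b\<close> tending to 0 would form a
  Cauchy sequence, whose limit in the complete \<open>V\<close> would be \<open>b\<close>. So
  \<open>b\<close> has positive distance from \<open>V\<close>, and homogeneity turns this into a
  bound on the coordinate along \<open>b\<close>.\<close>

lemma coordinate_bound:
  assumes "quasi_space UNIV N D" and "complete_quasi_space V N D" and b: "b \<notin> V"
  obtains c where "0 \<le> c" and "\<And>y t. y \<in> V \<Longrightarrow> \<bar>t\<bar> \<le> c * N (y + t *\<^sub>R b)"
proof -
  interpret quasi_space UNIV N D by fact
  interpret V: complete_quasi_space V N D by fact
  have "\<exists>n::nat. \<forall>y\<in>V. 1 \<le> real (Suc n) * N (b - y)"
  proof (rule ccontr)
    assume "\<not> ?thesis"
    then obtain z where z: "\<And>n. z n \<in> V" "\<And>n. real (Suc n) * N (b - z n) < 1"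
      by (simp add: not_le) metis
    have "N (z n - b) \<le> 1 / real (Suc n)" for n
      using z(2)[of n] diff_commute[of "z n" b] by (simp add: field_simps del: of_nat_Suc)
    then have lim: "(\<lambda>n. N (z n - b)) \<longlonglongrightarrow> 0"
      using LIMSEQ_inverse_real_of_nat unfolding inverse_eq_divide
      by (intro tendsto_sandwich_norm[of "\<lambda>n. z n - b" "\<lambda>n. 1 / real (Suc n)"] UNIV_I)
    have "\<exists>y\<in>V. (\<lambda>n. N (z n - y)) \<longlonglongrightarrow> 0"
    proof (rule V.complete)
      fix e :: real assume e: "e > 0"
      then have "e / (2 * D) > 0" using D_pos by simp
      then obtain n0 where n0: "\<And>n. n \<ge> n0 \<Longrightarrow> N (z n - b) < e / (2 * D)"
        using order_tendstoD(2)[OF lim] by (auto simp: eventually_sequentially)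
      have "N (z m - z n) < e" if "m \<ge> n0" "n \<ge> n0" for m n
      proof -
        have "N (z m - z n) \<le> D * (N (z m - b) + N (z n - b))"
          using triangle_via[of "z m" b "z n"] diff_commute[of b "z n"] by simp
        also have "\<dots> < D * (e / (2 * D) + e / (2 * D))"
          using n0[OF that(1)] n0[OF that(2)] D_pos
          by (intro mult_strict_left_mono add_strict_mono) auto
        finally show ?thesis using D_pos by simp
      qed
      then show "\<exists>n0. \<forall>m\<ge>n0. \<forall>n\<ge>n0. N (z m - z n) < e" by blast
    qed (rule z)
    then obtain y where y: "y \<in> V" "(\<lambda>n. N (z n - y)) \<longlonglongrightarrow> 0" by blast
    then have "b = y" using lim_unique[OF _ _ _ lim] by simp
    with y b show False by simp
  qed
  then obtain n :: nat where n: "\<And>y. y \<in> V \<Longrightarrow> 1 \<le> real (Suc n) * N (b - y)" by blast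
  show ?thesis
  proof (rule that[of "real (Suc n)"])
    fix y t assume y: "y \<in> V"
    show "\<bar>t\<bar> \<le> real (Suc n) * N (y + t *\<^sub>R b)"
    proof (cases "t = 0")
      case True
      then show ?thesis using nonneg[of y] by simp
    next
      case False
      have "y + t *\<^sub>R b = t *\<^sub>R (b - (- inverse t) *\<^sub>R y)"
        using False by (simp add: algebra_simps)
      then have "N (y + t *\<^sub>R b) = \<bar>t\<bar> * N (b - (- inverse t) *\<^sub>R y)"
        using scale[of "b - (- inverse t) *\<^sub>R y" t] by simp
      then show ?thesis
        using mult_left_mono[OF n[OF V.mem_scale[OF y, of "- inverse t"]], of "\<bar>t\<bar>"]
        by (simp only: mult_ac) simp
    qed
  qed simp
qed

lemma quasi_space_subspace:
  assumes "quasi_space UNIV N D" "subspace V"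
  shows "quasi_space V N D"
proof -
  interpret quasi_space UNIV N D by fact
  show ?thesis using assms(2) D_ge_1 nonneg definite scale triangle by unfold_locales auto
qed

text \<open>For a new vector \<open>b\<close>, \<open>coordinate_bound\<close> makes the coordinates
  along \<open>b\<close> a Cauchy sequence of reals; what remains is Cauchy in the span of the
  previous vectors.\<close>

lemma finite_dim_complete:
  assumes sp: "quasi_space UNIV N D" and "finite B"
  shows "complete_quasi_space (span B) N D"
  using assms(2)
proof (induction B)
  case empty
  interpret V: quasi_space "span {}" N D by (rule quasi_space_subspace[OF sp]) simp
  show ?case by unfold_locales simp
next
  case (insert b B)
  interpret quasi_space UNIV N D by fact
  show ?case
  proof (cases "b \<in> span B")
    case True
    then show ?thesis using insert.IH by (simp add: span_redundant)
  next
    case False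
    interpret V: complete_quasi_space "span B" N D by (rule insert.IH)
    interpret W: quasi_space "span (insert b B)" N D by (rule quasi_space_subspace[OF sp]) simp
    obtain c where c: "0 \<le> c" "\<And>y t. y \<in> span B \<Longrightarrow> \<bar>t\<bar> \<le> c * N (y + t *\<^sub>R b)"
      using coordinate_bound[OF sp insert.IH False] by blast
    show ?thesis
    proof
      fix s :: "nat \<Rightarrow> _"
      assume s: "\<And>n. s n \<in> span (insert b B)"
        and Cauchy: "\<And>e. e > 0 \<Longrightarrow> \<exists>n0. \<forall>m\<ge>n0. \<forall>n\<ge>n0. N (s m - s n) < e"
      have "\<forall>n. \<exists>t. s n - t *\<^sub>R b \<in> span B" using s span_breakdown_eq by blast
      then obtain t where t: "\<And>n. s n - t n *\<^sub>R b \<in> span B" by metis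
      define y where "y n = s n - t n *\<^sub>R b" for n
      have yB: "y n \<in> span B" for n using t by (simp add: y_def)
      have tN: "\<bar>t m - t n\<bar> \<le> c * N (s m - s n)" for m n
        using c(2)[OF V.mem_diff[OF yB yB], of "t m - t n" m n] by (simp add: y_def algebra_simps)
      have yN: "N (y m - y n) \<le> D * (1 + c * N b) * N (s m - s n)" for m n
      proof -
        have "y m - y n = (s m - s n) - (t m - t n) *\<^sub>R b" by (simp add: y_def algebra_simps)
        then have "N (y m - y n) \<le> D * (N (s m - s n) + \<bar>t m - t n\<bar> * N b)"
          using triangle_diff[of "s m - s n" "(t m - t n) *\<^sub>R b"] by (simp add: scale)
        also have "\<dots> \<le> D * (N (s m - s n) + (c * N (s m - s n)) * N b)"
          using D_pos nonneg[of b] tN by (intro mult_left_mono add_mono mult_right_mono) auto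
        finally show ?thesis by (simp add: algebra_simps)
      qed
      have small: "\<exists>n0. \<forall>m\<ge>n0. \<forall>n\<ge>n0. K * N (s m - s n) < e" if "e > 0" "K \<ge> 0" for e K
      proof -
        have "e / (K + 1) > 0" using that by simp
        then obtain n0 where n0: "\<And>m n. m \<ge> n0 \<Longrightarrow> n \<ge> n0 \<Longrightarrow> N (s m - s n) < e / (K + 1)"
          using Cauchy by blast
        have "K * N (s m - s n) < e" if "m \<ge> n0" "n \<ge> n0" for m n
        proof -
          have "K * N (s m - s n) \<le> (K + 1) * N (s m - s n)"
            using nonneg[of "s m - s n"] by (simp add: algebra_simps)
          also have "\<dots> < (K + 1) * (e / (K + 1))"
            using n0[OF that] \<open>K \<ge> 0\<close> by (intro mult_strict_left_mono) auto
          finally show ?thesis using \<open>K \<ge> 0\<close> by simp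
        qed
        then show ?thesis by blast
      qed
      have "\<exists>y0\<in>span B. (\<lambda>n. N (y n - y0)) \<longlonglongrightarrow> 0"
      proof (rule V.complete[OF yB])
        fix e :: real assume "e > 0"
        then show "\<exists>n0. \<forall>m\<ge>n0. \<forall>n\<ge>n0. N (y m - y n) < e"
          using small[of e "D * (1 + c * N b)"] yN D_pos c(1) nonneg[of b]
          by (simp; meson le_less_trans)
      qed
      then obtain y0 where y0: "y0 \<in> span B" "(\<lambda>n. N (y n - y0)) \<longlonglongrightarrow> 0" by blast
      have "Cauchy t"
        unfolding Cauchy_def dist_real_def using small[OF _ c(1)] tN by (meson le_less_trans)
      then obtain t0 where t0: "t \<longlonglongrightarrow> t0" using Cauchy_convergent convergentD by blast
      show "\<exists>x\<in>span (insert b B). (\<lambda>n. N (s n - x)) \<longlonglongrightarrow> 0"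
      proof (rule bexI[of _ "y0 + t0 *\<^sub>R b"], rule tendsto_sandwich_norm)
        show "N (s n - (y0 + t0 *\<^sub>R b)) \<le> D * (N (y n - y0) + \<bar>t n - t0\<bar> * N b)" for n
        proof -
          have eq: "s n - (y0 + t0 *\<^sub>R b) = (y n - y0) + (t n - t0) *\<^sub>R b"
            by (simp add: y_def algebra_simps)
          show ?thesis
            unfolding eq using triangle[of "y n - y0" "(t n - t0) *\<^sub>R b"] scale[of b "t n - t0"] by simp
        qed
        have "(\<lambda>n. \<bar>t n - t0\<bar>) \<longlonglongrightarrow> 0"
          using t0 by (simp add: LIM_zero_iff tendsto_rabs_zero_iff)
        then have "(\<lambda>n. D * (N (y n - y0) + \<bar>t n - t0\<bar> * N b)) \<longlonglongrightarrow> D * (0 + 0 * N b)"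
          by (intro tendsto_intros y0)
        then show "(\<lambda>n. D * (N (y n - y0) + \<bar>t n - t0\<bar> * N b)) \<longlonglongrightarrow> 0" by simp
        have "y0 \<in> span (insert b B)" using y0(1) span_mono[of B "insert b B"] by blast
        then show "y0 + t0 *\<^sub>R b \<in> span (insert b B)"
          by (simp add: span_add span_scale span_base)
      qed simp
    qed
  qed
qed

section \<open>Quasilinear maps on finite-dimensional subspaces\<close>

context quasi_pair
begin

text \<open>This is what makes compositions with finite-rank operators bounded. In
  \<open>x = y + t *\<^sub>R b\<close> both parts are controlled by \<open>NX x\<close>, so
  quasilinearity passes the bound from \<open>span B\<close> to the larger span. With
  \<open>Q = 0\<close> it covers linear maps.\<close>

lemma bounded_on_finite_dim:
  assumes "finite B" and g: "homogeneous g" and Q: "0 \<le> Q" "quasilinear_bound NX NY g Q"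
  obtains c where "0 \<le> c" and "\<And>x. x \<in> span B \<Longrightarrow> NY (g x) \<le> c * NX x"
proof -
  have "\<exists>c\<ge>0. \<forall>x\<in>span B. NY (g x) \<le> c * NX x"
    using assms(1)
  proof (induction B)
    case empty
    then show ?case using homogeneous_zero[OF g] by (intro exI[of _ 0]) auto
  next
    case (insert b B)
    then obtain M where M: "M \<ge> 0" "\<And>x. x \<in> span B \<Longrightarrow> NY (g x) \<le> M * NX x" by blast
    show ?case
    proof (cases "b \<in> span B")
      case True
      then show ?thesis using M by (auto simp: span_redundant)
    next
      case False
      obtain c where c: "0 \<le> c" "\<And>y t. y \<in> span B \<Longrightarrow> \<bar>t\<bar> \<le> c * NX (y + t *\<^sub>R b)"
        using coordinate_bound[OF X.quasi_space_axioms
          finite_dim_complete[OF X.quasi_space_axioms insert.hyps(1)] False] by blast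
      \<comment> \<open>\<open>k\<close> and \<open>h\<close> bound the components
        \<open>t *\<^sub>R b\<close> and \<open>y\<close> of \<open>x\<close> relative to
        \<open>NX x\<close>.\<close>
      define k where "k = c * NX b"
      define h where "h = DX * (1 + k)"
      have k: "0 \<le> k" "0 \<le> h" using c X.nonneg X.D_pos by (auto simp: k_def h_def)
      have "NY (g x) \<le> DY * (Q * (h + k) + DY * (M * h + c * NY (g b))) * NX x"
        if x: "x \<in> span (insert b B)" for x
      proof -
        obtain t where "x - t *\<^sub>R b \<in> span B" using x span_breakdown_eq by blast
        then obtain y where y: "y \<in> span B" "x = y + t *\<^sub>R b" by (metis diff_add_cancel)
        have t: "\<bar>t\<bar> \<le> c * NX x" using c(2)[OF y(1), of t] y(2) by simp
        have tb: "NX (t *\<^sub>R b) \<le> k * NX x"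
          using mult_right_mono[OF t X.nonneg[of b]] by (simp add: X.scale k_def mult_ac)
        have "NX y \<le> DX * (NX x + NX (t *\<^sub>R b))"
          using X.triangle_diff[of x "t *\<^sub>R b"] y(2) by simp
        also have "\<dots> \<le> DX * (NX x + k * NX x)"
          using tb X.D_pos by (intro mult_left_mono add_mono) auto
        finally have Ny: "NX y \<le> h * NX x" by (simp add: h_def algebra_simps)
        have gt: "NY (g (t *\<^sub>R b)) = \<bar>t\<bar> * NY (g b)"
          using g Y.scale[of "g b" t] by (simp add: homogeneous_def)
        let ?d = "g (y + t *\<^sub>R b) - g y - g (t *\<^sub>R b)"
        have "NY (g x) = NY (?d + (g y + g (t *\<^sub>R b)))" by (simp add: y(2))
        also have "\<dots> \<le> DY * (NY ?d + NY (g y + g (t *\<^sub>R b)))" by (rule Y.triangle) auto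
        also have "\<dots> \<le> DY * (Q * (NX y + NX (t *\<^sub>R b)) + DY * (NY (g y) + NY (g (t *\<^sub>R b))))"
          using Q(2) Y.D_pos unfolding quasilinear_bound_def
          by (intro mult_left_mono add_mono Y.triangle) auto
        also have "\<dots> \<le> DY * (Q * (h * NX x + k * NX x) + DY * (M * (h * NX x) + c * NX x * NY (g b)))"
        proof -
          have "NY (g y) \<le> M * (h * NX x)"
            using M(2)[OF y(1)] mult_left_mono[OF Ny M(1)] by linarith
          moreover have "NY (g (t *\<^sub>R b)) \<le> c * NX x * NY (g b)"
            unfolding gt by (rule mult_right_mono[OF t]) (rule Y.nonneg, simp)
          ultimately show ?thesis
            using Y.D_pos Q(1) Ny tb by (intro mult_left_mono add_mono) auto
        qed
        finally show ?thesis by (simp add: algebra_simps)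
      qed
      moreover have "0 \<le> DY * (Q * (h + k) + DY * (M * h + c * NY (g b)))"
        using Y.D_pos Q(1) k M(1) c(1) Y.nonneg[of "g b"] by simp
      ultimately show ?thesis by blast
    qed
  qed
  then show ?thesis using that by blast
qed

lemma bounded_sum:
  assumes "finite B" and "\<And>b. b \<in> B \<Longrightarrow> \<exists>c. \<forall>x. NY (h b x) \<le> c * NX x"
  shows "\<exists>c. \<forall>x. NY (\<Sum>b\<in>B. h b x) \<le> c * NX x"
  using assms
proof (induction B)
  case empty
  then show ?case by (intro exI[of _ 0]) simp
next
  case (insert b B)
  obtain c where c: "\<And>x. NY (\<Sum>b\<in>B. h b x) \<le> c * NX x" using insert by blast
  obtain d where d: "\<And>x. NY (h b x) \<le> d * NX x" using insert.prems[of b] by blast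
  have "NY (\<Sum>b\<in>insert b B. h b x) \<le> DY * (d + c) * NX x" for x
  proof -
    have "NY (\<Sum>b\<in>insert b B. h b x) \<le> DY * (NY (h b x) + NY (\<Sum>b\<in>B. h b x))"
      using insert.hyps by (simp add: Y.triangle)
    also have "\<dots> \<le> DY * (d * NX x + c * NX x)"
      using c d Y.D_pos by (intro mult_left_mono add_mono) auto
    finally show ?thesis by (simp add: algebra_simps)
  qed
  then show ?case by blast
qed

end

text \<open>The approximating operators can be taken to be the identity on the given subspace \<open>E\<close>: the
  property itself supplies a bounded projection \<open>\<pi>\<close> onto \<open>E\<close>, and one corrects a good
  approximation \<open>t\<close> to \<open>t + (1 - t) \<pi>\<close>.\<close>

lemma BAP_exact:
  assumes sp: "quasi_space UNIV N D" and "BAP N"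
  obtains K where "0 \<le> K" and "\<And>B. finite B \<Longrightarrow> \<exists>t R. linear t \<and> finite R \<and> range t \<subseteq> span R \<and>
    (\<forall>x. N (t x) \<le> K * N x) \<and> (\<forall>x\<in>span B. t x = x)"
proof -
  interpret quasi_space UNIV N D by fact
  interpret quasi_pair N D N D ..
  obtain K where K: "K \<ge> 1" and bapK: "\<forall>E. finite_dim_subspace E \<longrightarrow> (\<forall>\<epsilon>>0.
     \<exists>t. bounded_operator N N t \<and> finite_dim_subspace (range t) \<and>
         hom_norm N N t \<le> ennreal K \<and> (\<forall>x\<in>E. N (t x - x) \<le> \<epsilon> * N x))"
    using assms(2) unfolding BAP_def by (elim exE conjE) (rule that)
  have bap: "\<exists>t R. linear t \<and> finite R \<and> range t = span R \<and> (\<forall>x. N (t x) \<le> K * N x) \<and>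
      (\<forall>x\<in>span B. N (t x - x) \<le> \<epsilon> * N x)" if B: "finite B" and \<epsilon>: "\<epsilon> > 0" for B \<epsilon>
  proof -
    have "finite_dim_subspace (span B)" using B unfolding finite_dim_subspace_def by blast
    then obtain t where t: "bounded_operator N N t" "finite_dim_subspace (range t)"
      "hom_norm N N t \<le> ennreal K" "\<forall>x\<in>span B. N (t x - x) \<le> \<epsilon> * N x"
      using bapK \<epsilon> by blast
    have "linear t" using t(1) unfolding bounded_operator_def by blast
    moreover have "\<forall>x. N (t x) \<le> K * N x"
      using hom_norm_le_iff[OF homogeneous_linear[OF \<open>linear t\<close>], of K] t(3) K by simp
    ultimately show ?thesis using t(2,4) unfolding finite_dim_subspace_def by blast
  qed
  have "\<exists>t R. linear t \<and> finite R \<and> range t \<subseteq> span R \<and>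
    (\<forall>x. N (t x) \<le> D * (K + 1) * N x) \<and> (\<forall>x\<in>span B. t x = x)" if B: "finite B" for B
  proof -
    obtain s R1 where s: "linear s" "finite R1" "range s = span R1" "\<And>x. N (s x) \<le> K * N x"
      and s1: "\<And>x. x \<in> span B \<Longrightarrow> N (s x - x) \<le> 1 / 2 * N x"
      using bap[OF B, of "1 / 2"] by auto
    have "inj_on s (span B)"
    proof (rule linear_inj_on_iff_eq_0[OF s(1) subspace_span, THEN iffD2], intro ballI impI)
      fix x assume x: "x \<in> span B" "s x = 0"
      then have "N x \<le> 1 / 2 * N x" using s1[OF x(1)] minus[of x] by simp
      then show "x = 0" using nonneg[of x] definite[of x] by simp
    qed
    then obtain g where g: "range g \<subseteq> span B" "linear g" "\<And>x. x \<in> span B \<Longrightarrow> g (s x) = x"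
      using linear_exists_left_inverse_on[OF s(1) subspace_span] by blast
    obtain c where c: "0 \<le> c" "\<And>x. x \<in> span R1 \<Longrightarrow> N (g x) \<le> c * N x"
    proof (rule bounded_on_finite_dim[OF s(2) homogeneous_linear[OF g(2)], of 0])
      show "quasilinear_bound N N g 0"
        by (simp add: quasilinear_bound_def linear_add[OF g(2)])
    qed auto
    \<comment> \<open>\<open>g\<close> inverts \<open>s\<close> on \<open>span B\<close>, so this is
      a projection onto \<open>span B\<close>. It is bounded because \<open>g\<close> is applied
      only on the finite-dimensional range of \<open>s\<close>; its norm depends on
      \<open>B\<close>.\<close>
    define \<pi> where "\<pi> x = g (s x)" for x
    have \<pi>: "linear \<pi>" unfolding \<pi>_def using linear_compose[OF s(1) g(2)] by (simp add: o_def)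
    have \<pi>B: "\<pi> x \<in> span B" for x using g(1) by (auto simp: \<pi>_def)
    have \<pi>N: "N (\<pi> x) \<le> c * K * N x" for x
    proof -
      have "N (\<pi> x) \<le> c * N (s x)" unfolding \<pi>_def using c(2) s(3) by blast
      also have "\<dots> \<le> c * (K * N x)" using s(4) c(1) by (intro mult_left_mono) auto
      finally show ?thesis by simp
    qed
    \<comment> \<open>The accuracy \<open>1 / M\<close> outweighs the norm of \<open>\<pi>\<close>:
      the correction \<open>\<pi> x - t (\<pi> x)\<close> has size at most \<open>N x\<close>, and
      the final constant \<open>D * (K + 1)\<close> is the same for all \<open>B\<close>.\<close>
    define M where "M = c * K + 1"
    have M: "M > 0" "c * K \<le> M" using c K by (auto simp: M_def intro: add_nonneg_pos)
    obtain t R2 where t: "linear t" "finite R2" "range t = span R2" "\<And>x. N (t x) \<le> K * N x"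
      and t1: "\<And>x. x \<in> span B \<Longrightarrow> N (t x - x) \<le> 1 / M * N x"
      using bap[OF B, of "1 / M"] M by auto
    define u where "u x = t x + (\<pi> x - t (\<pi> x))" for x
    have "linear u"
      unfolding u_def using linear_compose[OF \<pi> t(1)]
      by (intro linear_compose_add linear_compose_sub t \<pi>) (simp add: o_def)
    moreover have "range u \<subseteq> span (R2 \<union> B)"
    proof -
      have "t x \<in> span (R2 \<union> B)" for x
        using t(3) span_mono[of R2 "R2 \<union> B"] by blast
      moreover have "\<pi> x \<in> span (R2 \<union> B)" for x
        using \<pi>B span_mono[of B "R2 \<union> B"] by blast
      ultimately show ?thesis unfolding u_def by (auto intro!: span_add span_diff)
    qed
    moreover have "N (u x) \<le> D * (K + 1) * N x" for x
    proof -
      have "N (\<pi> x - t (\<pi> x)) \<le> 1 / M * N (\<pi> x)"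
        using t1[OF \<pi>B] diff_commute[of "\<pi> x" "t (\<pi> x)"] by simp
      also have "\<dots> \<le> 1 / M * (M * N x)"
        using \<pi>N[of x] mult_right_mono[OF M(2) nonneg[of x]] M(1) by (intro mult_left_mono) auto
      finally have *: "N (\<pi> x - t (\<pi> x)) \<le> N x" using M(1) by simp
      have "N (u x) \<le> D * (N (t x) + N (\<pi> x - t (\<pi> x)))" unfolding u_def by (rule triangle) auto
      also have "\<dots> \<le> D * (K * N x + N x)"
        using * t(4) D_pos by (intro mult_left_mono add_mono) auto
      finally show ?thesis by (simp add: algebra_simps)
    qed
    moreover have "u x = x" if "x \<in> span B" for x using g(3)[OF that] by (simp add: u_def \<pi>_def)
    ultimately show ?thesis using t(2) B by (intro exI[of _ u] exI[of _ "R2 \<union> B"]) auto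
  qed
  moreover have "0 \<le> D * (K + 1)" using D_pos K by simp
  ultimately show ?thesis using that by blast
qed

section \<open>Linear approximation on finite sets\<close>

context quasi_pair
begin

lemma quasilinear_bound_compose_linear_right:
  assumes "linear t" and "\<And>x. NX (t x) \<le> K * NX x" and "0 \<le> Q" "quasilinear_bound NX NY f Q"
  shows "quasilinear_bound NX NY (\<lambda>x. f (t x)) (Q * K)"
  unfolding quasilinear_bound_def
proof (intro allI)
  fix x y
  have "NY (f (t (x + y)) - f (t x) - f (t y)) \<le> Q * (NX (t x) + NX (t y))"
    using assms(4) unfolding quasilinear_bound_def by (simp add: linear_add[OF assms(1)])
  also have "\<dots> \<le> Q * (K * NX x + K * NX y)"
    using assms(2,3) by (intro mult_left_mono add_mono) auto
  finally show "NY (f (t (x + y)) - f (t x) - f (t y)) \<le> Q * K * (NX x + NX y)"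
    by (simp add: algebra_simps)
qed

text \<open>A linear map of finite rank on \<open>Y\<close> turns \<open>f\<close> into finitely many scalar quasilinear
  maps, which are trivial on a \<open>K\<close>-space.\<close>

lemma K_space_finite_rank_trivial:
  assumes K: "K_space NX" and f: "homogeneous f" "0 \<le> Q" "quasilinear_bound NX NY f Q"
    and R: "finite R" and fR: "range f \<subseteq> span R"
  shows "\<exists>c. lin_approx NX NY f c"
proof -
  interpret R: quasi_space UNIV "abs :: real \<Rightarrow> real" 1
    by unfold_locales (simp_all add: abs_mult abs_triangle_ineq)
  interpret XR: quasi_pair NX DX "abs :: real \<Rightarrow> real" 1 ..
  interpret YR: quasi_pair NY DY "abs :: real \<Rightarrow> real" 1 ..
  obtain CR where CR: "\<And>f Q. homogeneous f \<and> 0 \<le> Q \<and> quasilinear_bound NX (abs :: real \<Rightarrow> real) f Q \<Longrightarrow>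
      lin_approx NX abs f (CR * Q)"
    using K XR.K_const_finite_iff unfolding K_space_def K_fin_def by blast
  obtain B where B: "B \<subseteq> R" "independent B" "R \<subseteq> span B"
    using maximal_independent_subset[of R] by blast
  have finB: "finite B" using B(1) R by (rule finite_subset)
  have fB: "f x \<in> span B" for x
    using fR span_mono[OF B(3)] by (auto simp: span_span)
  \<comment> \<open>Coordinate functionals, extended to all of \<open>Y\<close> by linear algebra
    alone. They may be unbounded there, but only their values on \<open>span B\<close> matter, where
    they are bounded.\<close>
  have "\<forall>b. \<exists>\<phi> :: 'b \<Rightarrow> real. linear \<phi> \<and> (\<forall>b'\<in>B. \<phi> b' = (if b' = b then 1 else 0))"
    by (intro allI linear_independent_extend[OF B(2)])
  then obtain \<phi> :: "'b \<Rightarrow> 'b \<Rightarrow> real" where \<phi>: "\<And>b. linear (\<phi> b)"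
    "\<And>b b'. b' \<in> B \<Longrightarrow> \<phi> b b' = (if b' = b then 1 else 0)" by metis
  have expand: "z = (\<Sum>b\<in>B. \<phi> b z *\<^sub>R b)" if "z \<in> span B" for z
  proof -
    have "linear (\<lambda>z. \<Sum>b\<in>B. \<phi> b z *\<^sub>R b)"
      by (intro linearI) (simp_all add: linear_add[OF \<phi>(1)] linear_cmul[OF \<phi>(1)]
          scaleR_add_left sum.distrib scaleR_sum_right)
    moreover have "(\<Sum>b\<in>B. \<phi> b z *\<^sub>R b) = z" if "z \<in> B" for z
    proof -
      have "(\<Sum>b\<in>B. \<phi> b z *\<^sub>R b) = (\<Sum>b\<in>B. if b = z then z else 0)"
        using that by (intro sum.cong) (auto simp: \<phi>(2))
      then show ?thesis using that finB by simp
    qed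
    ultimately show ?thesis
      using linear_eq_on_span[of "\<lambda>z. \<Sum>b\<in>B. \<phi> b z *\<^sub>R b" "\<lambda>z. z" B z] that
        linear_id[where 'a='b, unfolded id_def] by simp
  qed
  have "\<exists>l. linear l \<and> (\<exists>c. \<forall>x. \<bar>\<phi> b (f x) - l x\<bar> \<le> c * NX x)" for b
  proof -
    obtain c where c: "0 \<le> c" "\<And>z. z \<in> span B \<Longrightarrow> \<bar>\<phi> b z\<bar> \<le> c * NY z"
    proof (rule YR.bounded_on_finite_dim[OF finB homogeneous_linear[OF \<phi>(1)], of 0 b])
      show "quasilinear_bound NY abs (\<phi> b) 0"
        by (simp add: quasilinear_bound_def linear_add[OF \<phi>(1)])
    qed auto
    have "homogeneous (\<lambda>x. \<phi> b (f x))"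
      using f(1) by (simp add: homogeneous_def linear_cmul[OF \<phi>(1)])
    moreover have "quasilinear_bound NX abs (\<lambda>x. \<phi> b (f x)) (c * Q)"
      unfolding quasilinear_bound_def
    proof (intro allI)
      fix x y
      have "\<bar>\<phi> b (f (x + y)) - \<phi> b (f x) - \<phi> b (f y)\<bar> = \<bar>\<phi> b (f (x + y) - f x - f y)\<bar>"
        by (simp add: linear_diff[OF \<phi>(1)])
      also have "\<dots> \<le> c * NY (f (x + y) - f x - f y)"
        by (intro c span_diff fB)
      also have "\<dots> \<le> c * (Q * (NX x + NX y))"
        using f(3) c(1) unfolding quasilinear_bound_def by (intro mult_left_mono) auto
      finally show "\<bar>\<phi> b (f (x + y)) - \<phi> b (f x) - \<phi> b (f y)\<bar> \<le> c * Q * (NX x + NX y)"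
        by (simp add: mult.assoc)
    qed
    ultimately have "lin_approx NX abs (\<lambda>x. \<phi> b (f x)) (CR * (c * Q))"
      using CR c(1) f(2) by simp
    then show ?thesis unfolding lin_approx_def by blast
  qed
  then obtain l where l: "\<And>b. linear (l b)"
    "\<And>b. \<exists>c. \<forall>x. \<bar>\<phi> b (f x) - l b x\<bar> \<le> c * NX x" by metis
  have "\<exists>c. \<forall>x. NY (\<Sum>b\<in>B. (\<phi> b (f x) - l b x) *\<^sub>R b) \<le> c * NX x"
  proof (rule bounded_sum[OF finB])
    fix b
    obtain c where c: "\<And>x. \<bar>\<phi> b (f x) - l b x\<bar> \<le> c * NX x" using l(2) by blast
    have "NY ((\<phi> b (f x) - l b x) *\<^sub>R b) \<le> c * NY b * NX x" for x
      using mult_right_mono[OF c[of x] Y.nonneg[of b]] by (simp add: Y.scale mult_ac)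
    then show "\<exists>c. \<forall>x. NY ((\<phi> b (f x) - l b x) *\<^sub>R b) \<le> c * NX x" by blast
  qed
  moreover have "(\<Sum>b\<in>B. (\<phi> b (f x) - l b x) *\<^sub>R b) = f x - (\<Sum>b\<in>B. l b x *\<^sub>R b)" for x
    using expand[OF fB[of x]] by (simp add: scaleR_diff_left sum_subtractf)
  moreover have "linear (\<lambda>x. \<Sum>b\<in>B. l b x *\<^sub>R b)"
    by (intro linearI) (simp_all add: linear_add[OF l(1)] linear_cmul[OF l(1)]
        scaleR_add_left sum.distrib scaleR_sum_right)
  ultimately show ?thesis unfolding lin_approx_def by auto
qed

text \<open>If \<open>t\<close> acts on \<open>X\<close>, then \<open>f (t x)\<close> is bounded in
  \<open>x\<close>, as \<open>f\<close> is bounded on the range of \<open>t\<close>, and it agrees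
  with \<open>f\<close> on \<open>A\<close>. If \<open>t\<close> acts on \<open>Y\<close> and fixes
  the values of \<open>f\<close> on \<open>A\<close>, then \<open>t (f x)\<close> ranges in finite
  dimension and is linear plus bounded by the K-space hypothesis. Either way the bound
  \<open>Q\<close> grows by the factor \<open>K\<close> only.\<close>

lemma finite_approximation:
  assumes K0: "K0_fin NX NY" and BAP: "BAP NX \<or> (K_space NX \<and> BAP NY)"
  obtains C where "0 \<le> C" and "\<And>f Q A. \<lbrakk>homogeneous f; 0 \<le> Q; quasilinear_bound NX NY f Q; finite A\<rbrakk> \<Longrightarrow>
    \<exists>l. linear l \<and> (\<forall>x\<in>A. NY (f x - l x) \<le> C * Q * NX x)"
proof -
  obtain C0 where C0: "C0 \<ge> 0" "\<And>f Q. homogeneous f \<Longrightarrow> 0 \<le> Q \<Longrightarrow> quasilinear_bound NX NY f Q \<Longrightarrow>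
      (\<exists>b. \<forall>x. NY (f x) \<le> b * NX x) \<Longrightarrow> lin_approx NX NY f (C0 * Q)"
    using K0 unfolding K0_fin_def by blast
  from BAP show ?thesis
  proof
    assume "BAP NX"
    then obtain K where K: "0 \<le> K" "\<And>B. finite B \<Longrightarrow> \<exists>t R. linear t \<and> finite R \<and> range t \<subseteq> span R \<and>
      (\<forall>x. NX (t x) \<le> K * NX x) \<and> (\<forall>x\<in>span B. t x = x)"
      using BAP_exact[OF X.quasi_space_axioms] by blast
    show ?thesis
    proof (rule that[of "C0 * K"])
      fix f Q and A :: "'a set"
      assume f: "homogeneous f" "0 \<le> Q" "quasilinear_bound NX NY f Q" and A: "finite A"
      obtain t R where t: "linear t" "finite R" "range t \<subseteq> span R"
        "\<And>x. NX (t x) \<le> K * NX x" "\<And>x. x \<in> span A \<Longrightarrow> t x = x"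
        using K(2)[OF A] by blast
      obtain c where c: "0 \<le> c" "\<And>x. x \<in> span R \<Longrightarrow> NY (f x) \<le> c * NX x"
        using bounded_on_finite_dim[OF t(2) f] by blast
      have "NY (f (t x)) \<le> c * K * NX x" for x
      proof -
        have "NY (f (t x)) \<le> c * NX (t x)" using c(2) t(3) by blast
        also have "\<dots> \<le> c * (K * NX x)" using t(4) c(1) by (intro mult_left_mono) auto
        finally show ?thesis by (simp add: mult.assoc)
      qed
      moreover have "homogeneous (\<lambda>x. f (t x))"
        using f(1) by (simp add: homogeneous_def linear_cmul[OF t(1)])
      ultimately have "lin_approx NX NY (\<lambda>x. f (t x)) (C0 * (Q * K))"
        using quasilinear_bound_compose_linear_right[OF t(1,4) f(2,3)] f(2) K(1)
        by (intro C0(2)) auto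
      then obtain l where l: "linear l" "\<And>x. NY (f (t x) - l x) \<le> C0 * (Q * K) * NX x"
        unfolding lin_approx_def by blast
      have "NY (f x - l x) \<le> C0 * K * Q * NX x" if "x \<in> A" for x
        using l(2)[of x] t(5)[OF span_base[OF that]] by (simp add: mult_ac)
      then show "\<exists>l. linear l \<and> (\<forall>x\<in>A. NY (f x - l x) \<le> C0 * K * Q * NX x)" using l(1) by blast
    qed (use C0 K in simp)
  next
    assume KB: "K_space NX \<and> BAP NY"
    then obtain K where K: "0 \<le> K" "\<And>B. finite B \<Longrightarrow> \<exists>t R. linear t \<and> finite R \<and> range t \<subseteq> span R \<and>
      (\<forall>x. NY (t x) \<le> K * NY x) \<and> (\<forall>x\<in>span B. t x = x)"
      using BAP_exact[OF Y.quasi_space_axioms] by blast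
    show ?thesis
    proof (rule that[of "C0 * K"])
      fix f Q and A :: "'a set"
      assume f: "homogeneous f" "0 \<le> Q" "quasilinear_bound NX NY f Q" and A: "finite A"
      obtain t R where t: "linear t" "finite R" "range t \<subseteq> span R"
        "\<And>x. NY (t x) \<le> K * NY x" "\<And>x. x \<in> span (f ` A) \<Longrightarrow> t x = x"
        using K(2)[OF finite_imageI[OF A, of f]] by blast
      define g where "g x = t (f x)" for x
      have g: "homogeneous g"
        using f(1) by (simp add: homogeneous_def g_def linear_cmul[OF t(1)])
      have gQ: "quasilinear_bound NX NY g (K * Q)"
        unfolding quasilinear_bound_def
      proof (intro allI)
        fix x y
        have "NY (g (x + y) - g x - g y) = NY (t (f (x + y) - f x - f y))"
          by (simp add: g_def linear_diff[OF t(1)])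
        also have "\<dots> \<le> K * NY (f (x + y) - f x - f y)" by (rule t)
        also have "\<dots> \<le> K * (Q * (NX x + NX y))"
          using f(3) K(1) unfolding quasilinear_bound_def by (intro mult_left_mono) auto
        finally show "NY (g (x + y) - g x - g y) \<le> K * Q * (NX x + NX y)" by (simp add: mult.assoc)
      qed
      have KQ: "0 \<le> K * Q" using K f by simp
      have "\<exists>c. lin_approx NX NY g c"
        by (rule K_space_finite_rank_trivial[OF _ g KQ gQ t(2)]) (use KB t(3) in \<open>auto simp: g_def\<close>)
      then obtain l c where l: "linear l" "\<And>x. NY (g x - l x) \<le> c * NX x"
        unfolding lin_approx_def by blast
      \<comment> \<open>The constant \<open>c\<close> of the first linear map is uncontrolled; it
        only shows that \<open>g x - l x\<close> is bounded. The defect is still that of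
        \<open>g\<close>, so this second approximation has a uniform constant.\<close>
      have "lin_approx NX NY (\<lambda>x. g x - l x) (C0 * (K * Q))"
        using l(2) KQ gQ quasilinear_bound_diff_linear[OF l(1)]
        by (intro C0(2) homogeneous_diff g homogeneous_linear l) auto
      then obtain k where k: "linear k" "\<And>x. NY (g x - l x - k x) \<le> C0 * (K * Q) * NX x"
        unfolding lin_approx_def by blast
      have "NY (f x - (l x + k x)) \<le> C0 * K * Q * NX x" if "x \<in> A" for x
      proof -
        have "g x = f x" unfolding g_def using that by (intro t(5) span_base) auto
        then show ?thesis using k(2)[of x] by (simp add: algebra_simps)
      qed
      then show "\<exists>l. linear l \<and> (\<forall>x\<in>A. NY (f x - l x) \<le> C0 * K * Q * NX x)"
        using linear_compose_add[OF l(1) k(1)] by blast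
    qed (use C0 K in simp)
  qed
qed

end

section \<open>Ultrafilters and ultrapowers\<close>

text \<open>Zorn's lemma for proper filters, represented as families of sets (\<open>isf\<close>)
  that contain all \<open>F\<close>-large sets; a maximal family is then turned back into a
  filter.\<close>

lemma ultrafilter_le_exists:
  fixes F :: "'a filter"
  assumes "F \<noteq> bot"
  obtains V where "V \<le> F" and "ultrafilter V"
proof -
  define G0 where "G0 = {S. eventually (\<lambda>x. x \<in> S) F}"
  define isf where "isf G \<longleftrightarrow> G0 \<subseteq> G \<and> {} \<notin> G \<and> (\<forall>S\<in>G. \<forall>T\<in>G. S \<inter> T \<in> G) \<and>
    (\<forall>S\<in>G. \<forall>T. S \<subseteq> T \<longrightarrow> T \<in> G)" for G :: "'a set set"
  have isfD: "isf G \<Longrightarrow> G0 \<subseteq> G" "isf G \<Longrightarrow> {} \<notin> G"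
    "isf G \<Longrightarrow> S \<in> G \<Longrightarrow> T \<in> G \<Longrightarrow> S \<inter> T \<in> G" "isf G \<Longrightarrow> S \<in> G \<Longrightarrow> S \<subseteq> T \<Longrightarrow> T \<in> G" for G S T
    unfolding isf_def by metis+
  have "isf G0"
    unfolding isf_def G0_def using assms
    by (auto intro: eventually_conj elim: eventually_mono simp: trivial_limit_def)
  have "\<exists>M\<in>{G. isf G}. \<forall>X\<in>{G. isf G}. M \<subseteq> X \<longrightarrow> X = M"
  proof (rule subset_Zorn_nonempty)
    show "{G. isf G} \<noteq> {}" using \<open>isf G0\<close> by blast
    fix \<C> assume ne: "\<C> \<noteq> {}" and ch: "subset.chain {G. isf G} \<C>"
    have isf: "isf G" if "G \<in> \<C>" for G using ch that unfolding subset.chain_def by blast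
    note isf_G0 = isfD(1)[OF isf] and isf_emp = isfD(2)[OF isf]
      and isf_int = isfD(3)[OF isf] and isf_up = isfD(4)[OF isf]
    have tot: "G \<subseteq> H \<or> H \<subseteq> G" if "G \<in> \<C>" "H \<in> \<C>" for G H
      using ch that unfolding subset.chain_def by blast
    have "S \<inter> T \<in> \<Union>\<C>" if S: "S \<in> \<Union>\<C>" and T: "T \<in> \<Union>\<C>" for S T
    proof -
      obtain G H where G: "G \<in> \<C>" "S \<in> G" and H: "H \<in> \<C>" "T \<in> H" using S T by blast
      then obtain K where "K \<in> \<C>" "S \<in> K" "T \<in> K" using tot[OF G(1) H(1)] by blast
      then show ?thesis using isf_int[of K S T] by blast
    qed
    moreover have "G0 \<subseteq> \<Union>\<C>" using ne isf_G0 by blast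
    moreover have "{} \<notin> \<Union>\<C>" using isf_emp by blast
    moreover have "\<forall>S\<in>\<Union>\<C>. \<forall>T. S \<subseteq> T \<longrightarrow> T \<in> \<Union>\<C>"
    proof (intro ballI allI impI)
      fix S T assume "S \<in> \<Union>\<C>" "S \<subseteq> T"
      then obtain G where "G \<in> \<C>" "S \<in> G" by blast
      then show "T \<in> \<Union>\<C>" using isf_up[of G S T] \<open>S \<subseteq> T\<close> by blast
    qed
    ultimately show "\<Union>\<C> \<in> {G. isf G}" unfolding isf_def by blast
  qed
  then obtain M where M: "isf M" and max: "\<And>X. isf X \<Longrightarrow> M \<subseteq> X \<Longrightarrow> X = M" by blast
  have UNIV: "UNIV \<in> M" using isfD(1)[OF M] unfolding G0_def by auto
  note up = isfD(4)[OF M] and int = isfD(3)[OF M] and emp = isfD(2)[OF M]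
  define V where "V = Abs_filter (\<lambda>P. {x. P x} \<in> M)"
  have V: "eventually P V \<longleftrightarrow> {x. P x} \<in> M" for P
    unfolding V_def
  proof (rule eventually_Abs_filter, unfold_locales)
    show "{x. True} \<in> M" using UNIV by simp
    show "{x. P x \<and> Q x} \<in> M" if "{x. P x} \<in> M" "{x. Q x} \<in> M" for P Q
      using int[OF that] by (simp add: Collect_conj_eq)
    show "{x. Q x} \<in> M" if "\<forall>x. P x \<longrightarrow> Q x" "{x. P x} \<in> M" for P Q
      using up[OF that(2)] that(1) by blast
  qed
  have "V \<le> F"
  proof (rule filter_leI)
    fix P assume "eventually P F"
    then have "{x. P x} \<in> G0" by (simp add: G0_def)
    then show "eventually P V" using isfD(1)[OF M] unfolding V by blast
  qed
  moreover have "ultrafilter V"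
    unfolding ultrafilter_def
  proof (intro conjI allI)
    show "V \<noteq> bot" using emp V[of "\<lambda>_. False"] by (auto simp: trivial_limit_def)
    fix P
    show "eventually P V \<or> eventually (\<lambda>i. \<not> P i) V"
    proof (rule ccontr)
      assume "\<not> ?thesis"
      then have no: "{x. P x} \<notin> M" "{x. \<not> P x} \<notin> M" by (auto simp: V)
      \<comment> \<open>The filter generated by \<open>M\<close> and \<open>{x. P x}\<close>. It is
        proper because the complement of \<open>{x. P x}\<close> is not in \<open>M\<close>, and it
        contradicts maximality.\<close>
      define X where "X = {T. \<exists>S\<in>M. S \<inter> {x. P x} \<subseteq> T}"
      have MX: "M \<subseteq> X" and PX: "{x. P x} \<in> X" using UNIV unfolding X_def by auto
      have "{} \<notin> X"
      proof
        assume "{} \<in> X"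
        then obtain S where "S \<in> M" "S \<inter> {x. P x} \<subseteq> {}" unfolding X_def by blast
        then have "{x. \<not> P x} \<in> M" using up[of S "{x. \<not> P x}"] by blast
        then show False using no by blast
      qed
      moreover have "S \<inter> T \<in> X" if S: "S \<in> X" and T: "T \<in> X" for S T
      proof -
        obtain S' T' where "S' \<in> M" "S' \<inter> {x. P x} \<subseteq> S" "T' \<in> M" "T' \<inter> {x. P x} \<subseteq> T"
          using S T unfolding X_def by blast
        then show ?thesis unfolding X_def using int[of S' T'] by blast
      qed
      moreover have "\<forall>S\<in>X. \<forall>T. S \<subseteq> T \<longrightarrow> T \<in> X" unfolding X_def by blast
      moreover have "G0 \<subseteq> X" using isfD(1)[OF M] MX by blast
      ultimately have "isf X" unfolding isf_def by blast
      then show False using max[OF _ MX] PX no by blast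
    qed
  qed
  ultimately show ?thesis by (rule that)
qed

text \<open>Compactness of the interval gives a cluster point. For an ultrafilter a cluster point is
  a limit: if the values were not eventually in a neighbourhood, they would eventually be outside
  it.\<close>

lemma ultrafilter_bounded_convergent:
  fixes f :: "'i \<Rightarrow> real"
  assumes U: "ultrafilter U" and bd: "\<And>i. \<bar>f i\<bar> \<le> C"
  obtains L where "(f \<longlongrightarrow> L) U"
proof -
  have ne: "filtermap f U \<noteq> bot" using U by (simp add: ultrafilter_def filtermap_bot_iff)
  have ev: "eventually (\<lambda>x. x \<in> {-C..C}) (filtermap f U)"
    using bd by (auto simp: eventually_filtermap abs_le_iff minus_le_iff intro!: always_eventually)
  have "compact {-C..C}" by (rule compact_Icc)
  then obtain x where x: "inf (nhds x) (filtermap f U) \<noteq> bot"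
    using ne ev unfolding compact_filter by blast
  have "(f \<longlongrightarrow> x) U"
  proof (rule topological_tendstoI)
    fix S assume S: "open S" "x \<in> S"
    show "eventually (\<lambda>i. f i \<in> S) U"
    proof (rule ccontr)
      assume "\<not> ?thesis"
      then have "eventually (\<lambda>i. f i \<notin> S) U" using U unfolding ultrafilter_def by blast
      then have "eventually (\<lambda>y. y \<notin> S) (filtermap f U)" by (simp add: eventually_filtermap)
      moreover have "eventually (\<lambda>y. y \<in> S) (nhds x)" using S by (rule eventually_nhds_in_open)
      ultimately have "eventually (\<lambda>y. False) (inf (nhds x) (filtermap f U))"
        unfolding eventually_inf by (intro exI conjI) auto
      then show False using x by (simp add: trivial_limit_def)
    qed
  qed
  then show ?thesis by (rule that)
qed

section \<open>Calculus in a single ultrapower\<close>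

locale ultrapower_space = quasi_space "UNIV :: 'a::real_vector set" N D
  for N :: "'a::real_vector \<Rightarrow> real" and D +
  fixes U :: "'i filter" and p :: real
  assumes ultra: "ultrafilter U" and p_norm: "p_norm p N"
begin

abbreviation "BF \<equiv> bounded_families N :: ('i \<Rightarrow> 'a) set"
abbreviation "cls \<equiv> ultra_class U N"

lemma nontrivial: "U \<noteq> bot"
  using ultra by (simp add: ultrafilter_def)

lemma BF_I: "(\<And>i. N (x i) \<le> C) \<Longrightarrow> x \<in> BF"
  by (auto simp: bounded_families_def)

lemma BF_E:
  assumes "x \<in> BF"
  obtains C where "0 \<le> C" and "\<And>i. N (x i) \<le> C"
proof -
  obtain C where "\<And>i. N (x i) \<le> C" using assms by (auto simp: bounded_families_def)
  then have "N (x i) \<le> \<bar>C\<bar>" for i using abs_ge_self order_trans by blast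
  then show ?thesis using that[of "\<bar>C\<bar>"] by simp
qed

lemma BF_const: "(\<lambda>_. x) \<in> BF"
  by (rule BF_I) (rule order_refl)

lemma BF_add:
  assumes "x \<in> BF" "y \<in> BF"
  shows "(\<lambda>i. x i + y i) \<in> BF"
proof -
  obtain C E where "\<And>i. N (x i) \<le> C" "\<And>i. N (y i) \<le> E" using assms by (meson BF_E)
  then have "N (x i + y i) \<le> D * (C + E)" for i
    using triangle[of "x i" "y i"] mult_left_mono[of "N (x i) + N (y i)" "C + E" D] D_pos
    by (smt (verit) UNIV_I)
  then show ?thesis by (rule BF_I)
qed

lemma BF_scale:
  assumes "x \<in> BF" "\<And>i. \<bar>t i\<bar> \<le> c"
  shows "(\<lambda>i. t i *\<^sub>R x i) \<in> BF"
proof -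
  obtain C where C: "0 \<le> C" "\<And>i. N (x i) \<le> C" using assms by (meson BF_E)
  have "N (t i *\<^sub>R x i) \<le> c * C" for i
    using mult_mono[OF assms(2)[of i] C(2)[of i] _ nonneg] assms(2)[of i] by (simp add: scale)
  then show ?thesis by (rule BF_I)
qed

lemma BF_diff: "x \<in> BF \<Longrightarrow> y \<in> BF \<Longrightarrow> (\<lambda>i. x i - y i) \<in> BF"
  using BF_add[OF _ BF_scale[of y "\<lambda>_. -1" 1], of x] by simp

lemma limit_zero_I:
  assumes "(b \<longlongrightarrow> 0) U" and "eventually (\<lambda>i. N (x i) \<le> b i) U"
  shows "((\<lambda>i. N (x i)) \<longlongrightarrow> 0) U"
  by (rule tendsto_sandwich[OF _ assms(2) tendsto_const assms(1)]) (simp add: nonneg)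

lemma limit_zero_add:
  assumes "((\<lambda>i. N (x i)) \<longlongrightarrow> 0) U" "((\<lambda>i. N (y i)) \<longlongrightarrow> 0) U"
  shows "((\<lambda>i. N (x i + y i)) \<longlongrightarrow> 0) U"
proof (rule limit_zero_I)
  show "((\<lambda>i. D * (N (x i) + N (y i))) \<longlongrightarrow> 0) U"
    using tendsto_mult_left[OF tendsto_add[OF assms], of D] by simp
qed (simp add: triangle)

lemma limit_zero_scale:
  assumes "((\<lambda>i. N (x i)) \<longlongrightarrow> 0) U"
  shows "((\<lambda>i. N (t *\<^sub>R x i)) \<longlongrightarrow> 0) U"
  using tendsto_mult_left[OF assms, of "\<bar>t\<bar>"] by (simp add: scale)

lemma equiv_ultra_rel: "equiv BF (ultra_rel U N)"
proof (rule equivI)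
  show "ultra_rel U N \<subseteq> BF \<times> BF" by (auto simp: ultra_rel_def)
  show "refl_on BF (ultra_rel U N)" by (auto simp: refl_on_def ultra_rel_def)
  show "sym (ultra_rel U N)"
    by (auto simp: sym_def ultra_rel_def diff_commute)
  show "trans (ultra_rel U N)"
  proof (rule transI)
    fix x y z assume "(x, y) \<in> ultra_rel U N" "(y, z) \<in> ultra_rel U N"
    then show "(x, z) \<in> ultra_rel U N"
      using limit_zero_add[of "\<lambda>i. x i - y i" "\<lambda>i. y i - z i"] by (simp add: ultra_rel_def)
  qed
qed

lemma cls_eq_iff:
  assumes "x \<in> BF" "y \<in> BF"
  shows "cls x = cls y \<longleftrightarrow> ((\<lambda>i. N (x i - y i)) \<longlongrightarrow> 0) U"
  unfolding ultra_class_def eq_equiv_class_iff[OF equiv_ultra_rel assms]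
  using assms by (simp add: ultra_rel_def)

lemma cls_cong:
  assumes "x \<in> BF" "y \<in> BF" "eventually (\<lambda>i. x i = y i) U"
  shows "cls x = cls y"
  unfolding cls_eq_iff[OF assms(1,2)]
  by (rule tendsto_eventually) (use assms(3) in eventually_elim, simp)

lemma cls_self: "x \<in> BF \<Longrightarrow> x \<in> cls x"
  unfolding ultra_class_def by (rule equiv_class_self[OF equiv_ultra_rel])

lemma cls_memD: "y \<in> cls x \<Longrightarrow> x \<in> BF \<and> y \<in> BF \<and> cls y = cls x"
  unfolding ultra_class_def using equiv_class_eq[OF equiv_ultra_rel, of x y]
  by (auto simp: ultra_rel_def)

lemma cls_in [simp]: "x \<in> BF \<Longrightarrow> cls x \<in> ultrapower U N"
  unfolding ultrapower_def ultra_class_def by (rule quotientI)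

lemma ultrapower_E:
  assumes "\<xi> \<in> ultrapower U N"
  obtains x where "x \<in> BF" and "\<xi> = cls x"
  using assms unfolding ultrapower_def ultra_class_def by (rule quotientE)

lemma add_cls:
  assumes x: "x \<in> BF" and y: "y \<in> BF"
  shows "ultra_add U N (cls x) (cls y) = cls (\<lambda>i. x i + y i)"
proof -
  have "cls (\<lambda>i. x' i + y' i) = cls (\<lambda>i. x i + y i)" if "x' \<in> cls x" "y' \<in> cls y" for x' y'
  proof -
    have x': "x' \<in> BF" "((\<lambda>i. N (x' i - x i)) \<longlongrightarrow> 0) U"
      using cls_memD[OF that(1)] cls_eq_iff[of x' x] by auto
    have y': "y' \<in> BF" "((\<lambda>i. N (y' i - y i)) \<longlongrightarrow> 0) U"
      using cls_memD[OF that(2)] cls_eq_iff[of y' y] by auto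
    show ?thesis
      unfolding cls_eq_iff[OF BF_add[OF x'(1) y'(1)] BF_add[OF x y]]
      using limit_zero_add[OF x'(2) y'(2)] by (simp add: algebra_simps)
  qed
  then show ?thesis
    unfolding ultra_add_def using cls_self[OF x] cls_self[OF y] by blast
qed

lemma scale_cls:
  assumes x: "x \<in> BF"
  shows "ultra_scale U N t (cls x) = cls (\<lambda>i. t *\<^sub>R x i)"
proof -
  have "cls (\<lambda>i. t *\<^sub>R x' i) = cls (\<lambda>i. t *\<^sub>R x i)" if "x' \<in> cls x" for x'
  proof -
    have x': "x' \<in> BF" "((\<lambda>i. N (x' i - x i)) \<longlongrightarrow> 0) U"
      using cls_memD[OF that] cls_eq_iff[of x' x] by auto
    show ?thesis
      using limit_zero_scale[OF x'(2), of t] BF_scale[OF x, of "\<lambda>_. t" "\<bar>t\<bar>"]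
        BF_scale[OF x'(1), of "\<lambda>_. t" "\<bar>t\<bar>"]
      by (subst cls_eq_iff) (auto simp: scaleR_diff_right)
  qed
  then show ?thesis
    unfolding ultra_scale_def using cls_self[OF x] by blast
qed

lemma diff_cls:
  assumes "x \<in> BF" "y \<in> BF"
  shows "ultra_add U N (cls x) (ultra_scale U N (-1) (cls y)) = cls (\<lambda>i. x i - y i)"
  using assms add_cls[OF assms(1) BF_scale[OF assms(2), of "\<lambda>_. -1" 1]] by (simp add: scale_cls)

text \<open>Here the p-norm is essential: \<open>N (y i) powr p\<close> and
  \<open>N (x i) powr p\<close> differ by at most \<open>N (y i - x i) powr p\<close>, so equivalent
  families have the same limit. The factor \<open>D\<close> of a mere quasinorm would
  survive.\<close>

lemma norm_tendsto_cong:
  assumes L: "((\<lambda>i. N (x i)) \<longlongrightarrow> L) U" and d: "((\<lambda>i. N (y i - x i)) \<longlongrightarrow> 0) U"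
  shows "((\<lambda>i. N (y i)) \<longlongrightarrow> L) U"
proof -
  have p: "0 < p" and sub: "\<And>x y. N (x + y) powr p \<le> N x powr p + N y powr p"
    using p_norm unfolding p_norm_def by auto
  have L0: "0 \<le> L"
    by (rule tendsto_lowerbound[OF L]) (auto simp: nonneg nontrivial)
  have d': "((\<lambda>i. N (y i - x i) powr p) \<longlongrightarrow> 0) U"
    using tendsto_powr'[OF d tendsto_const, of p] p nonneg by simp
  have x': "((\<lambda>i. N (x i) powr p) \<longlongrightarrow> L powr p) U"
    using tendsto_powr'[OF L tendsto_const, of p] p nonneg by simp
  have "\<bar>N (y i) powr p - N (x i) powr p\<bar> \<le> N (y i - x i) powr p" for i
    using sub[of "y i - x i" "x i"] sub[of "x i - y i" "y i"] diff_commute[of "x i" "y i"]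
    by (simp add: abs_le_iff)
  then have "((\<lambda>i. N (y i) powr p - N (x i) powr p) \<longlongrightarrow> 0) U"
    by (intro Lim_null_comparison[OF _ d']) simp
  from tendsto_add[OF this x'] have "((\<lambda>i. N (y i) powr p) \<longlongrightarrow> L powr p) U" by simp
  from tendsto_powr'[OF this tendsto_const, of "1 / p"]
  have "((\<lambda>i. (N (y i) powr p) powr (1 / p)) \<longlongrightarrow> (L powr p) powr (1 / p)) U"
    using p by simp
  then show ?thesis using p L0 by (simp add: powr_powr nonneg)
qed

lemma norm_cls_eq:
  assumes x: "x \<in> BF" and L: "((\<lambda>i. N (x i)) \<longlongrightarrow> L) U"
  shows "ultra_norm U N (cls x) = L"
proof -
  have "Lim U (\<lambda>i. N (y i)) = L" if "y \<in> cls x" for y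
  proof -
    have "((\<lambda>i. N (y i - x i)) \<longlongrightarrow> 0) U"
      using cls_memD[OF that] cls_eq_iff[of y x] by auto
    then show ?thesis using norm_tendsto_cong[OF L] nontrivial by (intro tendsto_Lim) auto
  qed
  then have "(\<lambda>y. Lim U (\<lambda>i. N (y i))) ` cls x = {L}"
    using cls_self[OF x] by blast
  then show ?thesis unfolding ultra_norm_def by simp
qed

lemma norm_cls_tendsto:
  assumes x: "x \<in> BF"
  shows "((\<lambda>i. N (x i)) \<longlongrightarrow> ultra_norm U N (cls x)) U"
proof -
  obtain C where "\<And>i. N (x i) \<le> C" using x by (meson BF_E)
  then obtain L where L: "((\<lambda>i. N (x i)) \<longlongrightarrow> L) U"
    using ultrafilter_bounded_convergent[OF ultra, of "\<lambda>i. N (x i)" C] nonneg by auto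
  then show ?thesis using norm_cls_eq[OF x L] by simp
qed

lemma norm_cls_le:
  assumes "x \<in> BF" and "eventually (\<lambda>i. N (x i) \<le> B) U"
  shows "ultra_norm U N (cls x) \<le> B"
  by (rule tendsto_upperbound[OF norm_cls_tendsto[OF assms(1)] assms(2) nontrivial])

lemma norm_cls_nonneg: "x \<in> BF \<Longrightarrow> 0 \<le> ultra_norm U N (cls x)"
  by (rule tendsto_lowerbound[OF norm_cls_tendsto]) (auto simp: nonneg nontrivial)

lemma norm_cls_const: "ultra_norm U N (cls (\<lambda>_. x)) = N x"
  by (intro norm_cls_eq BF_const tendsto_const)

lemma cls_const_inj: "cls (\<lambda>_. x) = cls (\<lambda>_. y) \<Longrightarrow> x = y"
  using cls_eq_iff[OF BF_const BF_const, of x y] definite[of "x - y"]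
  by (simp add: tendsto_const_iff[OF nontrivial])

end

text \<open>Local linear approximations of \<open>f\<close> on the finite subsets of \<open>X\<close> are glued by taking an
  ultraproduct along the finite subsets and projecting back to \<open>Y\<close>. The index type of the
  hypothesis contains all finite subsets of \<open>X\<close>.\<close>

lemma ultrasummand_linear_approximation:
  fixes PX :: "'x::real_vector \<Rightarrow> real" and PY :: "'y::real_vector \<Rightarrow> real"
  assumes spX: "quasi_space UNIV PX DX" and spY: "quasi_space UNIV PY DY" and pY: "p_norm p PY"
    and us: "ultrasummand TYPE(('i \<times> 'x \<times> 'y) set) PY"
  obtains K where "0 \<le> K" and "\<And>f c. \<lbrakk>0 \<le> c; \<And>A. finite A \<Longrightarrow>
      \<exists>l. linear l \<and> (\<forall>x\<in>A. PY (f x - l x) \<le> c * PX x)\<rbrakk> \<Longrightarrow> lin_approx PX PY f (K * c)"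
proof -
  \<comment> \<open>\<open>emb\<close> encodes the finite subsets of \<open>X\<close> in the index
    type of the hypothesis and \<open>E\<close> decodes them. For every \<open>x\<close>,
    \<open>V\<close>-almost every index decodes to a finite set containing \<open>x\<close>.\<close>
  define emb :: "'x set \<Rightarrow> ('i \<times> 'x \<times> 'y) set"
    where "emb A = (\<lambda>x. (undefined, x, undefined)) ` A" for A
  define E :: "('i \<times> 'x \<times> 'y) set \<Rightarrow> 'x set" where "E j = (fst \<circ> snd) ` j" for j
  have E: "E (emb A) = A" for A by (simp add: E_def emb_def image_image)
  obtain V where V: "V \<le> filtermap emb (finite_subsets_at_top UNIV)" "ultrafilter V"
    using ultrafilter_le_exists[of "filtermap emb (finite_subsets_at_top UNIV)"]
    by (auto simp: filtermap_bot_iff)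
  have evE: "eventually (\<lambda>j. finite (E j) \<and> x \<in> E j) V" for x
  proof (rule filter_leD[OF V(1)])
    show "eventually (\<lambda>j. finite (E j) \<and> x \<in> E j) (filtermap emb (finite_subsets_at_top UNIV))"
      unfolding eventually_filtermap E eventually_finite_subsets_at_top
      by (rule exI[of _ "{x}"]) auto
  qed
  interpret X: quasi_space UNIV PX DX by fact
  interpret Y: quasi_space UNIV PY DY by fact
  interpret V: ultrapower_space PY DY V p by unfold_locales (fact V(2), fact pY)
  have "\<exists>P. ultra_bounded_operator V PY PY P \<and> (\<forall>\<xi>\<in>ultrapower V PY. P (P \<xi>) = P \<xi>) \<and>
      P ` ultrapower V PY = range (\<lambda>y. ultra_class V PY (\<lambda>_. y))"
    using us V(2) by (simp add: ultrasummand_def)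
  then obtain P where Pop: "ultra_bounded_operator V PY PY P"
    and PP: "\<forall>\<xi>\<in>ultrapower V PY. P (P \<xi>) = P \<xi>"
    and rangeP: "P ` ultrapower V PY = range (\<lambda>y. ultra_class V PY (\<lambda>_. y))"
    by (elim exE conjE) (rule that)
  have Padd: "P (ultra_add V PY \<xi> \<eta>) = ultra_add V PY (P \<xi>) (P \<eta>)"
    and Pscale: "P (ultra_scale V PY t \<xi>) = ultra_scale V PY t (P \<xi>)"
    if "\<xi> \<in> ultrapower V PY" "\<eta> \<in> ultrapower V PY" for \<xi> \<eta> t
    using Pop that by (simp_all add: ultra_bounded_operator_def)
  have "\<exists>K. \<forall>\<xi>\<in>ultrapower V PY. ultra_norm V PY (P \<xi>) \<le> K * ultra_norm V PY \<xi>"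
    using Pop by (simp add: ultra_bounded_operator_def)
  then obtain K where K: "\<And>\<xi>. \<xi> \<in> ultrapower V PY \<Longrightarrow> ultra_norm V PY (P \<xi>) \<le> K * ultra_norm V PY \<xi>"
    by blast
  have Pdiag: "P (V.cls (\<lambda>_. y)) = V.cls (\<lambda>_. y)" for y
  proof -
    obtain \<xi> where "\<xi> \<in> ultrapower V PY" "V.cls (\<lambda>_. y) = P \<xi>" using rangeP by blast
    then show ?thesis using PP by simp
  qed
  have "lin_approx PX PY f (\<bar>K\<bar> * c)"
    if c: "0 \<le> c" and ap: "\<And>A. finite A \<Longrightarrow> \<exists>l. linear l \<and> (\<forall>x\<in>A. PY (f x - l x) \<le> c * PX x)" for f c
  proof -
    have "\<forall>j. \<exists>l. finite (E j) \<longrightarrow> linear l \<and> (\<forall>x\<in>E j. PY (f x - l x) \<le> c * PX x)"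
      using ap by blast
    then obtain l where l: "\<And>j. finite (E j) \<Longrightarrow> linear (l j)"
      "\<And>j x. finite (E j) \<Longrightarrow> x \<in> E j \<Longrightarrow> PY (f x - l j x) \<le> c * PX x" by metis
    \<comment> \<open>The default 0 keeps \<open>a x\<close> a bounded family: each
      \<open>f x - a x j\<close> is at most \<open>max (c * PX x) (PY (f x))\<close>. It occurs only
      on a \<open>V\<close>-small set of indices and does not affect the class.\<close>
    define a where "a x j = (if finite (E j) \<and> x \<in> E j then l j x else 0)" for x j
    have aN: "PY (f x - a x j) \<le> max (c * PX x) (PY (f x))" for x j
      using l(2)[of j x] by (auto simp: a_def)
    have dBF: "(\<lambda>j. f x - a x j) \<in> V.BF" for x using aN by (rule V.BF_I)
    have aBF: "a x \<in> V.BF" for x using V.BF_diff[OF V.BF_const[of "f x"] dBF[of x]] by simp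
    have "\<forall>x. \<exists>y. P (V.cls (a x)) = V.cls (\<lambda>_. y)"
      using rangeP V.cls_in[OF aBF] by blast
    then obtain L where L: "\<And>x. P (V.cls (a x)) = V.cls (\<lambda>_. L x)" by metis
    have "linear L"
    proof (rule linearI)
      fix x y
      have ev: "eventually (\<lambda>j. a (x + y) j = a x j + a y j) V"
        using evE[of x] evE[of y] evE[of "x + y"]
        by eventually_elim (simp add: a_def linear_add[OF l(1)])
      have "V.cls (a (x + y)) = ultra_add V PY (V.cls (a x)) (V.cls (a y))"
        unfolding V.add_cls[OF aBF aBF] by (rule V.cls_cong[OF aBF V.BF_add[OF aBF aBF] ev])
      then have "V.cls (\<lambda>_. L (x + y)) = V.cls (\<lambda>_. L x + L y)"
        using Padd[OF V.cls_in[OF aBF[of x]] V.cls_in[OF aBF[of y]]]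
        by (simp add: L V.add_cls[OF V.BF_const V.BF_const] flip: L[of "x + y"])
      then show "L (x + y) = L x + L y" by (rule V.cls_const_inj)
    next
      fix t x
      have ev: "eventually (\<lambda>j. a (t *\<^sub>R x) j = t *\<^sub>R a x j) V"
        using evE[of x] evE[of "t *\<^sub>R x"]
        by eventually_elim (simp add: a_def linear_cmul[OF l(1)])
      have "V.cls (a (t *\<^sub>R x)) = ultra_scale V PY t (V.cls (a x))"
        unfolding V.scale_cls[OF aBF] using V.BF_scale[OF aBF, of "\<lambda>_. t" "\<bar>t\<bar>"]
        by (intro V.cls_cong[OF aBF _ ev]) auto
      then have "V.cls (\<lambda>_. L (t *\<^sub>R x)) = V.cls (\<lambda>_. t *\<^sub>R L x)"
        using Pscale[OF V.cls_in[OF aBF[of x]] V.cls_in[OF aBF[of x]], of t]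
        by (simp add: L V.scale_cls[OF V.BF_const] flip: L[of "t *\<^sub>R x"])
      then show "L (t *\<^sub>R x) = t *\<^sub>R L x" by (rule V.cls_const_inj)
    qed
    moreover have "PY (f x - L x) \<le> \<bar>K\<bar> * c * PX x" for x
    proof -
      \<comment> \<open>\<open>P\<close> fixes the diagonal, so \<open>f x - L x\<close> is the
        image under \<open>P\<close> of the class of \<open>f x - a x j\<close>, whose norm is at
        most \<open>c * PX x\<close>.\<close>
      have "V.cls (\<lambda>j. f x - a x j) = ultra_add V PY (V.cls (\<lambda>_. f x)) (ultra_scale V PY (-1) (V.cls (a x)))"
        by (rule V.diff_cls[OF V.BF_const aBF, symmetric])
      moreover have "ultra_scale V PY (-1) (V.cls (a x)) \<in> ultrapower V PY"
        using V.BF_scale[OF aBF[of x], of "\<lambda>_. -1" 1] by (simp add: V.scale_cls[OF aBF])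
      ultimately have "P (V.cls (\<lambda>j. f x - a x j)) =
          ultra_add V PY (V.cls (\<lambda>_. f x)) (ultra_scale V PY (-1) (V.cls (\<lambda>_. L x)))"
        using Padd[OF V.cls_in[OF V.BF_const]] Pscale[OF V.cls_in[OF aBF[of x]] V.cls_in[OF aBF[of x]]]
        by (simp add: Pdiag L)
      then have "P (V.cls (\<lambda>j. f x - a x j)) = V.cls (\<lambda>_. f x - L x)"
        by (simp add: V.diff_cls[OF V.BF_const V.BF_const])
      then have "PY (f x - L x) \<le> K * ultra_norm V PY (V.cls (\<lambda>j. f x - a x j))"
        using K[OF V.cls_in[OF dBF], of x] by (simp add: V.norm_cls_const)
      also have "\<dots> \<le> \<bar>K\<bar> * ultra_norm V PY (V.cls (\<lambda>j. f x - a x j))"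
        using V.norm_cls_nonneg[OF dBF] by (intro mult_right_mono) auto
      also have "\<dots> \<le> \<bar>K\<bar> * (c * PX x)"
      proof (intro mult_left_mono V.norm_cls_le[OF dBF])
        show "eventually (\<lambda>j. PY (f x - a x j) \<le> c * PX x) V"
          using evE[of x] by eventually_elim (simp add: a_def l(2))
      qed simp
      finally show ?thesis by (simp add: mult.assoc)
    qed
    ultimately show ?thesis unfolding lin_approx_def by blast
  qed
  then show ?thesis using that[of "\<bar>K\<bar>"] by simp
qed

section \<open>Accessible operators\<close>

text \<open>The family \<open>x\<close> picks a point of \<open>B\<close> violating
  \<open>R i\<close> wherever there is one, so \<open>R i (x i)\<close> at an index excludes all
  violations there. This turns statements about single families in an ultrapower into uniform ones
  on a ball.\<close>

lemma eventually_uniform: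
  assumes "d \<in> B" and "\<And>x. (\<And>i. x i \<in> B) \<Longrightarrow> eventually (\<lambda>i. R i (x i)) F"
  shows "eventually (\<lambda>i. \<forall>b\<in>B. R i b) F"
proof -
  define x where "x i = (if \<exists>b\<in>B. \<not> R i b then SOME b. b \<in> B \<and> \<not> R i b else d)" for i
  have x: "x i \<in> B \<and> (R i (x i) \<longrightarrow> (\<forall>b\<in>B. R i b))" for i
  proof (cases "\<exists>b\<in>B. \<not> R i b")
    case True
    then have "\<exists>b. b \<in> B \<and> \<not> R i b" by blast
    from someI_ex[OF this]
    have "(SOME b. b \<in> B \<and> \<not> R i b) \<in> B \<and> \<not> R i (SOME b. b \<in> B \<and> \<not> R i b)" .
    then show ?thesis using True by (simp add: x_def)
  next
    case False
    then show ?thesis using assms(1) by (auto simp: x_def)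
  qed
  have "eventually (\<lambda>i. R i (x i)) F" using x by (intro assms(2)) blast
  then show ?thesis by eventually_elim (use x in blast)
qed

text \<open>\<open>m i\<close> is the first \<open>n\<close> with \<open>i \<notin> A n\<close>. It
  exists for almost all \<open>i\<close>, because the complement of the intersection is large, and
  membership in \<open>A k\<close> for all \<open>k < n\<close> forces
  \<open>n \<le> m i\<close>.\<close>

lemma countably_incomplete_index:
  assumes "ultrafilter U" and "countably_incomplete U"
  shows "\<exists>m :: 'i \<Rightarrow> nat. \<forall>n. eventually (\<lambda>i. n \<le> m i) U"
proof -
  obtain A :: "nat \<Rightarrow> 'i set" where A: "\<And>n. eventually (\<lambda>i. i \<in> A n) U"
    and "\<not> eventually (\<lambda>i. i \<in> (\<Inter>n. A n)) U"
    using assms(2) unfolding countably_incomplete_def by blast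
  then have notA: "eventually (\<lambda>i. i \<notin> (\<Inter>n. A n)) U"
    using assms(1) unfolding ultrafilter_def by blast
  define m where "m i = (LEAST n. i \<notin> A n)" for i
  have "eventually (\<lambda>i. n \<le> m i) U" for n
  proof -
    have "eventually (\<lambda>i. \<forall>k\<in>{..<n}. i \<in> A k) U"
      using A by (intro eventually_ball_finite) auto
    with notA show ?thesis
    proof eventually_elim
      case (elim i)
      then obtain k where "i \<notin> A k" by blast
      then have "i \<notin> A (m i)" unfolding m_def by (rule LeastI)
      then show ?case using elim by (meson lessThan_iff not_le_imp_less)
    qed
  qed
  then show ?thesis by (intro exI allI)
qed

context quasi_pair
begin

lemma homogeneous_bound_from_ball:
  assumes f: "homogeneous f" and c: "\<And>x. NX x \<le> 1 \<Longrightarrow> NY (f x) \<le> c"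
  shows "NY (f x) \<le> c * NX x"
proof (cases "x = 0")
  case True
  then show ?thesis using homogeneous_zero[OF f] by simp
next
  case False
  then have Nx: "NX x > 0" using X.nonneg[of x] X.definite[of x] by fastforce
  have "NY (f (inverse (NX x) *\<^sub>R x)) \<le> c"
    using Nx by (intro c) (simp add: X.scale)
  moreover have "f (inverse (NX x) *\<^sub>R x) = inverse (NX x) *\<^sub>R f x"
    using f unfolding homogeneous_def by blast
  ultimately have "inverse (NX x) * NY (f x) \<le> c" using Nx by (simp add: Y.scale)
  then show ?thesis using Nx by (simp add: field_simps)
qed

lemma quasilinear_bound_from_ball:
  assumes f: "homogeneous f"
    and c: "\<And>x y. NX x \<le> 1 \<Longrightarrow> NX y \<le> 1 \<Longrightarrow> NY (f (x + y) - f x - f y) \<le> c"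
  shows "quasilinear_bound NX NY f c"
  unfolding quasilinear_bound_def
proof (intro allI)
  fix x y
  show "NY (f (x + y) - f x - f y) \<le> c * (NX x + NX y)"
  proof (cases "NX x + NX y = 0")
    case True
    then have "x = 0" "y = 0"
      using X.nonneg[of x] X.nonneg[of y] X.definite[of x] X.definite[of y] by auto
    then show ?thesis using homogeneous_zero[OF f] by simp
  next
    case False
    \<comment> \<open>Dividing by this sum brings both vectors into the unit ball.\<close>
    define r where "r = NX x + NX y"
    have r: "r > 0" using False X.nonneg[of x] X.nonneg[of y] by (simp add: r_def)
    have hf: "f (inverse r *\<^sub>R z) = inverse r *\<^sub>R f z" for z
      using f unfolding homogeneous_def by blast
    have "NX (inverse r *\<^sub>R x) \<le> 1" "NX (inverse r *\<^sub>R y) \<le> 1"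
      using r X.nonneg[of x] X.nonneg[of y] by (simp_all add: X.scale field_simps r_def)
    then have "NY (f (inverse r *\<^sub>R x + inverse r *\<^sub>R y) - f (inverse r *\<^sub>R x) - f (inverse r *\<^sub>R y)) \<le> c"
      by (rule c)
    also have "f (inverse r *\<^sub>R x + inverse r *\<^sub>R y) - f (inverse r *\<^sub>R x) - f (inverse r *\<^sub>R y)
        = inverse r *\<^sub>R (f (x + y) - f x - f y)"
      unfolding scaleR_add_right[symmetric] hf by (simp add: scaleR_diff_right)
    finally have "inverse r * NY (f (x + y) - f x - f y) \<le> c" using r by (simp add: Y.scale)
    then show ?thesis using r unfolding r_def[symmetric] by (simp add: field_simps)
  qed
qed

end

locale ultrapower_pair = X: ultrapower_space NX DX U p + Y: ultrapower_space NY DY U p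
  for NX :: "'a::real_vector \<Rightarrow> real" and DX and NY :: "'b::real_vector \<Rightarrow> real" and DY
    and U :: "'i filter" and p :: real
begin

sublocale quasi_pair NX DX NY DY ..

text \<open>The components of an accessible operator can be replaced by homogeneous maps: choose a unit
  vector on each line and use that the operator commutes with the scalars \<open>lim t\<^sub>i\<close>.\<close>

lemma accessible_operator_homogeneous:
  assumes "accessible_operator U NX NY F"
  obtains h where "\<And>i. homogeneous (h i)" and "is_ultraproduct_map U NX NY F h"
proof -
  obtain g where g: "is_ultraproduct_map U NX NY F g" and op: "ultra_bounded_operator U NX NY F"
    using assms unfolding accessible_operator_def accessible_def by blast
  have gBF: "(\<lambda>i. g i (x i)) \<in> Y.BF" and gF: "F (X.cls x) = Y.cls (\<lambda>i. g i (x i))"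
    if "x \<in> X.BF" for x
    using g that by (simp_all add: is_ultraproduct_map_def)
  have Fscale: "F (ultra_scale U NX r \<xi>) = ultra_scale U NY r (F \<xi>)" if "\<xi> \<in> ultrapower U NX" for r \<xi>
    using op that by (simp add: ultra_bounded_operator_def)
  obtain e t where et: "\<And>x. x = t x *\<^sub>R e x" "\<And>x. \<bar>t x\<bar> = NX x" "\<And>x. NX (e x) \<le> 1"
    "\<And>s x. t (s *\<^sub>R x) = s * t x" "\<And>s x. s \<noteq> 0 \<Longrightarrow> e (s *\<^sub>R x) = e x"
    by (rule line_section[OF X.quasi_space_axioms]) blast
  define h where "h i x = t x *\<^sub>R g i (e x)" for i x
  have hom: "homogeneous (h i)" for i
    unfolding h_def by (rule homogeneous_line_extension[OF et(4,5)])
  have "(\<lambda>i. h i (x i)) \<in> Y.BF \<and> F (X.cls x) = Y.cls (\<lambda>i. h i (x i))" if x: "x \<in> X.BF" for x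
  proof -
    obtain C where C: "0 \<le> C" "\<And>i. NX (x i) \<le> C" by (rule X.BF_E[OF x]) blast
    have tC: "\<bar>t (x i)\<bar> \<le> C" for i using C by (simp add: et)
    obtain T where T: "((\<lambda>i. t (x i)) \<longlongrightarrow> T) U"
      by (rule ultrafilter_bounded_convergent[OF X.ultra tC])
    have T0: "((\<lambda>i. \<bar>t (x i) - T\<bar> * c) \<longlongrightarrow> 0) U" for c
      using tendsto_mult_right[OF tendsto_rabs[OF tendsto_diff[OF T tendsto_const[of T]]], of c] by simp
    define ex where "ex = (\<lambda>i. e (x i))"
    define gx where "gx = (\<lambda>i. g i (ex i))"
    have ex: "ex \<in> X.BF" unfolding ex_def by (rule X.BF_I) (rule et(3))
    have gx: "gx \<in> Y.BF" unfolding gx_def by (rule gBF[OF ex])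
    have hx: "(\<lambda>i. h i (x i)) = (\<lambda>i. t (x i) *\<^sub>R gx i)" by (simp add: h_def gx_def ex_def)
    have hBF: "(\<lambda>i. t (x i) *\<^sub>R gx i) \<in> Y.BF" by (rule Y.BF_scale[OF gx tC])
    have TexBF: "(\<lambda>i. T *\<^sub>R ex i) \<in> X.BF" by (rule X.BF_scale[OF ex order_refl])
    have TgxBF: "(\<lambda>i. T *\<^sub>R gx i) \<in> Y.BF" by (rule Y.BF_scale[OF gx order_refl])
    obtain G where G: "0 \<le> G" "\<And>i. NY (gx i) \<le> G" by (rule Y.BF_E[OF gx]) blast
    \<comment> \<open>In the class the varying scalars may be replaced by their limit
      \<open>T\<close>, which \<open>F\<close> can pull out. Afterwards they are put back in
      \<open>Y\<close>, where the bound \<open>G\<close> makes the difference tend to 0.\<close>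
    have "X.cls x = X.cls (\<lambda>i. T *\<^sub>R ex i)"
      unfolding X.cls_eq_iff[OF x TexBF]
    proof (rule X.limit_zero_I[OF T0[of 1]], rule always_eventually, rule allI)
      fix i
      have "x i - T *\<^sub>R ex i = (t (x i) - T) *\<^sub>R e (x i)"
        using et(1)[of "x i"] by (simp add: ex_def scaleR_diff_left)
      then have "NX (x i - T *\<^sub>R ex i) = \<bar>t (x i) - T\<bar> * NX (e (x i))" by (simp add: X.scale)
      also have "\<dots> \<le> \<bar>t (x i) - T\<bar> * 1" by (intro mult_left_mono et(3)) simp
      finally show "NX (x i - T *\<^sub>R ex i) \<le> \<bar>t (x i) - T\<bar> * 1" .
    qed
    also have "\<dots> = ultra_scale U NX T (X.cls ex)" by (rule X.scale_cls[OF ex, symmetric])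
    finally have "F (X.cls x) = ultra_scale U NY T (F (X.cls ex))"
      using Fscale[OF X.cls_in[OF ex]] by simp
    also have "\<dots> = Y.cls (\<lambda>i. T *\<^sub>R gx i)"
      using gF[OF ex] Y.scale_cls[OF gx] by (simp add: gx_def)
    also have "\<dots> = Y.cls (\<lambda>i. t (x i) *\<^sub>R gx i)"
      unfolding Y.cls_eq_iff[OF TgxBF hBF]
    proof (rule Y.limit_zero_I[OF T0[of G]], rule always_eventually, rule allI)
      fix i
      have "T *\<^sub>R gx i - t (x i) *\<^sub>R gx i = (T - t (x i)) *\<^sub>R gx i" by (simp add: scaleR_diff_left)
      then have "NY (T *\<^sub>R gx i - t (x i) *\<^sub>R gx i) = \<bar>t (x i) - T\<bar> * NY (gx i)"
        by (simp add: Y.scale abs_minus_commute)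
      also have "\<dots> \<le> \<bar>t (x i) - T\<bar> * G" using G by (intro mult_left_mono) auto
      finally show "NY (T *\<^sub>R gx i - t (x i) *\<^sub>R gx i) \<le> \<bar>t (x i) - T\<bar> * G" .
    qed
    finally show ?thesis using hBF hx by simp
  qed
  then have "is_ultraproduct_map U NX NY F h" unfolding is_ultraproduct_map_def by blast
  then show ?thesis using that hom by blast
qed

text \<open>\<open>eventually_uniform\<close>, applied to single vectors and to pairs of the unit
  ball, yields the norm bound and the small defects. Linear maps within \<open>C0 * Q i\<close> of
  the components then define the same classes, since \<open>Q i\<close> tends to 0 along
  \<open>U\<close>.\<close>

lemma K0_fin_imp_ultraproduct_of_operators:
  assumes K0: "K0_fin NX NY" and acc: "accessible_operator U NX NY F"
  shows "ultraproduct_of_operators U NX NY F"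
proof -
  obtain h where hom: "\<And>i. homogeneous (h i)" and h: "is_ultraproduct_map U NX NY F h"
    using accessible_operator_homogeneous[OF acc] by blast
  have hBF: "(\<lambda>i. h i (x i)) \<in> Y.BF" and hF: "F (X.cls x) = Y.cls (\<lambda>i. h i (x i))"
    if "x \<in> X.BF" for x
    using h that by (simp_all add: is_ultraproduct_map_def)
  have op: "ultra_bounded_operator U NX NY F" using acc by (simp add: accessible_operator_def)
  have Fadd: "F (ultra_add U NX \<xi> \<eta>) = ultra_add U NY (F \<xi>) (F \<eta>)"
    if "\<xi> \<in> ultrapower U NX" "\<eta> \<in> ultrapower U NX" for \<xi> \<eta>
    using op that by (simp add: ultra_bounded_operator_def)
  have "\<exists>C. \<forall>\<xi>\<in>ultrapower U NX. ultra_norm U NY (F \<xi>) \<le> C * ultra_norm U NX \<xi>"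
    using op by (simp add: ultra_bounded_operator_def)
  then obtain C where C: "\<And>\<xi>. \<xi> \<in> ultrapower U NX \<Longrightarrow> ultra_norm U NY (F \<xi>) \<le> C * ultra_norm U NX \<xi>"
    by blast
  \<comment> \<open>The limits are at most \<open>\<bar>C\<bar>\<close>; the extra 1 makes the
    inequality strict, so that it holds at almost all indices.\<close>
  define c where "c = \<bar>C\<bar> + 1"
  have ev_bound: "eventually (\<lambda>i. \<forall>x\<in>{x. NX x \<le> 1}. NY (h i x) \<le> c) U"
  proof (rule eventually_uniform[of 0])
    fix x :: "'i \<Rightarrow> 'a" assume "\<And>i. x i \<in> {x. NX x \<le> 1}"
    then have x1: "\<And>i. NX (x i) \<le> 1" by simp
    have x: "x \<in> X.BF" using x1 by (rule X.BF_I)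
    have "ultra_norm U NY (Y.cls (\<lambda>i. h i (x i))) \<le> C * ultra_norm U NX (X.cls x)"
      using C[OF X.cls_in[OF x]] hF[OF x] by simp
    also have "\<dots> \<le> \<bar>C\<bar> * 1"
      using X.norm_cls_nonneg[OF x] X.norm_cls_le[OF x, of 1] x1 by (intro mult_mono) auto
    finally have "ultra_norm U NY (Y.cls (\<lambda>i. h i (x i))) < c" by (simp add: c_def)
    from order_tendstoD(2)[OF Y.norm_cls_tendsto[OF hBF[OF x]] this]
    show "eventually (\<lambda>i. NY (h i (x i)) \<le> c) U" by eventually_elim simp
  qed simp
  have ev_quasi: "eventually (\<lambda>i. quasilinear_bound NX NY (h i) \<epsilon>) U" if \<epsilon>: "\<epsilon> > 0" for \<epsilon>
  proof -
    let ?B = "{(x, y). NX x \<le> 1 \<and> NX y \<le> 1}"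
    have "eventually (\<lambda>i. \<forall>z\<in>?B. NY (h i (fst z + snd z) - h i (fst z) - h i (snd z)) \<le> \<epsilon>) U"
    proof (rule eventually_uniform[of "(0, 0)"])
      fix z :: "'i \<Rightarrow> 'a \<times> 'a" assume z: "\<And>i. z i \<in> ?B"
      define x where "x i = fst (z i)" for i
      define y where "y i = snd (z i)" for i
      have x: "x \<in> X.BF" and y: "y \<in> X.BF"
        using z by (auto simp: x_def y_def case_prod_unfold intro!: X.BF_I[of _ 1])
      note xy = X.BF_add[OF x y] and hxy = Y.BF_add[OF hBF[OF x] hBF[OF y]]
      have "Y.cls (\<lambda>i. h i (x i + y i)) = F (ultra_add U NX (X.cls x) (X.cls y))"
        using hF[OF xy] X.add_cls[OF x y] by simp
      also have "\<dots> = Y.cls (\<lambda>i. h i (x i) + h i (y i))"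
        using Fadd[OF X.cls_in[OF x] X.cls_in[OF y]] hF[OF x] hF[OF y]
          Y.add_cls[OF hBF[OF x] hBF[OF y]] by simp
      finally have "((\<lambda>i. NY (h i (x i + y i) - (h i (x i) + h i (y i)))) \<longlongrightarrow> 0) U"
        unfolding Y.cls_eq_iff[OF hBF[OF xy] hxy] .
      from order_tendstoD(2)[OF this \<epsilon>]
      show "eventually (\<lambda>i. NY (h i (fst (z i) + snd (z i)) - h i (fst (z i)) - h i (snd (z i))) \<le> \<epsilon>) U"
        by eventually_elim (simp add: x_def y_def diff_diff_eq)
    qed simp
    then show ?thesis
      by eventually_elim (rule quasilinear_bound_from_ball[OF hom], auto)
  qed
  obtain C0 where C0: "C0 \<ge> 0" "\<And>f Q. homogeneous f \<Longrightarrow> 0 \<le> Q \<Longrightarrow> quasilinear_bound NX NY f Q \<Longrightarrow>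
      (\<exists>b. \<forall>x. NY (f x) \<le> b * NX x) \<Longrightarrow> lin_approx NX NY f (C0 * Q)"
    using K0 unfolding K0_fin_def by blast
  define good where "good i \<longleftrightarrow> (\<forall>x. NY (h i x) \<le> c * NX x) \<and> quasilinear_bound NX NY (h i) 1" for i
  have ev_good: "eventually good U"
    using ev_bound ev_quasi[OF zero_less_one]
  proof eventually_elim
    case (elim i)
    then show ?case
      unfolding good_def using homogeneous_bound_from_ball[OF hom, of i c] by blast
  qed
  \<comment> \<open>One number per index serves every tolerance: the optimal constant lies below
    each bound that eventually holds, hence tends to 0.\<close>
  define Q where "Q i = quasilinear_const NX NY (h i)" for i
  have quasi: "quasilinear NX NY (h i)" if "good i" for i
    using that hom unfolding good_def quasilinear_def by blast
  have Q: "0 \<le> Q i" "Q i \<le> 1" "quasilinear_bound NX NY (h i) (Q i)" if "good i" for i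
    using quasilinear_const_bound[OF quasi[OF that]] that
    by (auto simp: Q_def good_def intro: quasilinear_const_le)
  have "\<forall>i. \<exists>l. good i \<longrightarrow> linear l \<and> (\<forall>x. NY (h i x - l x) \<le> C0 * Q i * NX x)"
  proof
    fix i
    show "\<exists>l. good i \<longrightarrow> linear l \<and> (\<forall>x. NY (h i x - l x) \<le> C0 * Q i * NX x)"
    proof (cases "good i")
      case True
      then have "\<exists>b. \<forall>x. NY (h i x) \<le> b * NX x" unfolding good_def by blast
      from C0(2)[OF hom Q(1,3)[OF True] this] show ?thesis unfolding lin_approx_def by blast
    qed simp
  qed
  then obtain l where l: "\<And>i. good i \<Longrightarrow> linear (l i)"
    "\<And>i x. good i \<Longrightarrow> NY (h i x - l i x) \<le> C0 * Q i * NX x" by metis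
  \<comment> \<open>The uniform bound has to hold at every index, the class only sees almost all of
    them; hence 0 off the good indices.\<close>
  define u where "u i = (if good i then l i else (\<lambda>_. 0))" for i
  have "linear (u i)" for i
    using l(1) by (auto simp: u_def intro!: linearI)
  moreover have uN: "NY (u i x) \<le> DY * (C0 + c) * NX x" for i x
  proof (cases "good i")
    case True
    have "NY (u i x) \<le> DY * (NY (h i x - u i x) + NY (h i x))"
      using Y.triangle_from[of "u i x" "h i x"] Y.diff_commute[of "u i x" "h i x"] by simp
    also have "\<dots> \<le> DY * (C0 * Q i * NX x + c * NX x)"
      using True l(2)[OF True, of x] Y.D_pos unfolding u_def good_def
      by (intro mult_left_mono add_mono) auto
    also have "\<dots> \<le> DY * (C0 * 1 * NX x + c * NX x)"
      using Q(2)[OF True] C0(1) Y.D_pos X.nonneg[of x]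
      by (intro mult_left_mono add_mono mult_right_mono) auto
    finally show ?thesis by (simp add: algebra_simps)
  next
    case False
    then show ?thesis using Y.D_pos C0(1) X.nonneg[of x] by (simp add: u_def c_def)
  qed
  moreover have "is_ultraproduct_map U NX NY F u"
    unfolding is_ultraproduct_map_def
  proof (rule ballI)
    fix x assume x: "x \<in> X.BF"
    obtain B where B: "0 \<le> B" "\<And>i. NX (x i) \<le> B" by (rule X.BF_E[OF x]) blast
    have "0 \<le> DY * (C0 + c)" using Y.D_pos C0(1) by (simp add: c_def)
    then have uBF: "(\<lambda>i. u i (x i)) \<in> Y.BF"
      using order_trans[OF uN mult_left_mono[OF B(2)]] by (intro Y.BF_I) blast
    have "((\<lambda>i. if good i then Q i else 0) \<longlongrightarrow> 0) U"
    proof (rule tendstoI)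
      fix \<epsilon> :: real assume \<epsilon>: "\<epsilon> > 0"
      then have "eventually (\<lambda>i. quasilinear_bound NX NY (h i) (\<epsilon> / 2)) U"
        by (intro ev_quasi) simp
      then show "eventually (\<lambda>i. dist (if good i then Q i else 0) 0 < \<epsilon>) U"
      proof eventually_elim
        case (elim i)
        then show ?case
          using Q(1)[of i] quasilinear_const_le[OF _ elim] \<epsilon> by (auto simp: Q_def dist_real_def)
      qed
    qed
    from tendsto_mult_right[OF tendsto_mult_left[OF this, of C0], of B]
    have "((\<lambda>i. C0 * (if good i then Q i else 0) * B) \<longlongrightarrow> 0) U" by simp
    then have "((\<lambda>i. NY (h i (x i) - u i (x i))) \<longlongrightarrow> 0) U"
    proof (rule Y.limit_zero_I)
      show "eventually (\<lambda>i. NY (h i (x i) - u i (x i)) \<le> C0 * (if good i then Q i else 0) * B) U"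
        using ev_good
      proof eventually_elim
        case (elim i)
        have "NY (h i (x i) - u i (x i)) \<le> C0 * Q i * NX (x i)"
          using l(2)[OF elim] elim by (simp add: u_def)
        also have "\<dots> \<le> C0 * Q i * B"
          using B(2) C0(1) Q(1)[OF elim] by (intro mult_left_mono) auto
        finally show ?case using elim by simp
      qed
    qed
    then have "Y.cls (\<lambda>i. h i (x i)) = Y.cls (\<lambda>i. u i (x i))"
      unfolding Y.cls_eq_iff[OF hBF[OF x] uBF] .
    then show "(\<lambda>i. u i (x i)) \<in> Y.BF \<and> F (X.cls x) = Y.cls (\<lambda>i. u i (x i))"
      using uBF hF[OF x] by simp
  qed
  ultimately show ?thesis unfolding ultraproduct_of_operators_def by blast
qed

text \<open>The distance to the linear maps need not be attained, so a threshold is found by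
  halving: some \<open>c\<close> admits a linear map within \<open>c\<close> of \<open>f\<close>,
  but \<open>c / 2\<close> does not. Subtracting that map and dividing by \<open>c\<close> gives
  norm at most 1 and no linear map within \<open>1 / 2\<close>; since \<open>c\<close> exceeds
  \<open>real (Suc n) * Q\<close>, the defect drops below \<open>1 / real (Suc n)\<close>.\<close>

lemma not_K0_fin_normalized:
  assumes K0: "\<not> K0_fin NX NY"
  shows "\<exists>g. homogeneous g \<and> (\<forall>x. NY (g x) \<le> NX x) \<and> quasilinear_bound NX NY g (1 / real (Suc n)) \<and>
    \<not> lin_approx NX NY g (1 / 2)"
proof -
  let ?n = "real (Suc n)"
  have "\<exists>f Q. homogeneous f \<and> 0 \<le> Q \<and> quasilinear_bound NX NY f Q \<and>
     (\<exists>b. \<forall>x. NY (f x) \<le> b * NX x) \<and> \<not> lin_approx NX NY f (?n * Q)"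
    using K0 of_nat_0_le_iff[of "Suc n"] unfolding K0_fin_def by blast
  then obtain f Q b where f: "homogeneous f" "0 \<le> Q" "quasilinear_bound NX NY f Q"
    and b: "\<And>x. NY (f x) \<le> b * NX x" and far: "\<not> lin_approx NX NY f (?n * Q)" by blast
  have "Q \<noteq> 0"
  proof
    assume "Q = 0"
    then have "f (x + y) - f x - f y = 0" for x y
      using f(3) Y.nonneg[of "f (x + y) - f x - f y"] unfolding quasilinear_bound_def
      by (intro Y.definite) (auto intro: antisym)
    then have "linear f" using f(1) by (intro linearI) (auto simp: homogeneous_def algebra_simps)
    then have "lin_approx NX NY f 0" unfolding lin_approx_def by (intro exI[of _ f]) simp
    then show False using far \<open>Q = 0\<close> by simp
  qed
  then have Q: "Q > 0" using f(2) by simp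
  define r where "r k = \<bar>b\<bar> * (1 / 2) ^ k" for k
  have far': "?n * Q < c" if "lin_approx NX NY f c" for c
    using far lin_approx_mono[OF that, of "?n * Q"] by linarith
  have "\<exists>k. lin_approx NX NY f (r k) \<and> \<not> lin_approx NX NY f (r (Suc k))"
  proof (rule ccontr)
    assume no: "\<not> ?thesis"
    have all: "lin_approx NX NY f (r k)" for k
    proof (induction k)
      case 0
      have "NY (f x - 0) \<le> \<bar>b\<bar> * NX x" for x
        using order_trans[OF b mult_right_mono[OF abs_ge_self X.nonneg]] by simp
      then show ?case
        unfolding lin_approx_def r_def by (intro exI[of _ "\<lambda>_. 0"]) (auto intro: linearI)
    next
      case (Suc k)
      then show ?case using no by blast
    qed
    have "r \<longlonglongrightarrow> 0"
      unfolding r_def using tendsto_mult_left[OF LIMSEQ_power_zero[of "1 / 2 :: real"], of "\<bar>b\<bar>"] by simp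
    then have "eventually (\<lambda>k. r k < ?n * Q) sequentially"
      using Q by (intro order_tendstoD(2)) auto
    then obtain k where "r k < ?n * Q" using eventually_happens' sequentially_bot by blast
    then show False using far'[OF all, of k] by simp
  qed
  then obtain k where k: "lin_approx NX NY f (r k)" "\<not> lin_approx NX NY f (r (Suc k))" by blast
  define c where "c = r k"
  have cQ: "?n * Q < c" using far'[OF k(1)] by (simp add: c_def)
  have c: "c > 0" using Q cQ by (smt (verit) mult_nonneg_nonneg of_nat_0_le_iff)
  obtain l where l: "linear l" "\<And>x. NY (f x - l x) \<le> c * NX x"
    using k(1) unfolding lin_approx_def c_def by blast
  define g where "g x = (1 / c) *\<^sub>R (f x - l x)" for x
  have "homogeneous g"
    unfolding g_def by (intro homogeneous_scale homogeneous_diff f homogeneous_linear l)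
  moreover have "NY (g x) \<le> NX x" for x
  proof -
    have "NY (g x) = 1 / c * NY (f x - l x)"
      unfolding g_def using Y.scale[of "f x - l x" "1 / c"] c by simp
    then have "c * NY (g x) \<le> c * NX x" using l(2)[of x] c by simp
    then show ?thesis using c by (simp only: mult_le_cancel_left_pos)
  qed
  moreover have "quasilinear_bound NX NY g (1 / ?n)"
    unfolding quasilinear_bound_def
  proof (intro allI)
    fix x y
    have "(f (x + y) - l (x + y)) - (f x - l x) - (f y - l y) = f (x + y) - f x - f y"
      by (simp add: linear_add[OF l(1)])
    then have "g (x + y) - g x - g y = (1 / c) *\<^sub>R (f (x + y) - f x - f y)"
      unfolding g_def scaleR_diff_right[symmetric] by (rule arg_cong)
    then have "NY (g (x + y) - g x - g y) = 1 / c * NY (f (x + y) - f x - f y)"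
      using c Y.scale[of "f (x + y) - f x - f y" "1 / c"] by simp
    also have "\<dots> \<le> 1 / c * (Q * (NX x + NX y))"
      using f(3) c unfolding quasilinear_bound_def by (intro mult_left_mono) auto
    also have "\<dots> = Q / c * (NX x + NX y)" by simp
    also have "\<dots> \<le> 1 / ?n * (NX x + NX y)"
      using cQ c X.nonneg[of x] X.nonneg[of y]
      by (intro mult_right_mono) (auto simp: field_simps)
    finally show "NY (g (x + y) - g x - g y) \<le> 1 / ?n * (NX x + NX y)" .
  qed
  moreover have "\<not> lin_approx NX NY g (1 / 2)"
  proof
    assume "lin_approx NX NY g (1 / 2)"
    then obtain l' where l': "linear l'" "\<And>x. NY (g x - l' x) \<le> 1 / 2 * NX x"
      unfolding lin_approx_def by blast
    have "NY (f x - (l x + c *\<^sub>R l' x)) \<le> r (Suc k) * NX x" for x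
    proof -
      have "f x - (l x + c *\<^sub>R l' x) = c *\<^sub>R (g x - l' x)"
        using c by (simp add: g_def scaleR_diff_right)
      then have "NY (f x - (l x + c *\<^sub>R l' x)) = c * NY (g x - l' x)"
        using c Y.scale[of "g x - l' x" c] by simp
      also have "\<dots> \<le> c * (1 / 2 * NX x)" using l'(2) c by (intro mult_left_mono) auto
      finally show ?thesis by (simp add: c_def r_def)
    qed
    moreover have "linear (\<lambda>x. l x + c *\<^sub>R l' x)"
      by (intro linear_compose_add linear_compose_scale_right l l')
    ultimately show False using k(2) unfolding lin_approx_def by blast
  qed
  ultimately show ?thesis by blast
qed

text \<open>The defects \<open>\<epsilon> i\<close> vanish along \<open>U\<close>, so maps that are
  additive at no single index induce an additive map of the ultrapowers. Being far from every linear
  map survives at each index and contradicts a representation by operators.\<close>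

lemma ultraproducts_imp_K0_fin:
  assumes inc: "countably_incomplete U"
    and all: "\<And>F. accessible_operator U NX NY F \<Longrightarrow> ultraproduct_of_operators U NX NY F"
  shows "K0_fin NX NY"
proof (rule ccontr)
  assume "\<not> K0_fin NX NY"
  then obtain G where G: "\<And>n. homogeneous (G n)" "\<And>n x. NY (G n x) \<le> NX x"
    "\<And>n. quasilinear_bound NX NY (G n) (1 / real (Suc n))" "\<And>n. \<not> lin_approx NX NY (G n) (1 / 2)"
    using not_K0_fin_normalized by metis
  obtain m :: "'i \<Rightarrow> nat" where m: "\<And>n. eventually (\<lambda>i. n \<le> m i) U"
    using countably_incomplete_index[OF X.ultra inc] by blast
  define h where "h i = G (m i)" for i
  define \<epsilon> where "\<epsilon> i = 1 / real (Suc (m i))" for i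
  have \<epsilon>: "(\<epsilon> \<longlongrightarrow> 0) U"
  proof -
    have "filterlim m sequentially U" using m by (simp add: filterlim_at_top)
    from filterlim_compose[OF LIMSEQ_inverse_real_of_nat this]
    show ?thesis by (simp add: \<epsilon>_def[abs_def] inverse_eq_divide)
  qed
  have \<epsilon>0: "0 \<le> \<epsilon> i" for i by (simp add: \<epsilon>_def)
  have hom: "h i (r *\<^sub>R x) = r *\<^sub>R h i x" for i r x
    using G(1) unfolding h_def homogeneous_def by blast
  have hN: "NY (h i x) \<le> NX x" for i x by (simp add: h_def G(2))
  have hQ: "NY (h i (x + y) - h i x - h i y) \<le> \<epsilon> i * (NX x + NX y)" for i x y
    using G(3)[of "m i"] unfolding quasilinear_bound_def h_def \<epsilon>_def by blast
  have hBF: "(\<lambda>i. h i (x i)) \<in> Y.BF" if x: "x \<in> X.BF" for x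
  proof -
    obtain B where "\<And>i. NX (x i) \<le> B" by (rule X.BF_E[OF x]) blast
    then show ?thesis using hN by (intro Y.BF_I[of _ B]) (meson order_trans)
  qed
  have hadd: "((\<lambda>i. NY (h i (x i + y i) - h i (x i) - h i (y i))) \<longlongrightarrow> 0) U"
    if x: "x \<in> X.BF" and y: "y \<in> X.BF" for x y
  proof -
    obtain B where B: "\<And>i. NX (x i) \<le> B" by (rule X.BF_E[OF x]) blast
    obtain E where E: "\<And>i. NX (y i) \<le> E" by (rule X.BF_E[OF y]) blast
    show ?thesis
    proof (rule Y.limit_zero_I)
      show "((\<lambda>i. \<epsilon> i * (B + E)) \<longlongrightarrow> 0) U" using tendsto_mult_right[OF \<epsilon>, of "B + E"] by simp
      have "NY (h i (x i + y i) - h i (x i) - h i (y i)) \<le> \<epsilon> i * (B + E)" for i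
        by (rule order_trans[OF hQ]) (intro mult_left_mono add_mono B E \<epsilon>0)
      then show "eventually (\<lambda>i. NY (h i (x i + y i) - h i (x i) - h i (y i)) \<le> \<epsilon> i * (B + E)) U"
        by simp
    qed
  qed
  \<comment> \<open>Near-additivity replaces uniform continuity: \<open>h i (x i)\<close> is close
    to \<open>h i (x i - y i) + h i (y i)\<close>, and the first summand tends to 0 by the norm
    bound.\<close>
  have cong: "Y.cls (\<lambda>i. h i (x i)) = Y.cls (\<lambda>i. h i (y i))"
    if x: "x \<in> X.BF" and y: "y \<in> X.BF" and eq: "X.cls x = X.cls y" for x y
  proof -
    have d: "((\<lambda>i. NX (x i - y i)) \<longlongrightarrow> 0) U" using eq X.cls_eq_iff[OF x y] by simp
    have "((\<lambda>i. NY (h i (x i - y i))) \<longlongrightarrow> 0) U" by (rule Y.limit_zero_I[OF d]) (simp add: hN)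
    from Y.limit_zero_add[OF hadd[OF X.BF_diff[OF x y] y] this]
    show ?thesis unfolding Y.cls_eq_iff[OF hBF[OF x] hBF[OF y]] by simp
  qed
  define F where "F \<xi> = Y.cls (\<lambda>i. h i ((SOME x. x \<in> \<xi>) i))" for \<xi>
  have F: "F (X.cls x) = Y.cls (\<lambda>i. h i (x i))" if x: "x \<in> X.BF" for x
  proof -
    define y where "y = (SOME y. y \<in> X.cls x)"
    have "y \<in> X.cls x"
      unfolding y_def by (rule someI[where P="\<lambda>y. y \<in> X.cls x", OF X.cls_self[OF x]])
    then show ?thesis unfolding F_def y_def[symmetric] using X.cls_memD[of y x] x by (intro cong) auto
  qed
  have "is_ultraproduct_map U NX NY F h"
    unfolding is_ultraproduct_map_def using hBF F by blast
  moreover have "ultra_bounded_operator U NX NY F"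
    unfolding ultra_bounded_operator_def
  proof (intro conjI ballI allI exI[of _ 1])
    fix \<xi> assume "\<xi> \<in> ultrapower U NX"
    then obtain x where x: "x \<in> X.BF" "\<xi> = X.cls x" by (rule X.ultrapower_E)
    show "F \<xi> \<in> ultrapower U NY" using F[OF x(1)] hBF[OF x(1)] x(2) by simp
    show "F (ultra_scale U NX r \<xi>) = ultra_scale U NY r (F \<xi>)" for r
      using F[OF X.BF_scale[OF x(1), of "\<lambda>_. r" "\<bar>r\<bar>"]] F[OF x(1)]
      by (simp add: x(2) X.scale_cls[OF x(1)] Y.scale_cls[OF hBF[OF x(1)]] hom)
    show "ultra_norm U NY (F \<xi>) \<le> 1 * ultra_norm U NX \<xi>"
      unfolding x(2) F[OF x(1)] mult_1
      by (rule tendsto_le[OF X.nontrivial X.norm_cls_tendsto[OF x(1)] Y.norm_cls_tendsto[OF hBF[OF x(1)]]])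
        (simp add: hN)
    fix \<eta> assume "\<eta> \<in> ultrapower U NX"
    then obtain y where y: "y \<in> X.BF" "\<eta> = X.cls y" by (rule X.ultrapower_E)
    have "Y.cls (\<lambda>i. h i (x i + y i)) = Y.cls (\<lambda>i. h i (x i) + h i (y i))"
      unfolding Y.cls_eq_iff[OF hBF[OF X.BF_add[OF x(1) y(1)]] Y.BF_add[OF hBF[OF x(1)] hBF[OF y(1)]]]
      using hadd[OF x(1) y(1)] by (simp add: diff_diff_eq)
    then show "F (ultra_add U NX \<xi> \<eta>) = ultra_add U NY (F \<xi>) (F \<eta>)"
      by (simp add: x(2) y(2) X.add_cls[OF x(1) y(1)] F[OF X.BF_add[OF x(1) y(1)]] F[OF x(1)] F[OF y(1)]
          Y.add_cls[OF hBF[OF x(1)] hBF[OF y(1)]])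
  qed
  ultimately have "accessible_operator U NX NY F"
    unfolding accessible_operator_def accessible_def by blast
  then obtain u where u: "\<And>i. linear (u i)" and uF: "is_ultraproduct_map U NX NY F u"
    using all unfolding ultraproduct_of_operators_def by blast
  \<comment> \<open>Equal classes for all families in the unit ball give closeness uniform in
    \<open>x\<close> at almost every index; one such index suffices for the contradiction.\<close>
  have "eventually (\<lambda>i. \<forall>x\<in>{x. NX x \<le> 1}. NY (h i x - u i x) \<le> 1 / 2) U"
  proof (rule eventually_uniform[of 0])
    fix x :: "'i \<Rightarrow> 'a" assume "\<And>i. x i \<in> {x. NX x \<le> 1}"
    then have x: "x \<in> X.BF" by (intro X.BF_I[of _ 1]) simp
    have uBF: "(\<lambda>i. u i (x i)) \<in> Y.BF" and "F (X.cls x) = Y.cls (\<lambda>i. u i (x i))"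
      using uF x by (simp_all add: is_ultraproduct_map_def)
    then have "((\<lambda>i. NY (h i (x i) - u i (x i))) \<longlongrightarrow> 0) U"
      using F[OF x] Y.cls_eq_iff[OF hBF[OF x] uBF] by simp
    from order_tendstoD(2)[OF this, of "1 / 2"]
    have "eventually (\<lambda>i. NY (h i (x i) - u i (x i)) < 1 / 2) U" by simp
    then show "eventually (\<lambda>i. NY (h i (x i) - u i (x i)) \<le> 1 / 2) U"
      by eventually_elim simp
  qed simp
  then obtain i where i: "\<forall>x\<in>{x. NX x \<le> 1}. NY (h i x - u i x) \<le> 1 / 2"
    using eventually_happens'[OF X.nontrivial] by blast
  have "NY (h i x - u i x) \<le> 1 / 2 * NX x" for x
  proof (rule homogeneous_bound_from_ball[where f="\<lambda>x. h i x - u i x"])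
    show "homogeneous (\<lambda>x. h i x - u i x)"
      unfolding h_def by (intro homogeneous_diff G(1) homogeneous_linear u)
  qed (use i in simp)
  then show False using G(4)[of "m i"] u unfolding lin_approx_def h_def by blast
qed

end

text \<open>The approximation on finite sets takes place in \<open>NX\<close>, \<open>NY\<close>, to
  which the approximation property refers; the gluing takes place in \<open>PX\<close>,
  \<open>PY\<close>, whose ultrapower carries the projection. The constant \<open>a\<close> converts
  in both directions.\<close>

lemma K0_fin_imp_K_fin:
  fixes NX PX :: "'x::real_vector \<Rightarrow> real" and NY PY :: "'y::real_vector \<Rightarrow> real"
  assumes sp: "quasi_space UNIV NX DX" "quasi_space UNIV NY DY"
    "quasi_space UNIV PX FX" "quasi_space UNIV PY FY"
    and eq: "equivalent_quasinorms NX PX" "equivalent_quasinorms NY PY"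
    and pY: "p_norm p PY" and us: "ultrasummand TYPE(('i \<times> 'x \<times> 'y) set) PY"
    and BAP: "BAP NX \<or> (K_space NX \<and> BAP NY)" and K0: "K0_fin NX NY"
  shows "K_fin NX NY"
proof -
  interpret NX: quasi_space UNIV NX DX by fact
  interpret NY: quasi_space UNIV NY DY by fact
  interpret quasi_pair NX DX NY DY ..
  obtain a where a: "a > 0"
    "\<And>c x y. 0 \<le> c \<Longrightarrow> NY y \<le> c * NX x \<Longrightarrow> PY y \<le> a * c * PX x"
    "\<And>c x y. 0 \<le> c \<Longrightarrow> PY y \<le> c * PX x \<Longrightarrow> NY y \<le> a * c * NX x"
    by (rule quasilinear_equivalent[OF sp eq]) blast
  obtain C where C: "0 \<le> C" "\<And>f Q A. \<lbrakk>homogeneous f; 0 \<le> Q; quasilinear_bound NX NY f Q; finite A\<rbrakk> \<Longrightarrow>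
    \<exists>l. linear l \<and> (\<forall>x\<in>A. NY (f x - l x) \<le> C * Q * NX x)"
    using finite_approximation[OF K0 BAP] by blast
  obtain K where K: "0 \<le> K" "\<And>f c. \<lbrakk>0 \<le> c; \<And>A. finite A \<Longrightarrow>
      \<exists>l. linear l \<and> (\<forall>x\<in>A. PY (f x - l x) \<le> c * PX x)\<rbrakk> \<Longrightarrow> lin_approx PX PY f (K * c)"
    using ultrasummand_linear_approximation[OF sp(3,4) pY us] by blast
  have "lin_approx NX NY f (a * K * a * C * Q)"
    if f: "homogeneous f" "0 \<le> Q" "quasilinear_bound NX NY f Q" for f Q
  proof -
    have CQ: "0 \<le> C * Q" using C(1) f(2) by simp
    have "lin_approx PX PY f (K * (a * (C * Q)))"
    proof (rule K(2))
      show "0 \<le> a * (C * Q)" using a(1) CQ by simp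
      fix A :: "'x set" assume "finite A"
      then obtain l where "linear l" "\<forall>x\<in>A. NY (f x - l x) \<le> C * Q * NX x"
        using C(2)[OF f] by blast
      then show "\<exists>l. linear l \<and> (\<forall>x\<in>A. PY (f x - l x) \<le> a * (C * Q) * PX x)"
        using a(2)[OF CQ] by blast
    qed
    then obtain l where l: "linear l" "\<And>x. PY (f x - l x) \<le> K * (a * (C * Q)) * PX x"
      unfolding lin_approx_def by blast
    have "NY (f x - l x) \<le> a * (K * (a * (C * Q))) * NX x" for x
      using a(1) K(1) CQ by (intro a(3) l) simp
    then show ?thesis unfolding lin_approx_def using l(1) by (auto simp: mult_ac)
  qed
  moreover have "0 \<le> a * K * a * C" using a(1) K(1) C(1) by simp
  ultimately show ?thesis unfolding K_fin_def by blast
qed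

lemma trivial_imp_exact_sequences_split:
  assumes "quasi_banach NX" and "quasi_banach NY"
    and "\<And>f. quasilinear NX NY f \<Longrightarrow> trivial_quasilinear NX NY f"
  shows "exact_sequences_split TYPE('z::real_vector) NY NX"
  unfolding exact_sequences_split_def
proof (intro allI impI, elim conjE)
  fix NZ :: "'z \<Rightarrow> real" and j q
  assume "quasi_banach NZ" "short_exact NY NZ NX j q"
  then show "sequence_splits NY NZ j" by (rule trivial_imp_sequence_splits[OF assms(1,2)]) (rule assms(3))
qed

text \<open>Exact sequences are first quantified over middle spaces on the type
  \<open>'y \<times> 'x\<close>, which carries all twisted sums; the last conjunct passes to an
  arbitrary type \<open>'z\<close>.\<close>

theorem corollary7:
  fixes U :: "'i filter"
    and NX PX :: "'x::real_vector \<Rightarrow> real"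
    and NY PY :: "'y::real_vector \<Rightarrow> real"
    and p :: real
  assumes "ultrafilter U" and "countably_incomplete U"
    and "quasi_banach NX" and "quasi_banach NY"
    and "p_norm p PX" and "equivalent_quasinorms NX PX"
    and "p_norm p PY" and "equivalent_quasinorms NY PY"
    and "ultrasummand TYPE(('i \<times> 'x \<times> 'y) set) PY"
    and "BAP NX \<or> (K_space NX \<and> BAP NY)"
  shows "((\<forall>f. accessible_operator U PX PY f \<longrightarrow> ultraproduct_of_operators U PX PY f)
            \<longleftrightarrow> K_const NX NY < \<infinity>) \<and>
         (K_const NX NY < \<infinity> \<longleftrightarrow> K0_const NX NY < \<infinity>) \<and>
         (K0_const NX NY < \<infinity>
            \<longleftrightarrow> (\<forall>f. quasilinear NX NY f \<longrightarrow> trivial_quasilinear NX NY f)) \<and>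
         ((\<forall>f. quasilinear NX NY f \<longrightarrow> trivial_quasilinear NX NY f)
            \<longleftrightarrow> exact_sequences_split TYPE('y \<times> 'x) NY NX) \<and>
         (exact_sequences_split TYPE('y \<times> 'x) NY NX
            \<longrightarrow> exact_sequences_split TYPE('z::real_vector) NY NX)"
proof -
  obtain DX where X: "complete_quasi_space UNIV NX DX"
    using assms(3) quasi_banach_complete_quasi_space by blast
  obtain DY where Y: "complete_quasi_space UNIV NY DY"
    using assms(4) quasi_banach_complete_quasi_space by blast
  interpret X: complete_quasi_space UNIV NX DX by fact
  interpret Y: complete_quasi_space UNIV NY DY by fact
  interpret N: quasi_pair NX DX NY DY ..
  obtain FX where PX: "quasi_space UNIV PX FX"
    using assms(5) quasinorm_quasi_space unfolding p_norm_def by blast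
  obtain FY where PY: "quasi_space UNIV PY FY"
    using assms(7) quasinorm_quasi_space unfolding p_norm_def by blast
  interpret PX: quasi_space UNIV PX FX by fact
  interpret PY: quasi_space UNIV PY FY by fact
  interpret P: ultrapower_pair PX FX PY FY U p
    by unfold_locales (fact assms)+
  note NX = X.quasi_space_axioms and NY = Y.quasi_space_axioms
  define T where "T \<longleftrightarrow> (\<forall>f. quasilinear NX NY f \<longrightarrow> trivial_quasilinear NX NY f)"
  have "(\<forall>f. accessible_operator U PX PY f \<longrightarrow> ultraproduct_of_operators U PX PY f) \<longleftrightarrow> K0_fin PX PY"
    using P.K0_fin_imp_ultraproduct_of_operators P.ultraproducts_imp_K0_fin[OF assms(2)] by metis
  also have "\<dots> \<longleftrightarrow> K0_fin NX NY"
    using K0_fin_equivalent[OF NX NY PX PY assms(6,8)]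
      K0_fin_equivalent[OF PX PY NX NY equivalent_quasinorms_sym[OF assms(6)]
        equivalent_quasinorms_sym[OF assms(8)]] by (rule iffI[rotated])
  finally have acc: "(\<forall>f. accessible_operator U PX PY f \<longrightarrow> ultraproduct_of_operators U PX PY f)
    \<longleftrightarrow> K0_fin NX NY" .
  have K: "K0_fin NX NY \<longleftrightarrow> K_fin NX NY"
    using K0_fin_imp_K_fin[OF NX NY PX PY assms(6,8,7,9,10)] K_fin_imp_K0_fin by (rule iffI)
  have T: "K_fin NX NY \<longleftrightarrow> T"
    unfolding T_def using N.K_fin_imp_trivial trivial_imp_K_fin[OF NX Y] by metis
  have T_split: T if "exact_sequences_split TYPE('y \<times> 'x) NY NX"
    unfolding T_def using sequences_split_imp_trivial[OF assms(3,4) that] by simp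
  have "exact_sequences_split TYPE('y \<times> 'x) NY NX"
    "exact_sequences_split TYPE('z) NY NX" if T
    using that unfolding T_def by (auto intro: trivial_imp_exact_sequences_split[OF assms(3,4)])
  then show ?thesis
    unfolding N.K_const_finite_iff N.K0_const_finite_iff acc K T T_def[symmetric]
    using T_split by blast
qed

end
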